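(* Let $Y$ be an ICCSS$(p,q)$ process with $p>q>0$. Suppose $S\subseteq V=\{1,\dots,k\}$ and $a\in V$. Then, for $h\ge0$ and $t\in\mathbb R$, $\mathbb P$-a.s., $$\begin{aligned} P_{\mathcal L_{Y_S}(t)}Y_a(t+h)=&\sum_{v\in S}\int_{-\infty}^te_a^\top\mathbf M(h)e^{\mathbf\Lambda(t-u)}\mathbf\Theta e_vY_v(u)\,du+\sum_{v\in S}\sum_{m=0}^{p-q-1}e_a^\top\mathbf M_m(h)\mathbf\Theta e_vD^{(m)}Y_v(t) \\ &+P_{\mathcal L_{Y_S}(t)}\Big(\sum_{v\in V\setminus S}\int_{-\infty}^te_a^\top\mathbf M(h)e^{\mathbf\Lambda(t-u)}\mathbf\Theta e_vY_v(u)\,du\Big) \\ &+P_{\mathcal L_{Y_S}(t)}\Big(\sum_{v\in V\setminus S}\sum_{m=0}^{p-q-1}e_a^\top\mathbf M_m(h)\mathbf\Theta e_vD^{(m)}Y_v(t)\Big)\end{aligned}$$ and $$\begin{aligned} P_{\mathcal L_{Y_S}(t)}D^{(p-q-1)}Y_a(t+h)=&\sum_{v\in S}\int_{-\infty}^te_a^\top\mathsf M(h)e^{\mathbf\Lambda(t-u)}\mathbf\Theta e_vY_v(u)\,du+\sum_{v\in S}\sum_{m=0}^{p-q-1}e_a^\top\mathsf M_m(h)\mathbf\Theta e_vD^{(m)}Y_v(t) \\ &+P_{\mathcal L_{Y_S}(t)}\Big(\sum_{v\in V\setminus S}\int_{-\infty}^te_a^\top\mathsf M(h)e^{\mathbf\Lambda(t-u)}\mathbf\Theta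 e_vY_v(u)\,du\Big) \\ &+P_{\mathcal L_{Y_S}(t)}\Big(\sum_{v\in V\setminus S}\sum_{m=0}^{p-q-1}e_a^\top\mathsf M_m(h)\mathbf\Theta e_vD^{(m)}Y_v(t)\Big).\end{aligned}$$
   Context: Setting. Let $k\ge1$ and let $p>q>0$ be integers. $L=(L(t))_{t\in\mathbb R}$ is a two-sided $\mathbb R^k$-valued Lévy process with $\mathbb E L(1)=0$, $\mathbb E\|L(1)\|^2<\infty$. Let $P(z)=I_kz^p+A_1z^{p-1}+\dots+A_p$ and $Q(z)=C_0+C_1z+\dots+C_qz^q$ with $A_i,C_j\in M_k(\mathbb R)$ be right coprime (the stacked $2k\times k$ matrix $\begin{pmatrix} P(z) \\ Q(z) \end{pmatrix}$ has rank $k$ for all $z\in\mathbb C$), with $\operatorname{rank}(C_q)=k$ and such that all zeros of $\det P(z)$ and of $\det Q(z)$ have strictly negative real part. Put $$\mathbf A=\begin{pmatrix} 0_k & I_k & 0_k & \cdots & 0_k \\ \vdots & & \ddots & \ddots & \vdots \\ 0_k & \cdots & \cdots & 0_k & I_k \\ -A_p & -A_{p-1} & \cdots & \cdots & -A_1 \end{pmatrix}\in M_{kp}(\mathbb R),\quad \mathbf B=\begin{pmatrix} 0_k \\ \vdots \\ 0_k \\ I_k \end{pmatrix}\in M_{kp\times k}(\mathbb R),\quad \mathbf C=(C_0,\dots,C_q,0_k,\dots,0_k)\in M_{k\times kp}(\mathbb R).$$ The stationary processes $X(t)=\int_{-\infty}^te^{\mathbf A(t-u)}\mathbf B\,dL(u)$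 and $Y(t)=\mathbf CX(t)$, $t\in\mathbb R$, are the input process and the ICCSS$(p,q)$ process, respectively. Matrices: $\mathsf C=(0_k,\dots,0_k,C_0,\dots,C_q)\in M_{k\times kp}(\mathbb R)$; $$\mathbf\Lambda=\begin{pmatrix} 0_k & I_k & 0_k & \cdots & 0_k \\ \vdots & & \ddots & \ddots & \vdots \\ 0_k & \cdots & \cdots & 0_k & I_k \\ -C_q^{-1}C_0 & -C_q^{-1}C_1 & \cdots & \cdots & -C_q^{-1}C_{q-1} \end{pmatrix}\in M_{kq}(\mathbb R),\qquad \mathbf\Theta=\begin{pmatrix} 0_k \\ \vdots \\ 0_k \\ C_q^{-1} \end{pmatrix}\in M_{kq\times k}(\mathbb R);$$ $\mathbf E_j\in M_{kp\times k}(\mathbb R)$ ($j=1,\dots,p$) is the block column whose $j$-th $k\times k$ block is $I_k$ and whose other blocks are $0_k$; $\mathbf E^\top=(I_{kq},0_{kq\times k(p-q)})\in M_{kq\times kp}(\mathbb R)$; $\mathsf E^\top=(0_{k\times k(q-1)},I_k)\in M_{k\times kq}(\mathbb R)$; $$\mathbf M(h)=\mathbf Ce^{\mathbf Ah}\Big(\mathbf E+\sum_{j=1}^{p-q}\mathbf E_{q+j}\mathsf E^\top\mathbf\Lambda^j\Big),\quad \mathbf M_m(h)=\mathbf Ce^{\mathbf Ah}\sum_{j=m+1}^{p-q}\mathbf E_{q+j}\mathsf E^\top\mathbf\Lambda^{j-1-m},$$ and $\mathsf M(h),\mathsf M_m(h)$ are defined by the same formulas with $\mathbf C$ replaced by $\mathsf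 C$. $e_a\in\mathbb R^k$ is the $a$-th unit vector. $D^{(m)}Y_v$ is the $m$-th mean-square derivative of $Y_v$ ($D^{(0)}Y_v=Y_v$); $Y$ is $(p-q-1)$ times mean-square differentiable. For $S\subseteq V$, $\mathcal L_{Y_S}(t)$ is the closure in $L^2$ (complex square-integrable random variables) of the set of finite complex linear combinations of $Y_s(r)$, $s\in S$, $r\le t$. $P_{\mathcal L}$ is the orthogonal projection in $L^2$ onto the closed linear subspace $\mathcal L$. Integrals over $(-\infty,t]$ are limits (a.s. and in $L^2$) of integrals over $[s,t]$ as $s\to-\infty$. *)

theory Defs
  imports "HOL-Probability.Probability"
begin

section \<open>Block matrices\<close>

text \<open>
  The index set \<open>V = {1,...,k}\<close> is the finite type \<open>'k\<close>. A matrix made of \<open>k \<times> k\<close> blocks is a function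
  \<open>i j \<mapsto> \<close> block in block row \<open>i\<close> and block column \<open>j\<close>, where indices start from 1.  The numbers of block
  rows and block columns are not stored: only the blocks in the intended range are meaningful,
  and products get the common inner dimension as an argument.  A block row (a block column) is
  indexed as a matrix whose only block row (block column) is 1.  The product of \<open>k \<times> k\<close> blocks is
  \<open>**\<close>; note that \<open>*\<close>, \<open>^\<close> and \<open>exp\<close> on \<open>real^'k^'k\<close> are not the matrix operations.
\<close>

type_synonym 'k bmat = "nat \<Rightarrow> nat \<Rightarrow> real^'k^'k"

definition bmult :: "nat \<Rightarrow> 'k::finite bmat \<Rightarrow> 'k bmat \<Rightarrow> 'k bmat" where
  "bmult n F G = (\<lambda>i j. \<Sum>l=1..n. F i l ** G l j)"

definition badd :: "'k::finite bmat \<Rightarrow> 'k bmat \<Rightarrow> 'k bmat" where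
  "badd F G = (\<lambda>i j. F i j + G i j)"

definition bsum :: "nat set \<Rightarrow> (nat \<Rightarrow> 'k::finite bmat) \<Rightarrow> 'k bmat" where
  "bsum J F = (\<lambda>i j. \<Sum>l\<in>J. F l i j)"

definition bid :: "'k::finite bmat" where
  "bid = (\<lambda>i j. if i = j then mat 1 else 0)"

primrec bpow :: "nat \<Rightarrow> 'k::finite bmat \<Rightarrow> nat \<Rightarrow> 'k bmat" where
  "bpow n F 0 = bid"
| "bpow n F (Suc m) = bmult n F (bpow n F m)"

text \<open>\<open>bexp n F x\<close> is the matrix exponential \<open>e\<^sup>F\<^sup>x\<close> of the \<open>nk \<times> nk\<close> matrix \<open>F\<close>.\<close>

definition bexp :: "nat \<Rightarrow> 'k::finite bmat \<Rightarrow> real \<Rightarrow> 'k bmat" where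
  "bexp n F x = (\<lambda>i j. \<Sum>m. (x ^ m / fact m) *\<^sub>R bpow n F m i j)"


section \<open>The matrices of the model\<close>

text \<open>
  \<open>A i\<close> for \<open>1 \<le> i \<le> p\<close> and \<open>C j\<close> for \<open>0 \<le> j \<le> q\<close> are the coefficient matrices of \<open>P\<close> and \<open>Q\<close>; other
  values of \<open>A\<close> and \<open>C\<close> are never used.
\<close>

definition cmat :: "real^'k^'k \<Rightarrow> complex^'k^'k" where
  "cmat F = (\<chi> i j. complex_of_real (F $ i $ j))"

definition P_poly :: "nat \<Rightarrow> (nat \<Rightarrow> real^'k^'k) \<Rightarrow> complex \<Rightarrow> complex^'k^'k" where
  "P_poly p A z = mat (z ^ p) + (\<Sum>i=1..p. mat (z ^ (p - i)) ** cmat (A i))"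

definition Q_poly :: "nat \<Rightarrow> (nat \<Rightarrow> real^'k^'k) \<Rightarrow> complex \<Rightarrow> complex^'k^'k" where
  "Q_poly q C z = (\<Sum>j=0..q. mat (z ^ j) ** cmat (C j))"

definition stack :: "'a^'k^'k \<Rightarrow> 'a^'k^'k \<Rightarrow> 'a^'k^('k::finite + 'k)" where
  "stack F G = (\<chi> r. case r of Inl i \<Rightarrow> F $ i | Inr i \<Rightarrow> G $ i)"

definition right_coprime ::
  "nat \<Rightarrow> nat \<Rightarrow> (nat \<Rightarrow> real^'k^'k) \<Rightarrow> (nat \<Rightarrow> real^'k^'k) \<Rightarrow> bool" where
  "right_coprime p q A C \<longleftrightarrow>
     (\<forall>z. rank (stack (P_poly p A z) (Q_poly q C z)) = CARD('k))"

definition A_mat :: "nat \<Rightarrow> (nat \<Rightarrow> real^'k^'k) \<Rightarrow> 'k bmat" where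
  "A_mat p A = (\<lambda>i j. if i < p then (if j = i + 1 then mat 1 else 0) else - A (p + 1 - j))"

definition E_col :: "nat \<Rightarrow> 'k::finite bmat" where
  "E_col l = (\<lambda>i _. if i = l then mat 1 else 0)"

definition B_mat :: "nat \<Rightarrow> 'k::finite bmat" where
  "B_mat p = E_col p"

definition C_mat :: "nat \<Rightarrow> (nat \<Rightarrow> real^'k^'k) \<Rightarrow> 'k bmat" where
  "C_mat q C = (\<lambda>_ j. if j \<le> q + 1 then C (j - 1) else 0)"

text \<open>The row \<open>(0,...,0,C\<^sub>0,...,C\<^sub>q)\<close> of \<open>p\<close> blocks, in which \<open>C\<^sub>0\<close> is block number \<open>p - q\<close>.\<close>

definition C_shift :: "nat \<Rightarrow> nat \<Rightarrow> (nat \<Rightarrow> real^'k^'k) \<Rightarrow> 'k bmat" where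
  "C_shift p q C = (\<lambda>_ j. if j < p - q then 0 else C (j - (p - q)))"

definition Lambda_mat :: "nat \<Rightarrow> (nat \<Rightarrow> real^'k^'k) \<Rightarrow> 'k bmat" where
  "Lambda_mat q C =
     (\<lambda>i j. if i < q then (if j = i + 1 then mat 1 else 0) else - (matrix_inv (C q) ** C (j - 1)))"

definition Theta_mat :: "nat \<Rightarrow> (nat \<Rightarrow> real^'k^'k) \<Rightarrow> 'k bmat" where
  "Theta_mat q C = (\<lambda>i _. if i = q then matrix_inv (C q) else 0)"

text \<open>
  The \<open>kp \<times> kq\<close> matrix whose transpose is \<open>(I,0)\<close> has the same blocks as the identity, read for
  \<open>i \<le> p\<close> and \<open>j \<le> q\<close>.
\<close>

definition E_mat :: "'k::finite bmat" where
  "E_mat = bid"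

definition E_row :: "nat \<Rightarrow> 'k::finite bmat" where
  "E_row q = (\<lambda>_ j. if j = q then mat 1 else 0)"

text \<open>
  In \<open>M_mat\<close> and \<open>Mm_mat\<close> the argument \<open>R\<close> is the leading block row, either \<open>C_mat q C\<close> or
  \<open>C_shift p q C\<close>.
\<close>

definition M_mat ::
  "nat \<Rightarrow> nat \<Rightarrow> (nat \<Rightarrow> real^'k^'k) \<Rightarrow> (nat \<Rightarrow> real^'k^'k) \<Rightarrow> 'k bmat \<Rightarrow> real \<Rightarrow> 'k bmat" where
  "M_mat p q A C R h =
     bmult p (bmult p R (bexp p (A_mat p A) h))
       (badd E_mat
         (bsum {1..p - q}
           (\<lambda>j. bmult q (bmult 1 (E_col (q + j)) (E_row q)) (bpow q (Lambda_mat q C) j))))"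

definition Mm_mat ::
  "nat \<Rightarrow> nat \<Rightarrow> (nat \<Rightarrow> real^'k^'k) \<Rightarrow> (nat \<Rightarrow> real^'k^'k) \<Rightarrow> 'k bmat \<Rightarrow> nat \<Rightarrow> real \<Rightarrow> 'k bmat" where
  "Mm_mat p q A C R m h =
     bmult p (bmult p R (bexp p (A_mat p A) h))
       (bsum {m + 1..p - q}
         (\<lambda>j. bmult q (bmult 1 (E_col (q + j)) (E_row q)) (bpow q (Lambda_mat q C) (j - 1 - m))))"

text \<open>
  The scalars \<open>e\<^sub>a\<^sup>T M(h) e\<^sup>\<Lambda>\<^sup>x \<Theta> e\<^sub>v\<close> and \<open>e\<^sub>a\<^sup>T M\<^sub>m(h) \<Theta> e\<^sub>v\<close>: the products are \<open>1 \<times> 1\<close> block matrices.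
\<close>

definition M_kernel ::
  "nat \<Rightarrow> nat \<Rightarrow> (nat \<Rightarrow> real^'k^'k) \<Rightarrow> (nat \<Rightarrow> real^'k^'k) \<Rightarrow> 'k bmat \<Rightarrow> real \<Rightarrow> 'k \<Rightarrow> 'k \<Rightarrow> real \<Rightarrow> real"
  where
  "M_kernel p q A C R h a v x =
     bmult q (bmult q (M_mat p q A C R h) (bexp q (Lambda_mat q C) x)) (Theta_mat q C) 1 1 $ a $ v"

definition Mm_coeff ::
  "nat \<Rightarrow> nat \<Rightarrow> (nat \<Rightarrow> real^'k^'k) \<Rightarrow> (nat \<Rightarrow> real^'k^'k) \<Rightarrow> 'k bmat \<Rightarrow> nat \<Rightarrow> real \<Rightarrow> 'k \<Rightarrow> 'k \<Rightarrow> real"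
  where
  "Mm_coeff p q A C R m h a v =
     bmult q (Mm_mat p q A C R m h) (Theta_mat q C) 1 1 $ a $ v"


section \<open>Mean-square notions\<close>

text \<open>
  Random variables are functions, not classes modulo almost sure equality.  An object that is
  determined only almost surely (a projection, a mean-square derivative, an improper integral)
  is an arbitrary but fixed representative, chosen by \<open>SOME\<close>.
\<close>

definition L2_rv :: "'w measure \<Rightarrow> ('w \<Rightarrow> 'b::real_normed_vector) \<Rightarrow> bool" where
  "L2_rv M Z \<longleftrightarrow> Z \<in> borel_measurable M \<and> integrable M (\<lambda>\<omega>. (norm (Z \<omega>))\<^sup>2)"

definition L2_tendsto ::
  "'w measure \<Rightarrow> 'x filter \<Rightarrow> ('x \<Rightarrow> 'w \<Rightarrow> 'b::real_normed_vector) \<Rightarrow> ('w \<Rightarrow> 'b) \<Rightarrow> bool" where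
  "L2_tendsto M F Z W \<longleftrightarrow>
     ((\<lambda>x. \<integral>\<^sup>+\<omega>. ennreal ((norm (Z x \<omega> - W \<omega>))\<^sup>2) \<partial>M) \<longlongrightarrow> 0) F"

primrec ms_deriv ::
  "'w measure \<Rightarrow> nat \<Rightarrow> (real \<Rightarrow> 'w \<Rightarrow> complex) \<Rightarrow> real \<Rightarrow> 'w \<Rightarrow> complex" where
  "ms_deriv M 0 Z = Z"
| "ms_deriv M (Suc m) Z =
     (\<lambda>t. SOME W. W \<in> borel_measurable M \<and>
        L2_tendsto M (at 0)
          (\<lambda>d \<omega>. (ms_deriv M m Z (t + d) \<omega> - ms_deriv M m Z t \<omega>) /\<^sub>R d) W)"

definition integral_upto ::
  "'w measure \<Rightarrow> real \<Rightarrow> (real \<Rightarrow> 'w \<Rightarrow> complex) \<Rightarrow> 'w \<Rightarrow> complex" where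
  "integral_upto M t F =
     (SOME J. J \<in> borel_measurable M \<and>
        (AE \<omega> in M. ((\<lambda>s. LINT u:{s..t}|lborel. F u \<omega>) \<longlongrightarrow> J \<omega>) at_bot) \<and>
        L2_tendsto M at_bot (\<lambda>s \<omega>. LINT u:{s..t}|lborel. F u \<omega>) J)"

definition coord :: "(real \<Rightarrow> 'w \<Rightarrow> real^'k) \<Rightarrow> 'k \<Rightarrow> real \<Rightarrow> 'w \<Rightarrow> complex" where
  "coord Y v = (\<lambda>t \<omega>. complex_of_real (Y t \<omega> $ v))"

definition lin_space ::
  "(real \<Rightarrow> 'w \<Rightarrow> real^'k) \<Rightarrow> 'k set \<Rightarrow> real \<Rightarrow> ('w \<Rightarrow> complex) set" where
  "lin_space Y S t =
     {W. \<exists>F c. finite F \<and> F \<subseteq> S \<times> {..t} \<and> W = (\<lambda>\<omega>. \<Sum>(s, r)\<in>F. c (s, r) * coord Y s r \<omega>)}"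

definition L_space ::
  "'w measure \<Rightarrow> (real \<Rightarrow> 'w \<Rightarrow> real^'k) \<Rightarrow> 'k set \<Rightarrow> real \<Rightarrow> ('w \<Rightarrow> complex) set" where
  "L_space M Y S t =
     {Z. L2_rv M Z \<and> (\<exists>W. (\<forall>n. W n \<in> lin_space Y S t) \<and> L2_tendsto M sequentially W Z)}"

definition L2_proj ::
  "'w measure \<Rightarrow> ('w \<Rightarrow> complex) set \<Rightarrow> ('w \<Rightarrow> complex) \<Rightarrow> 'w \<Rightarrow> complex" where
  "L2_proj M H Z =
     (SOME W. W \<in> H \<and> (\<forall>U\<in>H. (LINT \<omega>|M. (Z \<omega> - W \<omega>) * cnj (U \<omega>)) = 0))"


section \<open>Driving process, input process and output process\<close>

text \<open>Cadlag paths are not demanded; stochastic continuity is the weaker customary requirement.\<close>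

definition levy_process :: "'w measure \<Rightarrow> (real \<Rightarrow> 'w \<Rightarrow> real^'k) \<Rightarrow> bool" where
  "levy_process M L \<longleftrightarrow>
     (\<forall>t. L t \<in> borel_measurable M) \<and>
     (AE \<omega> in M. L 0 \<omega> = 0) \<and>
     (\<forall>r n. strict_mono r \<longrightarrow>
        prob_space.indep_vars M (\<lambda>_. borel)
          (\<lambda>i \<omega>. L (r (Suc i)) \<omega> - L (r i) \<omega>) {..<n::nat}) \<and>
     (\<forall>s t h. s \<le> t \<longrightarrow>
        distr M borel (\<lambda>\<omega>. L (t + h) \<omega> - L (s + h) \<omega>) = distr M borel (\<lambda>\<omega>. L t \<omega> - L s \<omega>)) \<and>
     (\<forall>t. \<forall>\<epsilon>>0. ((\<lambda>s. measure M {\<omega>\<in>space M. norm (L s \<omega> - L t \<omega>) > \<epsilon>}) \<longlongrightarrow> 0) (at t))"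

text \<open>
  A list of triples \<open>(b, c, F)\<close> with \<open>b \<le> c\<close> stands for the matrix-valued step function
  \<open>\<Sum> 1\<^bsub>(b,c]\<^esub> F\<close>.  The stochastic integral of a deterministic square-integrable function is the
  mean-square limit of the integrals of step functions that converge to it in \<open>L\<^sup>2\<close> of Lebesgue measure.
\<close>

definition step_fun :: "(real \<times> real \<times> (real^'k^'k)) list \<Rightarrow> real \<Rightarrow> real^'k^'k" where
  "step_fun \<phi> u = (\<Sum>(b, c, F)\<leftarrow>\<phi>. indicator {b<..c} u *\<^sub>R F)"

definition step_int ::
  "(real \<Rightarrow> 'w \<Rightarrow> real^'k) \<Rightarrow> (real \<times> real \<times> (real^'k^'k)) list \<Rightarrow> 'w \<Rightarrow> real^'k" where
  "step_int L \<phi> \<omega> = (\<Sum>(b, c, F)\<leftarrow>\<phi>. F *v (L c \<omega> - L b \<omega>))"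

definition has_levy_integral ::
  "'w measure \<Rightarrow> (real \<Rightarrow> 'w \<Rightarrow> real^'k) \<Rightarrow> real \<Rightarrow> real \<Rightarrow> (real \<Rightarrow> real^'k^'k) \<Rightarrow> ('w \<Rightarrow> real^'k) \<Rightarrow> bool"
  where
  "has_levy_integral M L s t f I \<longleftrightarrow>
     f \<in> borel_measurable borel \<and> I \<in> borel_measurable M \<and>
     (\<exists>\<phi>. (\<forall>n. \<forall>(b, c, F)\<in>set (\<phi> n). b \<le> c) \<and>
        L2_tendsto lborel sequentially (\<lambda>n. step_fun (\<phi> n)) (\<lambda>u. indicator {s..t} u *\<^sub>R f u) \<and>
        L2_tendsto M sequentially (\<lambda>n. step_int L (\<phi> n)) I)"

definition has_levy_integral_upto ::
  "'w measure \<Rightarrow> (real \<Rightarrow> 'w \<Rightarrow> real^'k) \<Rightarrow> real \<Rightarrow> (real \<Rightarrow> real^'k^'k) \<Rightarrow> ('w \<Rightarrow> real^'k) \<Rightarrow> bool" where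
  "has_levy_integral_upto M L t f I \<longleftrightarrow>
     I \<in> borel_measurable M \<and>
     (\<exists>J. (\<forall>s\<le>t. has_levy_integral M L s t f (J s)) \<and> L2_tendsto M at_bot J I)"

text \<open>
  \<open>X t \<omega> j\<close> is block \<open>j\<close> of the input process in \<open>\<real>\<^sup>k\<^sup>p\<close>.  The defining integral fixes \<open>X t\<close> only almost
  surely for each \<open>t\<close>; joint measurability (satisfied by the cadlag version) is what makes the pathwise
  Lebesgue integrals of the output process meaningful.
\<close>

definition input_process ::
  "'w measure \<Rightarrow> (real \<Rightarrow> 'w \<Rightarrow> real^'k) \<Rightarrow> nat \<Rightarrow> (nat \<Rightarrow> real^'k^'k) \<Rightarrow>
   (real \<Rightarrow> 'w \<Rightarrow> nat \<Rightarrow> real^'k) \<Rightarrow> bool" where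
  "input_process M L p A X \<longleftrightarrow>
     (\<forall>j\<in>{1..p}. (\<lambda>(t, \<omega>). X t \<omega> j) \<in> borel_measurable (lborel \<Otimes>\<^sub>M M)) \<and>
     (\<forall>t. \<forall>j\<in>{1..p}.
        has_levy_integral_upto M L t
          (\<lambda>u. bmult p (bexp p (A_mat p A) (t - u)) (B_mat p) j 1) (\<lambda>\<omega>. X t \<omega> j))"

definition output_process ::
  "nat \<Rightarrow> nat \<Rightarrow> (nat \<Rightarrow> real^'k^'k) \<Rightarrow> (real \<Rightarrow> 'w \<Rightarrow> nat \<Rightarrow> real^'k) \<Rightarrow> real \<Rightarrow> 'w \<Rightarrow> real^'k" where
  "output_process p q C X t \<omega> = (\<Sum>j=1..p. C_mat q C 1 j *v X t \<omega> j)"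

definition ICCSS ::
  "'w measure \<Rightarrow> nat \<Rightarrow> nat \<Rightarrow> (nat \<Rightarrow> real^'k^'k) \<Rightarrow> (nat \<Rightarrow> real^'k^'k) \<Rightarrow>
   (real \<Rightarrow> 'w \<Rightarrow> real^'k) \<Rightarrow> (real \<Rightarrow> 'w \<Rightarrow> nat \<Rightarrow> real^'k) \<Rightarrow> (real \<Rightarrow> 'w \<Rightarrow> real^'k) \<Rightarrow> bool" where
  "ICCSS M p q A C L X Y \<longleftrightarrow>
     levy_process M L \<and>
     integrable M (\<lambda>\<omega>. (norm (L 1 \<omega>))\<^sup>2) \<and> (LINT \<omega>|M. L 1 \<omega>) = 0 \<and>
     right_coprime p q A C \<and> rank (C q) = CARD('k) \<and>
     (\<forall>z. det (P_poly p A z) = 0 \<longrightarrow> Re z < 0) \<and>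
     (\<forall>z. det (Q_poly q C z) = 0 \<longrightarrow> Re z < 0) \<and>
     input_process M L p A X \<and> Y = output_process p q C X"

end

theory Submission
  imports Defs "HOL-Computational_Algebra.Fundamental_Theorem_Algebra"
begin

text \<open>
  Write \<open>X_1, ..., X_p\<close> for the blocks of the state. In mean square \<open>X_j' = X_{j+1}\<close> for \<open>j < p\<close>, and the
  output equation \<open>Y = C_0 X_1 + ... + C_q X_{q+1}\<close> can be solved for \<open>X_{q+1}\<close>. Hence the first \<open>q\<close> blocks
  satisfy the linear equation with matrix \<open>\<Lambda>\<close> and input \<open>\<Theta> Y\<close>. Since the zeros of \<open>det Q\<close> lie in the left
  half-plane, \<open>exp (\<Lambda> t)\<close> decays, and these blocks are the integral of \<open>exp (\<Lambda> (t - u)) \<Theta> Y(u)\<close> over the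
  past. Solving for the later blocks in the same way produces powers of \<open>\<Lambda>\<close> and the derivatives of \<open>Y\<close>.
  Finally \<open>X(t + h)\<close> is \<open>exp (A h) X(t)\<close> plus an integral of \<open>L\<close> over \<open>(t, t + h]\<close>, which is orthogonal to
  everything that depends linearly on the past. Projecting this decomposition gives both formulas.
\<close>

section \<open>Mean-square calculus\<close>

text \<open>The equations \<open>X_j' = X_{j+1}\<close> hold only in mean square, so no single path
  solves the linear equation. The way round is duality: for a fixed square-integrable
  \<open>W\<close> the functions \<open>u \<mapsto> E(X_j(u) W)\<close> with \<open>j < p\<close>
  are differentiable in the ordinary sense, the fundamental theorem of calculus applies to them, and
  taking for \<open>W\<close> the very difference of the two sides of the claimed identity shows
  that its second moment is 0. Testing a residual against itself also places the integrals over the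
  past in the closed span of the output. Integrals with respect to \<open>L\<close> are handled
  mainly through two facts: their second moment is bounded by a constant times the squared Lebesgue
  norm of the kernel, and kernels with disjoint supports give uncorrelated integrals. Projections,
  derivatives and improper integrals are arbitrary representatives, so each is identified up to a
  null set at one fixed time, never for all times at once. The decay of both exponentials is
  obtained without normal forms, by removing the factors of an annihilating polynomial one at a
  time.\<close>

definition msq :: "'a measure \<Rightarrow> ('a \<Rightarrow> 'b::real_normed_vector) \<Rightarrow> ennreal" where
  "msq M f = (\<integral>\<^sup>+\<omega>. ennreal ((norm (f \<omega>))\<^sup>2) \<partial>M)"

lemma L2_tendsto_msq: "L2_tendsto M F Z W \<longleftrightarrow> ((\<lambda>x. msq M (\<lambda>\<omega>. Z x \<omega> - W \<omega>)) \<longlongrightarrow> 0) F"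
  by (simp add: L2_tendsto_def msq_def)

lemma L2_rv_msq:
  fixes f :: "'a \<Rightarrow> 'b::real_normed_vector"
  shows "L2_rv M f \<longleftrightarrow> f \<in> borel_measurable M \<and> msq M f < \<infinity>"
proof -
  have "f \<in> borel_measurable M \<Longrightarrow> (\<lambda>\<omega>. (norm (f \<omega>))\<^sup>2) \<in> borel_measurable M" by measurable
  then show ?thesis by (auto simp: L2_rv_def msq_def integrable_iff_bounded)
qed

lemma L2_rv_measurable [dest]: "L2_rv M f \<Longrightarrow> f \<in> borel_measurable M"
  by (simp add: L2_rv_def)

lemma msq_bound:
  fixes f :: "'a \<Rightarrow> 'b::euclidean_space" and g :: "'a \<Rightarrow> 'c::euclidean_space"
  assumes "\<And>\<omega>. norm (f \<omega>) \<le> K * norm (g \<omega>)" "g \<in> borel_measurable M"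
  shows "msq M f \<le> ennreal (K\<^sup>2) * msq M g"
proof -
  have "msq M f \<le> (\<integral>\<^sup>+\<omega>. ennreal (K\<^sup>2) * ennreal ((norm (g \<omega>))\<^sup>2) \<partial>M)"
    unfolding msq_def
  proof (intro nn_integral_mono)
    fix \<omega>
    have "(norm (f \<omega>))\<^sup>2 \<le> (K * norm (g \<omega>))\<^sup>2"
      using assms(1)[of \<omega>] by (intro power_mono) auto
    then show "ennreal ((norm (f \<omega>))\<^sup>2) \<le> ennreal (K\<^sup>2) * ennreal ((norm (g \<omega>))\<^sup>2)"
      by (simp add: power_mult_distrib flip: ennreal_mult)
  qed
  also have "\<dots> = ennreal (K\<^sup>2) * msq M g"
    unfolding msq_def using assms(2) by (intro nn_integral_cmult) auto
  finally show ?thesis .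
qed

text \<open>Pointwise \<open>(a + b)^2 \<le> 2 a^2 + 2 b^2\<close>. This stands in for Minkowski's
  inequality: the factor 2 does no harm to finiteness or to limits equal to 0, and square roots in
  \<open>ennreal\<close> are avoided.\<close>

lemma msq_add:
  fixes f g :: "'a \<Rightarrow> 'b::euclidean_space"
  assumes [measurable]: "f \<in> borel_measurable M" "g \<in> borel_measurable M"
  shows "msq M (\<lambda>\<omega>. f \<omega> + g \<omega>) \<le> 2 * msq M f + 2 * msq M g"
proof -
  have "msq M (\<lambda>\<omega>. f \<omega> + g \<omega>) \<le> (\<integral>\<^sup>+\<omega>. 2 * ennreal ((norm (f \<omega>))\<^sup>2) + 2 * ennreal ((norm (g \<omega>))\<^sup>2) \<partial>M)"
    unfolding msq_def
  proof (intro nn_integral_mono)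
    fix \<omega>
    have "(norm (f \<omega> + g \<omega>))\<^sup>2 \<le> (norm (f \<omega>) + norm (g \<omega>))\<^sup>2"
      by (intro power_mono norm_triangle_ineq) auto
    also have "\<dots> \<le> 2 * (norm (f \<omega>))\<^sup>2 + 2 * (norm (g \<omega>))\<^sup>2"
      using sum_squares_bound[of "norm (f \<omega>)" "norm (g \<omega>)"] by (simp add: power2_sum)
    finally have "ennreal ((norm (f \<omega> + g \<omega>))\<^sup>2) \<le> ennreal (2 * (norm (f \<omega>))\<^sup>2 + 2 * (norm (g \<omega>))\<^sup>2)"
      by (rule ennreal_leI)
    then show "ennreal ((norm (f \<omega> + g \<omega>))\<^sup>2) \<le> 2 * ennreal ((norm (f \<omega>))\<^sup>2) + 2 * ennreal ((norm (g \<omega>))\<^sup>2)"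
      by (simp add: ennreal_plus ennreal_mult)
  qed
  also have "\<dots> = 2 * msq M f + 2 * msq M g"
    unfolding msq_def by (simp add: nn_integral_add nn_integral_cmult)
  finally show ?thesis .
qed

lemma msq_minus_commute: "msq M (\<lambda>\<omega>. f \<omega> - g \<omega>) = msq M (\<lambda>\<omega>. g \<omega> - f \<omega>)"
  by (simp add: msq_def norm_minus_commute)

lemma msq_eq_0_iff:
  fixes f :: "'a \<Rightarrow> 'b::euclidean_space"
  assumes [measurable]: "f \<in> borel_measurable M"
  shows "msq M f = 0 \<longleftrightarrow> (AE \<omega> in M. f \<omega> = 0)"
  unfolding msq_def by (subst nn_integral_0_iff_AE) auto

lemma msq_cong_AE: "AE \<omega> in M. f \<omega> = g \<omega> \<Longrightarrow> msq M f = msq M g"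
  unfolding msq_def by (intro nn_integral_cong_AE) auto

lemma L2_rv_zero: "L2_rv M (\<lambda>_. 0)"
  by (simp add: L2_rv_def)

lemma L2_rv_add:
  fixes f g :: "'a \<Rightarrow> 'b::euclidean_space"
  assumes "L2_rv M f" "L2_rv M g"
  shows "L2_rv M (\<lambda>\<omega>. f \<omega> + g \<omega>)"
  using assms le_less_trans[OF msq_add[of f M g]]
  by (auto simp: L2_rv_msq ennreal_mult_less_top)

lemma L2_rv_bound:
  fixes f :: "'a \<Rightarrow> 'b::euclidean_space" and g :: "'a \<Rightarrow> 'c::euclidean_space"
  assumes "\<And>\<omega>. norm (f \<omega>) \<le> K * norm (g \<omega>)" "L2_rv M g" "f \<in> borel_measurable M"
  shows "L2_rv M f"
  using assms(2,3) le_less_trans[OF msq_bound[of f K g M, OF assms(1)]]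
  by (auto simp: L2_rv_msq ennreal_mult_less_top)

lemma L2_rv_linear:
  fixes f :: "'a \<Rightarrow> 'b::euclidean_space" and T :: "'b \<Rightarrow> 'c::euclidean_space"
  assumes "bounded_linear T" "L2_rv M f"
  shows "L2_rv M (\<lambda>\<omega>. T (f \<omega>))"
proof -
  obtain K where K: "\<And>x. norm (T x) \<le> norm x * K"
    using bounded_linear.bounded[OF assms(1)] by blast
  have [measurable]: "T \<in> borel_measurable borel"
    using assms(1) by (intro borel_measurable_continuous_onI linear_continuous_on)
  have [measurable]: "f \<in> borel_measurable M" using assms(2) by auto
  show ?thesis by (rule L2_rv_bound[where K=K, OF _ assms(2)]) (use K in \<open>auto simp: mult.commute\<close>)
qed

lemma L2_rv_diff:
  fixes f g :: "'a \<Rightarrow> 'b::euclidean_space"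
  assumes "L2_rv M f" "L2_rv M g"
  shows "L2_rv M (\<lambda>\<omega>. f \<omega> - g \<omega>)"
  using L2_rv_add[OF assms(1) L2_rv_linear[OF bounded_linear_minus[OF bounded_linear_ident] assms(2)]] by simp

lemma L2_rv_cmult:
  fixes f :: "'a \<Rightarrow> 'b::{real_normed_algebra, euclidean_space}"
  shows "L2_rv M f \<Longrightarrow> L2_rv M (\<lambda>\<omega>. c * f \<omega>)"
  by (rule L2_rv_linear[OF bounded_linear_mult_right])

lemma L2_rv_sum:
  fixes f :: "'i \<Rightarrow> 'a \<Rightarrow> 'b::euclidean_space"
  assumes "\<And>i. i \<in> I \<Longrightarrow> L2_rv M (f i)"
  shows "L2_rv M (\<lambda>\<omega>. \<Sum>i\<in>I. f i \<omega>)"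
  using assms by (induction I rule: infinite_finite_induct) (auto intro: L2_rv_add L2_rv_zero)

section \<open>Convergence in mean square\<close>

lemma ennreal_tendsto_0_le:
  fixes f g :: "'x \<Rightarrow> ennreal"
  assumes "(g \<longlongrightarrow> 0) F" "\<forall>\<^sub>F x in F. f x \<le> g x"
  shows "(f \<longlongrightarrow> 0) F"
  by (rule tendsto_sandwich[OF _ assms(2) tendsto_const assms(1)]) auto

lemma ennreal_tendsto_0_cmult:
  fixes g :: "'x \<Rightarrow> ennreal"
  assumes "(g \<longlongrightarrow> 0) F" "c < \<infinity>"
  shows "((\<lambda>x. c * g x) \<longlongrightarrow> 0) F"
  using ennreal_tendsto_cmult[OF _ assms(1), of c] assms(2) by simp

lemma L2_tendsto_linear:
  fixes W :: "'a \<Rightarrow> 'b::euclidean_space" and T :: "'b \<Rightarrow> 'c::euclidean_space"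
  assumes "bounded_linear T" "L2_tendsto M F Z W"
    and [measurable]: "\<And>x. Z x \<in> borel_measurable M" "W \<in> borel_measurable M"
  shows "L2_tendsto M F (\<lambda>x \<omega>. T (Z x \<omega>)) (\<lambda>\<omega>. T (W \<omega>))"
proof -
  obtain K where K: "\<And>x. norm (T x) \<le> norm x * K"
    using bounded_linear.bounded[OF assms(1)] by blast
  have "msq M (\<lambda>\<omega>. T (Z x \<omega>) - T (W \<omega>)) \<le> ennreal (K\<^sup>2) * msq M (\<lambda>\<omega>. Z x \<omega> - W \<omega>)" for x
    using K by (intro msq_bound) (auto simp: mult.commute simp flip: linear_diff[OF bounded_linear.linear[OF assms(1)]])
  then have le: "\<forall>\<^sub>F x in F. msq M (\<lambda>\<omega>. T (Z x \<omega>) - T (W \<omega>)) \<le> ennreal (K\<^sup>2) * msq M (\<lambda>\<omega>. Z x \<omega> - W \<omega>)"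
    by (rule always_eventually[OF allI])
  have "((\<lambda>x. ennreal (K\<^sup>2) * msq M (\<lambda>\<omega>. Z x \<omega> - W \<omega>)) \<longlongrightarrow> 0) F"
    using assms(2) unfolding L2_tendsto_msq by (rule ennreal_tendsto_0_cmult) simp
  from ennreal_tendsto_0_le[OF this le] show ?thesis unfolding L2_tendsto_msq .
qed

lemma L2_tendsto_add:
  fixes W W' :: "'a \<Rightarrow> 'b::euclidean_space"
  assumes "L2_tendsto M F Z W" "L2_tendsto M F Z' W'"
    and [measurable]: "\<And>x. Z x \<in> borel_measurable M" "W \<in> borel_measurable M"
      "\<And>x. Z' x \<in> borel_measurable M" "W' \<in> borel_measurable M"
  shows "L2_tendsto M F (\<lambda>x \<omega>. Z x \<omega> + Z' x \<omega>) (\<lambda>\<omega>. W \<omega> + W' \<omega>)"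
proof -
  have lim: "((\<lambda>x. 2 * msq M (\<lambda>\<omega>. Z x \<omega> - W \<omega>) + 2 * msq M (\<lambda>\<omega>. Z' x \<omega> - W' \<omega>)) \<longlongrightarrow> 0 + 0) F"
    using assms(1,2) unfolding L2_tendsto_msq
    by (intro tendsto_add ennreal_tendsto_0_cmult) simp_all
  have "msq M (\<lambda>\<omega>. (Z x \<omega> + Z' x \<omega>) - (W \<omega> + W' \<omega>))
      \<le> 2 * msq M (\<lambda>\<omega>. Z x \<omega> - W \<omega>) + 2 * msq M (\<lambda>\<omega>. Z' x \<omega> - W' \<omega>)" for x
    using msq_add[of "\<lambda>\<omega>. Z x \<omega> - W \<omega>" M "\<lambda>\<omega>. Z' x \<omega> - W' \<omega>"]
    by (simp add: algebra_simps)
  then show ?thesis unfolding L2_tendsto_msq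
    by (intro ennreal_tendsto_0_le[OF lim[simplified]] always_eventually allI)
qed

lemma L2_tendsto_const: "L2_tendsto M F (\<lambda>_. W) W"
  by (simp add: L2_tendsto_msq msq_def)

lemma L2_tendsto_sum:
  fixes W :: "'i \<Rightarrow> 'a \<Rightarrow> 'b::euclidean_space"
  assumes "\<And>i. i \<in> I \<Longrightarrow> L2_tendsto M F (Z i) (W i)"
    and "\<And>i x. i \<in> I \<Longrightarrow> Z i x \<in> borel_measurable M" "\<And>i. i \<in> I \<Longrightarrow> W i \<in> borel_measurable M"
  shows "L2_tendsto M F (\<lambda>x \<omega>. \<Sum>i\<in>I. Z i x \<omega>) (\<lambda>\<omega>. \<Sum>i\<in>I. W i \<omega>)"
  using assms
proof (induction I rule: infinite_finite_induct)
  case (insert i I)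
  then show ?case by (simp add: L2_tendsto_add)
qed (auto intro: L2_tendsto_const)

lemma L2_tendsto_diff:
  fixes W W' :: "'a \<Rightarrow> 'b::euclidean_space"
  assumes "L2_tendsto M F Z W" "L2_tendsto M F Z' W'"
    and [measurable]: "\<And>x. Z x \<in> borel_measurable M" "W \<in> borel_measurable M"
      "\<And>x. Z' x \<in> borel_measurable M" "W' \<in> borel_measurable M"
  shows "L2_tendsto M F (\<lambda>x \<omega>. Z x \<omega> - Z' x \<omega>) (\<lambda>\<omega>. W \<omega> - W' \<omega>)"
  using L2_tendsto_add[OF assms(1) L2_tendsto_linear[OF bounded_linear_minus[OF bounded_linear_ident] assms(2)]] by simp

lemma L2_tendsto_filter: "L2_tendsto M F Z W \<Longrightarrow> filterlim r F G \<Longrightarrow> L2_tendsto M G (\<lambda>x. Z (r x)) W"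
  unfolding L2_tendsto_def by (rule filterlim_compose)

text \<open>Allows a representative that is fixed only almost surely, such as one chosen by
  \<open>SOME\<close>, to be exchanged inside a limit. A separate null set for each \<open>x\<close>
  is enough, since each second moment is computed on its own.\<close>

lemma L2_tendsto_cong_AE:
  assumes "\<And>x. AE \<omega> in M. Z x \<omega> = Z' x \<omega>" "AE \<omega> in M. W \<omega> = W' \<omega>"
  shows "L2_tendsto M F Z W \<longleftrightarrow> L2_tendsto M F Z' W'"
proof -
  have "msq M (\<lambda>\<omega>. Z x \<omega> - W \<omega>) = msq M (\<lambda>\<omega>. Z' x \<omega> - W' \<omega>)" for x
    using assms(1)[of x] assms(2) by (intro msq_cong_AE) auto
  then show ?thesis by (simp add: L2_tendsto_msq)
qed

text \<open>The net minus itself is 0 and converges to \<open>W - W'\<close>, so the second moment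
  of the latter is 0. This is what determines the value of a \<open>SOME\<close> up to a null
  set.\<close>

lemma L2_tendsto_unique:
  fixes W W' :: "'a \<Rightarrow> 'b::euclidean_space"
  assumes "L2_tendsto M F Z W" "L2_tendsto M F Z W'" "F \<noteq> bot"
    and [measurable]: "\<And>x. Z x \<in> borel_measurable M" "W \<in> borel_measurable M" "W' \<in> borel_measurable M"
  shows "AE \<omega> in M. W \<omega> = W' \<omega>"
proof -
  have "L2_tendsto M F (\<lambda>x \<omega>. Z x \<omega> - Z x \<omega>) (\<lambda>\<omega>. W \<omega> - W' \<omega>)"
    by (intro L2_tendsto_diff assms)
  then have "((\<lambda>x. msq M (\<lambda>\<omega>. W' \<omega> - W \<omega>)) \<longlongrightarrow> 0) F" by (simp add: L2_tendsto_msq)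
  then have "msq M (\<lambda>\<omega>. W' \<omega> - W \<omega>) = 0" using assms(3) by (simp add: tendsto_const_iff)
  then show ?thesis by (subst (asm) msq_eq_0_iff) auto
qed

text \<open>Some member of the net lies at finite distance from \<open>W\<close>, and that member is
  square-integrable.\<close>

lemma L2_tendsto_L2:
  fixes W :: "'a \<Rightarrow> 'b::euclidean_space"
  assumes "L2_tendsto M F Z W" "F \<noteq> bot" "\<And>x. L2_rv M (Z x)" and [measurable]: "W \<in> borel_measurable M"
  shows "L2_rv M W"
proof -
  have "\<forall>\<^sub>F x in F. msq M (\<lambda>\<omega>. Z x \<omega> - W \<omega>) < 1"
    using assms(1) unfolding L2_tendsto_msq by (rule order_tendstoD) simp
  then obtain x where x: "msq M (\<lambda>\<omega>. Z x \<omega> - W \<omega>) < 1" using assms(2) eventually_happens' by blast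
  have [measurable]: "Z x \<in> borel_measurable M" using assms(3) by auto
  have "L2_rv M (\<lambda>\<omega>. Z x \<omega> - W \<omega>)" using x by (auto simp: L2_rv_msq intro: less_trans)
  from L2_rv_diff[OF assms(3)[of x] this] show ?thesis by simp
qed

section \<open>Cauchy-Schwarz, continuity of the pairing, completeness\<close>

lemma L2_Cauchy_Schwarz:
  fixes f g :: "'a \<Rightarrow> 'b::{real_normed_algebra, euclidean_space}"
  assumes "L2_rv M f" "L2_rv M g"
  shows "integrable M (\<lambda>\<omega>. f \<omega> * g \<omega>)"
    and "ennreal ((norm (LINT \<omega>|M. f \<omega> * g \<omega>))\<^sup>2) \<le> msq M f * msq M g"
    and "(\<integral>\<^sup>+\<omega>. ennreal (norm (f \<omega> * g \<omega>)) \<partial>M)\<^sup>2 \<le> msq M f * msq M g"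
proof -
  have [measurable]: "f \<in> borel_measurable M" "g \<in> borel_measurable M" using assms by auto
  have "(\<integral>\<^sup>+\<omega>. ennreal (norm (f \<omega> * g \<omega>)) \<partial>M) \<le> (\<integral>\<^sup>+\<omega>. ennreal (norm (f \<omega>)) * ennreal (norm (g \<omega>)) \<partial>M)"
    by (intro nn_integral_mono) (simp add: norm_mult_ineq ennreal_leI flip: ennreal_mult)
  then have "(\<integral>\<^sup>+\<omega>. ennreal (norm (f \<omega> * g \<omega>)) \<partial>M)\<^sup>2 \<le> (\<integral>\<^sup>+\<omega>. ennreal (norm (f \<omega>)) * ennreal (norm (g \<omega>)) \<partial>M)\<^sup>2"
    by (intro power_mono) auto
  also have "\<dots> \<le> (\<integral>\<^sup>+\<omega>. (ennreal (norm (f \<omega>)))\<^sup>2 \<partial>M) * (\<integral>\<^sup>+\<omega>. (ennreal (norm (g \<omega>)))\<^sup>2 \<partial>M)"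
    by (intro Cauchy_Schwarz_nn_integral) auto
  also have "\<dots> = msq M f * msq M g"
    by (simp add: msq_def ennreal_power)
  finally show *: "(\<integral>\<^sup>+\<omega>. ennreal (norm (f \<omega> * g \<omega>)) \<partial>M)\<^sup>2 \<le> msq M f * msq M g" .
  also have "\<dots> < \<infinity>" using assms by (simp add: L2_rv_msq ennreal_mult_less_top)
  finally have fin: "(\<integral>\<^sup>+\<omega>. ennreal (norm (f \<omega> * g \<omega>)) \<partial>M) < \<infinity>" by (simp add: power_less_top_ennreal)
  then show int: "integrable M (\<lambda>\<omega>. f \<omega> * g \<omega>)" by (simp add: integrable_iff_bounded)
  have "ennreal (norm (LINT \<omega>|M. f \<omega> * g \<omega>)) \<le> (\<integral>\<^sup>+\<omega>. ennreal (norm (f \<omega> * g \<omega>)) \<partial>M)"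
    by (rule integral_norm_bound_ennreal[OF int])
  then have "(ennreal (norm (LINT \<omega>|M. f \<omega> * g \<omega>)))\<^sup>2 \<le> (\<integral>\<^sup>+\<omega>. ennreal (norm (f \<omega> * g \<omega>)) \<partial>M)\<^sup>2"
    by (intro power_mono) auto
  with * show "ennreal ((norm (LINT \<omega>|M. f \<omega> * g \<omega>))\<^sup>2) \<le> msq M f * msq M g"
    by (simp add: ennreal_power)
qed

text \<open>The way back from squared estimates in \<open>ennreal\<close>, as Cauchy-Schwarz
  supplies them, to an ordinary limit.\<close>

lemma tendsto_0_ennreal_sq:
  fixes g :: "'x \<Rightarrow> 'b::real_normed_vector"
  assumes "((\<lambda>x. ennreal ((norm (g x))\<^sup>2)) \<longlongrightarrow> 0) F"
  shows "(g \<longlongrightarrow> 0) F"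
proof -
  have "((\<lambda>x. (norm (g x))\<^sup>2) \<longlongrightarrow> 0) F"
    using assms by (subst (asm) ennreal_0[symmetric], subst (asm) tendsto_ennreal_iff) auto
  then have "((\<lambda>x. sqrt ((norm (g x))\<^sup>2)) \<longlongrightarrow> sqrt 0) F" by (rule tendsto_real_sqrt)
  then show ?thesis by (simp add: tendsto_norm_zero_iff)
qed

lemma L2_tendsto_inner:
  fixes W U :: "'a \<Rightarrow> 'b::{real_normed_algebra, euclidean_space}"
  assumes "L2_tendsto M F Z W" "\<And>x. L2_rv M (Z x)" "L2_rv M W" "L2_rv M U"
  shows "((\<lambda>x. LINT \<omega>|M. Z x \<omega> * U \<omega>) \<longlongrightarrow> (LINT \<omega>|M. W \<omega> * U \<omega>)) F"
proof (rule LIM_zero_cancel, rule tendsto_0_ennreal_sq)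
  have eq: "(LINT \<omega>|M. Z x \<omega> * U \<omega>) - (LINT \<omega>|M. W \<omega> * U \<omega>) = (LINT \<omega>|M. (Z x \<omega> - W \<omega>) * U \<omega>)" for x
    by (subst Bochner_Integration.integral_diff[symmetric])
      (simp_all add: left_diff_distrib L2_Cauchy_Schwarz(1) assms)
  have "((\<lambda>x. msq M U * msq M (\<lambda>\<omega>. Z x \<omega> - W \<omega>)) \<longlongrightarrow> 0) F"
    using assms(1,4) by (intro ennreal_tendsto_0_cmult) (auto simp: L2_rv_msq L2_tendsto_msq)
  then show "((\<lambda>x. ennreal ((norm ((LINT \<omega>|M. Z x \<omega> * U \<omega>) - (LINT \<omega>|M. W \<omega> * U \<omega>)))\<^sup>2)) \<longlongrightarrow> 0) F"
    unfolding eq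
    by (rule ennreal_tendsto_0_le, intro always_eventually allI)
      (simp add: L2_Cauchy_Schwarz(2) L2_rv_diff assms mult.commute[of "msq M U"])
qed

lemma L2_tendsto_inner2:
  fixes W V :: "'a \<Rightarrow> 'b::{real_normed_algebra, euclidean_space}"
  assumes "L2_tendsto M F Z W" "L2_tendsto M F U V"
    "\<And>x. L2_rv M (Z x)" "L2_rv M W" "\<And>x. L2_rv M (U x)" "L2_rv M V"
  shows "((\<lambda>x. LINT \<omega>|M. Z x \<omega> * U x \<omega>) \<longlongrightarrow> (LINT \<omega>|M. W \<omega> * V \<omega>)) F"
proof -
  have "((\<lambda>x. LINT \<omega>|M. Z x \<omega> * V \<omega>) \<longlongrightarrow> (LINT \<omega>|M. W \<omega> * V \<omega>)) F"
    by (rule L2_tendsto_inner) fact+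
  moreover have "((\<lambda>x. LINT \<omega>|M. Z x \<omega> * (U x \<omega> - V \<omega>)) \<longlongrightarrow> 0) F"
  proof (rule tendsto_0_ennreal_sq, rule ennreal_tendsto_0_le)
    \<comment> \<open>The factor \<open>2 * 1 + 2 * msq M W\<close> bounds
      \<open>msq M (Z x)\<close> as soon as \<open>Z x\<close> is within squared distance 1 of
      \<open>W\<close>.\<close>
    show "((\<lambda>x. (2 * 1 + 2 * msq M W) * msq M (\<lambda>\<omega>. U x \<omega> - V \<omega>)) \<longlongrightarrow> 0) F"
      using assms(2,4) by (intro ennreal_tendsto_0_cmult) (auto simp: L2_rv_msq L2_tendsto_msq ennreal_mult_less_top)
    have "\<forall>\<^sub>F x in F. msq M (\<lambda>\<omega>. Z x \<omega> - W \<omega>) < 1"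
      using assms(1) unfolding L2_tendsto_msq by (rule order_tendstoD) simp
    then show "\<forall>\<^sub>F x in F. ennreal ((norm (LINT \<omega>|M. Z x \<omega> * (U x \<omega> - V \<omega>)))\<^sup>2)
        \<le> (2 * 1 + 2 * msq M W) * msq M (\<lambda>\<omega>. U x \<omega> - V \<omega>)"
    proof eventually_elim
      case (elim x)
      have "msq M (Z x) \<le> 2 * msq M (\<lambda>\<omega>. Z x \<omega> - W \<omega>) + 2 * msq M W"
        using msq_add[of "\<lambda>\<omega>. Z x \<omega> - W \<omega>" M W] L2_rv_diff[OF assms(3,4)] assms(4)
        by (auto simp: L2_rv_def)
      also have "\<dots> \<le> 2 * 1 + 2 * msq M W"
        using elim by (intro add_mono mult_left_mono) auto
      finally have "msq M (Z x) \<le> 2 * 1 + 2 * msq M W" .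
      then have "msq M (Z x) * msq M (\<lambda>\<omega>. U x \<omega> - V \<omega>) \<le> (2 * 1 + 2 * msq M W) * msq M (\<lambda>\<omega>. U x \<omega> - V \<omega>)"
        by (intro mult_right_mono) auto
      with L2_Cauchy_Schwarz(2)[OF assms(3)[of x] L2_rv_diff[OF assms(5)[of x] assms(6)]]
      show ?case by (rule order_trans)
    qed
  qed
  ultimately have "((\<lambda>x. (LINT \<omega>|M. Z x \<omega> * V \<omega>) + (LINT \<omega>|M. Z x \<omega> * (U x \<omega> - V \<omega>))) \<longlongrightarrow> (LINT \<omega>|M. W \<omega> * V \<omega>) + 0) F"
    by (rule tendsto_add)
  moreover have "(LINT \<omega>|M. Z x \<omega> * V \<omega>) + (LINT \<omega>|M. Z x \<omega> * (U x \<omega> - V \<omega>)) = (LINT \<omega>|M. Z x \<omega> * U x \<omega>)" for x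
    by (subst Bochner_Integration.integral_add[symmetric])
      (simp_all add: L2_Cauchy_Schwarz(1) L2_rv_diff assms flip: distrib_left)
  ultimately show ?thesis by simp
qed

text \<open>On a probability space a Cauchy sequence in mean square is also Cauchy in mean, hence
  has a subsequence that converges almost surely. Fatou's lemma along this subsequence carries the
  Cauchy bound over to the limit.\<close>

lemma L2_complete:
  fixes W :: "nat \<Rightarrow> 'a \<Rightarrow> 'b::euclidean_space"
  assumes "prob_space M" and L2: "\<And>n. L2_rv M (W n)"
    and cauchy: "\<And>e::real. e > 0 \<Longrightarrow> \<exists>N. \<forall>m\<ge>N. \<forall>n\<ge>N. msq M (\<lambda>\<omega>. W m \<omega> - W n \<omega>) \<le> ennreal e"
  obtains Z where "L2_rv M Z" "L2_tendsto M sequentially W Z"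
proof -
  interpret prob_space M by fact
  have [measurable]: "\<And>n. W n \<in> borel_measurable M" using L2 by auto
  have L1: "ennreal ((LINT \<omega>|M. norm (f \<omega>))\<^sup>2) \<le> msq M f" "integrable M f"
    if f: "L2_rv M f" for f :: "'a \<Rightarrow> 'b"
  proof -
    have [measurable]: "f \<in> borel_measurable M" using f by auto
    \<comment> \<open>Pairing \<open>norm f\<close> with the constant 1, whose second moment is the
      total mass 1, bounds the mean of \<open>norm f\<close> by its root mean square.\<close>
    have *: "L2_rv M (\<lambda>\<omega>. norm (f \<omega>))" "L2_rv M (\<lambda>\<omega>. 1::real)" using f by (auto simp: L2_rv_def)
    have "msq M (\<lambda>\<omega>. 1::real) = 1" by (simp add: msq_def emeasure_space_1)
    with L2_Cauchy_Schwarz(2)[OF *] show "ennreal ((LINT \<omega>|M. norm (f \<omega>))\<^sup>2) \<le> msq M f"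
      by (simp add: msq_def)
    show "integrable M f" using L2_Cauchy_Schwarz(1)[OF *] by (simp add: integrable_norm_iff)
  qed
  have "\<exists>N. \<forall>i\<ge>N. \<forall>j\<ge>N. LINT x|M. norm (W i x - W j x) < e" if "e > 0" for e
  proof -
    have "(e/2)\<^sup>2 > 0" using that by simp
    from cauchy[OF this] obtain N where
      N: "\<And>m n. m \<ge> N \<Longrightarrow> n \<ge> N \<Longrightarrow> msq M (\<lambda>\<omega>. W m \<omega> - W n \<omega>) \<le> ennreal ((e/2)\<^sup>2)"
      by blast
    have "LINT x|M. norm (W i x - W j x) < e" if "i \<ge> N" "j \<ge> N" for i j
    proof -
      have "ennreal ((LINT x|M. norm (W i x - W j x))\<^sup>2) \<le> ennreal ((e/2)\<^sup>2)"
        using L1(1)[OF L2_rv_diff[OF L2 L2]] N[OF that] by (rule order_trans)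
      then have "(LINT x|M. norm (W i x - W j x))\<^sup>2 \<le> (e/2)\<^sup>2" by (subst (asm) ennreal_le_iff) auto
      then have "(LINT x|M. norm (W i x - W j x)) \<le> e/2" by (rule power2_le_imp_le) (use \<open>e>0\<close> in auto)
      with \<open>e>0\<close> show ?thesis by simp
    qed
    then show ?thesis by blast
  qed
  then obtain r where r: "strict_mono r" "AE x in M. Cauchy (\<lambda>i. W (r i) x)"
    using cauchy_L1_AE_cauchy_subseq[of M W] L1(2)[OF L2] by blast
  define Z where "Z = (\<lambda>x. lim (\<lambda>i. W (r i) x))"
  have Zm[measurable]: "Z \<in> borel_measurable M" unfolding Z_def by (rule borel_measurable_lim_metric) simp
  have AEl: "AE x in M. (\<lambda>i. W (r i) x) \<longlonglongrightarrow> Z x"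
    using r(2) by eventually_elim (auto simp: Z_def Cauchy_convergent_iff convergent_LIMSEQ_iff)
  have lim: "L2_tendsto M sequentially W Z"
    unfolding L2_tendsto_msq
  proof (rule order_tendstoI)
    fix a :: ennreal assume "0 < a"
    \<comment> \<open>Since \<open>a\<close> may be infinite, a finite real \<open>e\<close> with
      \<open>0 < e < a\<close> is extracted first; the Cauchy hypothesis speaks of reals
      only.\<close>
    then obtain b where b: "0 < b" "b < a" using dense by blast
    define e where "e = enn2real b"
    have "b < \<top>" using b(2) by (rule less_le_trans) simp
    then have be: "ennreal e = b" unfolding e_def by simp
    have "ennreal 0 < ennreal e" using b(1) by (simp only: be ennreal_0)
    then have "e > 0" using ennreal_neg[of e] by (cases "e > 0") auto
    moreover have "ennreal e < a" using b(2) by (simp only: be)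
    ultimately have e: "e > 0" "ennreal e < a" by auto
    obtain N where N: "\<And>m n. m \<ge> N \<Longrightarrow> n \<ge> N \<Longrightarrow> msq M (\<lambda>\<omega>. W m \<omega> - W n \<omega>) \<le> ennreal e"
      using cauchy[of e] e by auto
    have "msq M (\<lambda>\<omega>. W n \<omega> - Z \<omega>) < a" if "n \<ge> N" for n
    proof -
      have "msq M (\<lambda>\<omega>. W n \<omega> - Z \<omega>) = (\<integral>\<^sup>+\<omega>. liminf (\<lambda>i. ennreal ((norm (W n \<omega> - W (r i) \<omega>))\<^sup>2)) \<partial>M)"
        unfolding msq_def
      proof (rule nn_integral_cong_AE)
        show "AE \<omega> in M. ennreal ((norm (W n \<omega> - Z \<omega>))\<^sup>2) = liminf (\<lambda>i. ennreal ((norm (W n \<omega> - W (r i) \<omega>))\<^sup>2))"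
          using AEl
        proof eventually_elim
          case (elim \<omega>)
          then have "(\<lambda>i. ennreal ((norm (W n \<omega> - W (r i) \<omega>))\<^sup>2)) \<longlonglongrightarrow> ennreal ((norm (W n \<omega> - Z \<omega>))\<^sup>2)"
            by (intro tendsto_intros) auto
          from lim_imp_Liminf[OF _ this] show ?case by simp
        qed
      qed
      also have "\<dots> \<le> liminf (\<lambda>i. \<integral>\<^sup>+\<omega>. ennreal ((norm (W n \<omega> - W (r i) \<omega>))\<^sup>2) \<partial>M)"
        by (intro nn_integral_liminf) auto
      also have "\<dots> \<le> ennreal e"
      proof -
        have "\<forall>\<^sub>F i in sequentially. r i \<ge> N"
          using filterlim_subseq[OF r(1)] by (simp add: filterlim_at_top)
        then have "\<forall>\<^sub>F i in sequentially. (\<integral>\<^sup>+\<omega>. ennreal ((norm (W n \<omega> - W (r i) \<omega>))\<^sup>2) \<partial>M) \<le> ennreal e"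
          by eventually_elim (use N that in \<open>auto simp: msq_def\<close>)
        then have "liminf (\<lambda>i. \<integral>\<^sup>+\<omega>. ennreal ((norm (W n \<omega> - W (r i) \<omega>))\<^sup>2) \<partial>M) \<le> liminf (\<lambda>i::nat. ennreal e)"
          by (intro Liminf_mono) 
        then show ?thesis by (simp add: Liminf_const)
      qed
      finally show ?thesis using e by auto
    qed
    then show "\<forall>\<^sub>F n in sequentially. msq M (\<lambda>\<omega>. W n \<omega> - Z \<omega>) < a"
      by (auto simp: eventually_sequentially)
  qed auto
  have "L2_rv M Z" by (rule L2_tendsto_L2[OF lim]) (use L2 in auto)
  then show ?thesis using lim that by blast
qed

section \<open>Projections in \<open>L\<^sup>2\<close>\<close>

text \<open>The parallelogram law for \<open>z - a\<close> and \<open>z - b\<close>, solved for the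
  distance between \<open>a\<close> and \<open>b\<close>. The last term involves their midpoint,
  which never leaves a subspace.\<close>

lemma norm_parallelogram:
  fixes z a b :: complex
  shows "(norm (a - b))\<^sup>2 = 2 * (norm (z - a))\<^sup>2 + 2 * (norm (z - b))\<^sup>2 - 4 * (norm (z - (1/2) * (a + b)))\<^sup>2"
proof -
  have real: "(x - y)\<^sup>2 = 2 * (w - x)\<^sup>2 + 2 * (w - y)\<^sup>2 - 4 * (w - (x + y) / 2)\<^sup>2" for x y w :: real
    by (simp add: power2_eq_square field_simps)
  have *: "Re ((1/2) * (a + b)) = (Re a + Re b) / 2" "Im ((1/2) * (a + b)) = (Im a + Im b) / 2"
    by simp_all
  have comb: "A = 2 * X + 2 * Y - 4 * W \<Longrightarrow> B = 2 * X' + 2 * Y' - 4 * W' \<Longrightarrow>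
      A + B = 2 * (X + X') + 2 * (Y + Y') - 4 * (W + W')" for A B X Y W X' Y' W' :: real
    by simp
  show ?thesis
    unfolding cmod_power2 minus_complex.sel * by (rule comb[OF real real])
qed

lemma inverse_Suc_tendsto: "(\<lambda>n. 1 / (real n + 1)) \<longlonglongrightarrow> 0"
  using LIMSEQ_inverse_real_of_nat by (simp add: inverse_eq_divide add.commute)

lemma norm_diff_mult_sq:
  fixes v c u :: complex
  shows "(norm (v - c * u))\<^sup>2 = (norm v)\<^sup>2 - 2 * Re (cnj c * (v * cnj u)) + (norm c)\<^sup>2 * (norm u)\<^sup>2"
  unfolding cmod_power2 by (simp only: minus_complex.sel times_complex.sel cnj.sel) algebra

definition L2_subspace :: "'a measure \<Rightarrow> ('a \<Rightarrow> complex) set \<Rightarrow> bool" where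
  "L2_subspace M H \<longleftrightarrow> (\<forall>U\<in>H. L2_rv M U) \<and> (\<lambda>_. 0) \<in> H \<and>
     (\<forall>U\<in>H. \<forall>V\<in>H. (\<lambda>\<omega>. U \<omega> + V \<omega>) \<in> H) \<and> (\<forall>c. \<forall>U\<in>H. (\<lambda>\<omega>. c * U \<omega>) \<in> H) \<and>
     (\<forall>W Z. (\<forall>n. W n \<in> H) \<longrightarrow> L2_tendsto M sequentially W Z \<longrightarrow> L2_rv M Z \<longrightarrow> Z \<in> H)"

lemma L2_subspaceD:
  assumes "L2_subspace M H"
  shows "U \<in> H \<Longrightarrow> L2_rv M U" "(\<lambda>_. 0) \<in> H" "U \<in> H \<Longrightarrow> V \<in> H \<Longrightarrow> (\<lambda>\<omega>. U \<omega> + V \<omega>) \<in> H"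
    "U \<in> H \<Longrightarrow> (\<lambda>\<omega>. c * U \<omega>) \<in> H" "(\<And>n. W n \<in> H) \<Longrightarrow> L2_tendsto M sequentially W Z \<Longrightarrow> L2_rv M Z \<Longrightarrow> Z \<in> H"
  using assms unfolding L2_subspace_def by blast+

lemma L2_subspace_diff:
  assumes "L2_subspace M H" "U \<in> H" "V \<in> H"
  shows "(\<lambda>\<omega>. U \<omega> - V \<omega>) \<in> H"
  using L2_subspaceD(3)[OF assms(1,2) L2_subspaceD(4)[OF assms(1,3), of "-1"]] by simp

lemma L2_subspace_sum:
  assumes "L2_subspace M H" "\<And>i. i \<in> I \<Longrightarrow> U i \<in> H"
  shows "(\<lambda>\<omega>. \<Sum>i\<in>I. U i \<omega>) \<in> H"
  using assms(2)
  by (induction I rule: infinite_finite_induct) (auto intro: L2_subspaceD(2,3)[OF assms(1)])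

text \<open>The constant sequence \<open>U\<close> converges to \<open>V\<close> in mean square, so
  closedness absorbs modifications on null sets.\<close>

lemma L2_subspace_AE:
  assumes "L2_subspace M H" "U \<in> H" "V \<in> borel_measurable M" "AE \<omega> in M. U \<omega> = V \<omega>"
  shows "V \<in> H"
proof -
  have U: "L2_rv M U" using L2_subspaceD(1)[OF assms(1,2)] .
  have "L2_rv M V" using U assms(3) msq_cong_AE[OF assms(4)] by (simp add: L2_rv_msq)
  moreover have "L2_tendsto M sequentially (\<lambda>_. U) V"
    using L2_tendsto_cong_AE[where Z="\<lambda>_::nat. U" and Z'="\<lambda>_. V" and W=V and W'=V and F=sequentially] assms(4)
    by (simp add: L2_tendsto_const)
  ultimately show ?thesis using L2_subspaceD(5)[OF assms(1), of "\<lambda>_. U" V] assms(2) by simp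
qed

lemma L2_rv_cnj: "L2_rv M f \<Longrightarrow> L2_rv M (\<lambda>\<omega>. cnj (f \<omega>))"
  by (rule L2_rv_linear[OF bounded_linear_cnj])

lemma integrable_mult_cnj: "L2_rv M f \<Longrightarrow> L2_rv M g \<Longrightarrow> integrable M (\<lambda>\<omega>. f \<omega> * cnj (g \<omega>))"
  by (intro L2_Cauchy_Schwarz L2_rv_cnj)

lemma L2_energy_integrable: "L2_rv M (f :: _ \<Rightarrow> complex) \<Longrightarrow> integrable M (\<lambda>\<omega>. (norm (f \<omega>))\<^sup>2)"
  by (simp add: L2_rv_def)

lemma msq_eq_energy:
  "L2_rv M (f :: _ \<Rightarrow> complex) \<Longrightarrow> msq M f = ennreal (LINT \<omega>|M. (norm (f \<omega>))\<^sup>2)"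
  unfolding msq_def by (rule nn_integral_eq_integral) (auto simp: L2_rv_def)

lemma energy_cnj:
  "of_real (LINT \<omega>|M. (norm (f \<omega>))\<^sup>2) = (LINT \<omega>|M. f \<omega> * cnj (f \<omega>))"
  by (simp only: complex_norm_square[symmetric] integral_complex_of_real)

text \<open>The Hilbert space argument: a minimizing sequence is Cauchy by the parallelogram law,
  its limit attains the infimum \<open>d\<close>, and if the residual were not orthogonal to
  \<open>U\<close>, a small step along \<open>U\<close> would bring the distance below
  \<open>d\<close>.\<close>

lemma L2_proj_exists:
  assumes P: "prob_space M" and H: "L2_subspace M H" and Z: "L2_rv M Z"
  obtains W where "W \<in> H" "\<And>U. U \<in> H \<Longrightarrow> (LINT \<omega>|M. (Z \<omega> - W \<omega>) * cnj (U \<omega>)) = 0"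
proof -
  define en where "en f = (LINT \<omega>|M. (norm (f \<omega>))\<^sup>2)" for f :: "'a \<Rightarrow> complex"
  define d where "d = Inf ((\<lambda>W. en (\<lambda>\<omega>. Z \<omega> - W \<omega>)) ` H)"
  have en0: "en f \<ge> 0" for f unfolding en_def by simp
  have bdd: "bdd_below ((\<lambda>W. en (\<lambda>\<omega>. Z \<omega> - W \<omega>)) ` H)" by (rule bdd_belowI[of _ 0]) (auto simp: en0)
  have d_le: "d \<le> en (\<lambda>\<omega>. Z \<omega> - W \<omega>)" if "W \<in> H" for W
    unfolding d_def using that by (intro cInf_lower bdd) auto
  have "\<exists>W\<in>H. en (\<lambda>\<omega>. Z \<omega> - W \<omega>) < d + 1 / (real n + 1)" for n
  proof (rule ccontr)
    assume "\<not> ?thesis"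
    then have "d + 1 / (real n + 1) \<le> d" 
      unfolding d_def using L2_subspaceD(2)[OF H] by (intro cInf_greatest) (auto simp: d_def not_less)
    then show False by (simp add: field_simps)
  qed
  then obtain W where W: "\<And>n. W n \<in> H" "\<And>n. en (\<lambda>\<omega>. Z \<omega> - W n \<omega>) < d + 1 / (real n + 1)"
    by metis
  have WL: "L2_rv M (W n)" for n using L2_subspaceD(1)[OF H W(1)] .
  have par: "en (\<lambda>\<omega>. W m \<omega> - W n \<omega>) \<le> 2 / (real m + 1) + 2 / (real n + 1)" for m n
  proof -
    \<comment> \<open>The midpoint is again a candidate in \<open>H\<close>, so its squared distance
      from \<open>Z\<close> is at least \<open>d\<close>; this controls the subtracted term of the
      parallelogram law.\<close>
    have mid: "(\<lambda>\<omega>. (1/2) * (W m \<omega> + W n \<omega>)) \<in> H" by (intro L2_subspaceD(3,4)[OF H] W(1))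
    have pt: "(norm (W m \<omega> - W n \<omega>))\<^sup>2 = 2 * (norm (Z \<omega> - W m \<omega>))\<^sup>2 + 2 * (norm (Z \<omega> - W n \<omega>))\<^sup>2
      - 4 * (norm (Z \<omega> - (1/2) * (W m \<omega> + W n \<omega>)))\<^sup>2" for \<omega>
      by (rule norm_parallelogram)
    have L: "L2_rv M (\<lambda>\<omega>. Z \<omega> - W m \<omega>)" "L2_rv M (\<lambda>\<omega>. Z \<omega> - W n \<omega>)" "L2_rv M (\<lambda>\<omega>. Z \<omega> - (1/2) * (W m \<omega> + W n \<omega>))"
      by (intro L2_rv_diff L2_rv_add L2_rv_cmult Z WL)+
    have "en (\<lambda>\<omega>. W m \<omega> - W n \<omega>) = 2 * en (\<lambda>\<omega>. Z \<omega> - W m \<omega>) + 2 * en (\<lambda>\<omega>. Z \<omega> - W n \<omega>)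
       - 4 * en (\<lambda>\<omega>. Z \<omega> - (1/2) * (W m \<omega> + W n \<omega>))"
      unfolding en_def pt using L[THEN L2_energy_integrable] by simp
    moreover have "2 / (real k + 1) = 2 * (1 / (real k + 1))" for k by simp
    ultimately show ?thesis using d_le[OF mid] W(2)[of m] W(2)[of n] by argo
  qed
  obtain W0 where W0: "L2_rv M W0" "L2_tendsto M sequentially W W0"
  proof (rule L2_complete[OF P WL])
    fix e :: real assume e: "e > 0"
    obtain N :: nat where N: "4 / e < real N" using reals_Archimedean2 by blast
    have "msq M (\<lambda>\<omega>. W m \<omega> - W n \<omega>) \<le> ennreal e" if "m \<ge> N" "n \<ge> N" for m n
    proof -
      have *: "2 / (real k + 1) \<le> e / 2" if "k \<ge> N" for k
      proof -
        have "4 / e < real k + 1" using N that by linarith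
        then show ?thesis using e by (simp add: field_simps)
      qed
      have "en (\<lambda>\<omega>. W m \<omega> - W n \<omega>) \<le> e" using par[of m n] *[OF that(1)] *[OF that(2)] by linarith
      then show ?thesis using msq_eq_energy[OF L2_rv_diff[OF WL WL]] by (simp add: en_def ennreal_leI)
    qed
    then show "\<exists>N. \<forall>m\<ge>N. \<forall>n\<ge>N. msq M (\<lambda>\<omega>. W m \<omega> - W n \<omega>) \<le> ennreal e" by blast
  qed
  have W0H: "W0 \<in> H" using L2_subspaceD(5)[OF H W(1) W0(2,1)] .
  have enW0: "en (\<lambda>\<omega>. Z \<omega> - W0 \<omega>) \<le> d"
  proof -
    note [measurable] = L2_rv_measurable[OF Z] L2_rv_measurable[OF WL] L2_rv_measurable[OF W0(1)]
    have "L2_tendsto M sequentially (\<lambda>n \<omega>. Z \<omega> - W n \<omega>) (\<lambda>\<omega>. Z \<omega> - W0 \<omega>)"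
      by (intro L2_tendsto_diff L2_tendsto_const W0) auto
    moreover from L2_tendsto_linear[OF bounded_linear_cnj this]
    have "L2_tendsto M sequentially (\<lambda>n \<omega>. cnj (Z \<omega> - W n \<omega>)) (\<lambda>\<omega>. cnj (Z \<omega> - W0 \<omega>))" by simp
    ultimately have "(\<lambda>n. LINT \<omega>|M. (Z \<omega> - W n \<omega>) * cnj (Z \<omega> - W n \<omega>)) \<longlonglongrightarrow> (LINT \<omega>|M. (Z \<omega> - W0 \<omega>) * cnj (Z \<omega> - W0 \<omega>))"
      by (rule L2_tendsto_inner2) (intro L2_rv_cnj L2_rv_diff Z WL W0)+
    then have "(\<lambda>n. of_real (en (\<lambda>\<omega>. Z \<omega> - W n \<omega>)) :: complex) \<longlonglongrightarrow> of_real (en (\<lambda>\<omega>. Z \<omega> - W0 \<omega>))"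
      unfolding energy_cnj en_def .
    then have "(\<lambda>n. en (\<lambda>\<omega>. Z \<omega> - W n \<omega>)) \<longlonglongrightarrow> en (\<lambda>\<omega>. Z \<omega> - W0 \<omega>)"
      by (simp only: tendsto_of_real_iff)
    moreover have "(\<lambda>n. d + 1 / (real n + 1)) \<longlonglongrightarrow> d + 0"
      by (rule tendsto_add[OF tendsto_const inverse_Suc_tendsto])
    ultimately have "en (\<lambda>\<omega>. Z \<omega> - W0 \<omega>) \<le> d + 0"
      by (rule LIMSEQ_le) (use W(2) in \<open>auto intro: less_imp_le\<close>)
    then show ?thesis by simp
  qed
  have "(LINT \<omega>|M. (Z \<omega> - W0 \<omega>) * cnj (U \<omega>)) = 0" if U: "U \<in> H" for U
  proof -
    define e where "e = (LINT \<omega>|M. (Z \<omega> - W0 \<omega>) * cnj (U \<omega>))"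
    \<comment> \<open>The step length is small enough for the quadratic term to be at most half of
      the linear gain. The summand 1 keeps it defined when \<open>U\<close> has energy 0.\<close>
    define s where "s = 1 / (1 + en U)"
    have s: "s > 0" "s * en U \<le> 1" using en0[of U] unfolding s_def by (auto simp: field_simps)
    have UL: "L2_rv M U" using L2_subspaceD(1)[OF H U] .
    let ?c = "of_real s * e"
    have "(\<lambda>\<omega>. W0 \<omega> + ?c * U \<omega>) \<in> H" by (intro L2_subspaceD(3,4)[OF H] W0H U)
    from order_trans[OF enW0 d_le[OF this]]
    have le: "en (\<lambda>\<omega>. Z \<omega> - W0 \<omega>) \<le> en (\<lambda>\<omega>. Z \<omega> - (W0 \<omega> + ?c * U \<omega>))" .
    have pt: "(norm (Z \<omega> - (W0 \<omega> + ?c * U \<omega>)))\<^sup>2 = (norm (Z \<omega> - W0 \<omega>))\<^sup>2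
      - 2 * Re (cnj ?c * ((Z \<omega> - W0 \<omega>) * cnj (U \<omega>))) + (norm ?c)\<^sup>2 * (norm (U \<omega>))\<^sup>2" for \<omega>
      using norm_diff_mult_sq[of "Z \<omega> - W0 \<omega>" ?c "U \<omega>"] by (simp add: diff_diff_eq)
    have "en (\<lambda>\<omega>. Z \<omega> - (W0 \<omega> + ?c * U \<omega>)) = en (\<lambda>\<omega>. Z \<omega> - W0 \<omega>)
       - 2 * (LINT \<omega>|M. Re (cnj ?c * ((Z \<omega> - W0 \<omega>) * cnj (U \<omega>)))) + (norm ?c)\<^sup>2 * en U"
    proof -
      have int: "integrable M (\<lambda>\<omega>. Re (cnj ?c * ((Z \<omega> - W0 \<omega>) * cnj (U \<omega>))))"
        by (intro integrable_Re integrable_mult_right integrable_mult_cnj L2_rv_diff Z W0(1) UL)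
      show ?thesis
        unfolding en_def pt
        by (subst Bochner_Integration.integral_add, intro Bochner_Integration.integrable_diff L2_energy_integrable L2_rv_diff Z W0(1) integrable_mult_right int UL,
            intro integrable_mult_right L2_energy_integrable UL,
            subst Bochner_Integration.integral_diff, intro L2_energy_integrable L2_rv_diff Z W0(1),
            intro integrable_mult_right int, subst (1 2) integral_mult_right_zero) (rule refl)
    qed
    also have "(LINT \<omega>|M. Re (cnj ?c * ((Z \<omega> - W0 \<omega>) * cnj (U \<omega>)))) = Re (cnj ?c * e)"
      unfolding e_def using integrable_mult_cnj[OF L2_rv_diff[OF Z W0(1)] UL]
      by (subst integral_Re) simp_all
    also have "Re (cnj ?c * e) = s * (norm e)\<^sup>2"
      by (simp add: cmod_power2) (simp add: power2_eq_square algebra_simps)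
    also have "(norm ?c)\<^sup>2 * en U = (s * en U) * (s * (norm e)\<^sup>2)"
      by (simp add: norm_mult power2_eq_square)
    finally have "2 * (s * (norm e)\<^sup>2) \<le> (s * en U) * (s * (norm e)\<^sup>2)" using le by simp
    also have "\<dots> \<le> 1 * (s * (norm e)\<^sup>2)" using s by (intro mult_right_mono) auto
    finally have "s * (norm e)\<^sup>2 \<le> 0" by simp
    then have "e = 0" using s by (simp add: mult_le_0_iff)
    then show ?thesis by (simp add: e_def)
  qed
  then show ?thesis using W0H that by blast
qed

lemma L2_proj_spec:
  assumes "prob_space M" "L2_subspace M H" "L2_rv M Z"
  shows "L2_proj M H Z \<in> H" "U \<in> H \<Longrightarrow> (LINT \<omega>|M. (Z \<omega> - L2_proj M H Z \<omega>) * cnj (U \<omega>)) = 0"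
proof -
  have "\<exists>W. W \<in> H \<and> (\<forall>U\<in>H. (LINT \<omega>|M. (Z \<omega> - W \<omega>) * cnj (U \<omega>)) = 0)"
    using L2_proj_exists[OF assms] by metis
  from someI_ex[OF this]
  show "L2_proj M H Z \<in> H" "U \<in> H \<Longrightarrow> (LINT \<omega>|M. (Z \<omega> - L2_proj M H Z \<omega>) * cnj (U \<omega>)) = 0"
    by (auto simp: L2_proj_def)
qed

lemma AE_zero_if_energy_zero:
  assumes "L2_rv M (f :: _ \<Rightarrow> complex)" "(LINT \<omega>|M. f \<omega> * cnj (f \<omega>)) = 0"
  shows "AE \<omega> in M. f \<omega> = 0"
proof -
  have "(LINT \<omega>|M. (norm (f \<omega>))\<^sup>2) = 0"
    using assms(2) energy_cnj[of M f] by (metis of_real_eq_0_iff)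
  then have "msq M f = 0" using msq_eq_energy[OF assms(1)] by simp
  then show ?thesis using assms(1) by (subst (asm) msq_eq_0_iff) auto
qed

text \<open>The difference of two candidates lies in \<open>H\<close> and is orthogonal to
  \<open>H\<close>, hence to itself.\<close>

lemma L2_proj_AE_unique:
  assumes "prob_space M" and H: "L2_subspace M H" and Z: "L2_rv M Z" and W: "W \<in> H"
    and orth: "\<And>U. U \<in> H \<Longrightarrow> (LINT \<omega>|M. (Z \<omega> - W \<omega>) * cnj (U \<omega>)) = 0"
  shows "AE \<omega> in M. L2_proj M H Z \<omega> = W \<omega>"
proof -
  note P = L2_proj_spec[OF assms(1) H Z]
  define D where "D = (\<lambda>\<omega>. L2_proj M H Z \<omega> - W \<omega>)"
  have D: "D \<in> H" unfolding D_def by (intro L2_subspace_diff[OF H] P(1) W)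
  have L: "L2_rv M (\<lambda>\<omega>. Z \<omega> - W \<omega>)" "L2_rv M (\<lambda>\<omega>. Z \<omega> - L2_proj M H Z \<omega>)" "L2_rv M D"
    by (intro L2_rv_diff Z L2_subspaceD(1)[OF H P(1)] L2_subspaceD(1)[OF H W] L2_subspaceD(1)[OF H D])+
  have "(LINT \<omega>|M. D \<omega> * cnj (D \<omega>)) = (LINT \<omega>|M. (Z \<omega> - W \<omega>) * cnj (D \<omega>) - (Z \<omega> - L2_proj M H Z \<omega>) * cnj (D \<omega>))"
    by (rule Bochner_Integration.integral_cong) (auto simp: D_def algebra_simps)
  also have "\<dots> = 0"
    by (subst Bochner_Integration.integral_diff) (auto intro!: integrable_mult_cnj L simp: orth[OF D] P(2)[OF D])
  finally have "AE \<omega> in M. D \<omega> = 0" by (intro AE_zero_if_energy_zero L)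
  then show ?thesis by eventually_elim (simp add: D_def)
qed

text \<open>The abstract form of the final formula: \<open>A\<close> is already in \<open>H\<close>,
  \<open>R\<close> is orthogonal to \<open>H\<close>, and the unresolved parts \<open>B\<close> and
  \<open>C\<close> keep one projection each. The right-hand side is shown to have the characteristic
  property of the projection, and uniqueness does the rest.\<close>

lemma L2_proj_decomposition:
  assumes "prob_space M" and H: "L2_subspace M H" and Z: "L2_rv M Z"
    and A: "A \<in> H" and L: "L2_rv M B" "L2_rv M C" "L2_rv M R"
    and R: "\<And>U. U \<in> H \<Longrightarrow> (LINT \<omega>|M. R \<omega> * cnj (U \<omega>)) = 0"
    and eq: "AE \<omega> in M. Z \<omega> = A \<omega> + B \<omega> + C \<omega> + R \<omega>"
  shows "AE \<omega> in M. L2_proj M H Z \<omega> = A \<omega> + L2_proj M H B \<omega> + L2_proj M H C \<omega>"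
proof (rule L2_proj_AE_unique[OF assms(1) H Z])
  note PB = L2_proj_spec[OF assms(1) H L(1)] and PC = L2_proj_spec[OF assms(1) H L(2)]
  show "(\<lambda>\<omega>. A \<omega> + L2_proj M H B \<omega> + L2_proj M H C \<omega>) \<in> H"
    by (intro L2_subspaceD(3)[OF H] A PB(1) PC(1))
  fix U assume U: "U \<in> H"
  have UL: "L2_rv M U" using L2_subspaceD(1)[OF H U] .
  note LL = L L2_subspaceD(1)[OF H A] L2_subspaceD(1)[OF H PB(1)] L2_subspaceD(1)[OF H PC(1)] Z UL
  note [measurable] = LL[THEN L2_rv_measurable] L2_rv_measurable[OF L2_rv_cnj[OF UL]]
  have "(LINT \<omega>|M. (Z \<omega> - (A \<omega> + L2_proj M H B \<omega> + L2_proj M H C \<omega>)) * cnj (U \<omega>))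
    = (LINT \<omega>|M. (B \<omega> - L2_proj M H B \<omega>) * cnj (U \<omega>) + (C \<omega> - L2_proj M H C \<omega>) * cnj (U \<omega>) + R \<omega> * cnj (U \<omega>))"
  proof (rule integral_cong_AE)
    show "AE \<omega> in M. (Z \<omega> - (A \<omega> + L2_proj M H B \<omega> + L2_proj M H C \<omega>)) * cnj (U \<omega>)
      = (B \<omega> - L2_proj M H B \<omega>) * cnj (U \<omega>) + (C \<omega> - L2_proj M H C \<omega>) * cnj (U \<omega>) + R \<omega> * cnj (U \<omega>)"
      using eq by eventually_elim (simp add: algebra_simps)
  qed measurable
  also have "\<dots> = 0"
    by (simp add: integrable_mult_cnj L2_rv_diff LL PB(2)[OF U] PC(2)[OF U] R[OF U])
  finally show "(LINT \<omega>|M. (Z \<omega> - (A \<omega> + L2_proj M H B \<omega> + L2_proj M H C \<omega>)) * cnj (U \<omega>)) = 0" .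
qed

section \<open>The closed linear span of the past\<close>

lemma lin_spaceI:
  assumes "finite F" "F \<subseteq> S \<times> {..t}" "U = (\<lambda>\<omega>. \<Sum>(s, r)\<in>F. c (s, r) * coord Y s r \<omega>)"
  shows "U \<in> lin_space Y S t"
  unfolding lin_space_def by (intro CollectI exI[of _ F] exI[of _ c] conjI) (fact assms)+

lemma lin_space_generator:
  assumes "v \<in> S" "r \<le> t"
  shows "coord Y v r \<in> lin_space Y S t"
  by (rule lin_spaceI[where c="\<lambda>_. 1" and F="{(v, r)}"]) (simp_all add: assms)

lemma lin_space_add:
  assumes "U \<in> lin_space Y S t" "V \<in> lin_space Y S t"
  shows "(\<lambda>\<omega>. U \<omega> + V \<omega>) \<in> lin_space Y S t"
proof -
  obtain F c G d where F: "finite F" "F \<subseteq> S \<times> {..t}" "U = (\<lambda>\<omega>. \<Sum>(s, r)\<in>F. c (s, r) * coord Y s r \<omega>)"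
    and G: "finite G" "G \<subseteq> S \<times> {..t}" "V = (\<lambda>\<omega>. \<Sum>(s, r)\<in>G. d (s, r) * coord Y s r \<omega>)"
    using assms unfolding lin_space_def by blast
  \<comment> \<open>The index sets of the two combinations may overlap, so both coefficient families
    are extended by 0 to the union and added there.\<close>
  define e where "e x = (if x \<in> F then c x else 0) + (if x \<in> G then d x else 0)" for x
  have "(\<lambda>\<omega>. U \<omega> + V \<omega>) = (\<lambda>\<omega>. \<Sum>(s, r)\<in>F \<union> G. e (s, r) * coord Y s r \<omega>)"
  proof
    fix \<omega>
    have "U \<omega> = (\<Sum>x\<in>F \<union> G. (if x \<in> F then c x else 0) * coord Y (fst x) (snd x) \<omega>)"
      unfolding F(3) using F(1) G(1) by (intro sum.mono_neutral_cong_left) auto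
    moreover have "V \<omega> = (\<Sum>x\<in>F \<union> G. (if x \<in> G then d x else 0) * coord Y (fst x) (snd x) \<omega>)"
      unfolding G(3) using F(1) G(1) by (intro sum.mono_neutral_cong_left) auto
    ultimately show "U \<omega> + V \<omega> = (\<Sum>(s, r)\<in>F \<union> G. e (s, r) * coord Y s r \<omega>)"
      by (simp add: e_def case_prod_unfold distrib_right sum.distrib cong: if_cong)
  qed
  then show ?thesis unfolding lin_space_def using F G
    by (intro CollectI exI[of _ "F \<union> G"] exI[of _ e]) auto
qed

lemma lin_space_cmult:
  assumes "U \<in> lin_space Y S t"
  shows "(\<lambda>\<omega>. c * U \<omega>) \<in> lin_space Y S t"
proof -
  obtain F d where "finite F" "F \<subseteq> S \<times> {..t}" "U = (\<lambda>\<omega>. \<Sum>(s, r)\<in>F. d (s, r) * coord Y s r \<omega>)"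
    using assms unfolding lin_space_def by blast
  then show ?thesis unfolding lin_space_def
    by (intro CollectI exI[of _ F] exI[of _ "\<lambda>x. c * d x"])
      (auto simp: sum_distrib_left mult.assoc case_prod_unfold)
qed

lemma lin_space_L2:
  assumes "\<And>v r. L2_rv M (coord Y v r)" "U \<in> lin_space Y S t"
  shows "L2_rv M U"
proof -
  obtain F c where U: "U = (\<lambda>\<omega>. \<Sum>(s, r)\<in>F. c (s, r) * coord Y s r \<omega>)"
    using assms(2) unfolding lin_space_def by blast
  show ?thesis unfolding U case_prod_unfold by (intro L2_rv_sum L2_rv_cmult assms(1))
qed

lemma lin_space_in_L_space:
  assumes "\<And>v r. L2_rv M (coord Y v r)" "U \<in> lin_space Y S t"
  shows "U \<in> L_space M Y S t"
  unfolding L_space_def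
  by (intro CollectI conjI lin_space_L2[OF assms] exI[of _ "\<lambda>_. U"] allI assms(2) L2_tendsto_const)

text \<open>Closedness is the delicate property, because \<open>L_space\<close> collects limits of
  \<open>lin_space\<close> once. A limit of such limits is reached by a diagonal choice: the
  \<open>n\<close>-th term is replaced by an element of \<open>lin_space\<close> with error below
  \<open>1/(n+1)\<close>.\<close>

lemma L2_subspace_L_space:
  assumes Y: "\<And>v r. L2_rv M (coord Y v r)"
  shows "L2_subspace M (L_space M Y S t)"
  unfolding L2_subspace_def
proof (intro conjI ballI allI impI)
  show "L2_rv M U" if "U \<in> L_space M Y S t" for U using that by (simp add: L_space_def)
  have "(\<lambda>_. 0) \<in> lin_space Y S t"
    by (rule lin_spaceI[where c="\<lambda>_. 0" and F="{}"]) simp_all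
  then show "(\<lambda>_. 0) \<in> L_space M Y S t" by (rule lin_space_in_L_space[OF Y])
  fix U assume "U \<in> L_space M Y S t"
  then obtain u where u: "L2_rv M U" "\<And>n. u n \<in> lin_space Y S t" "L2_tendsto M sequentially u U"
    unfolding L_space_def by blast
  note [measurable] = lin_space_L2[OF Y u(2), THEN L2_rv_measurable] L2_rv_measurable[OF u(1)]
  show "(\<lambda>\<omega>. c * U \<omega>) \<in> L_space M Y S t" for c
  proof -
    have "L2_tendsto M sequentially (\<lambda>n \<omega>. c * u n \<omega>) (\<lambda>\<omega>. c * U \<omega>)"
      by (rule L2_tendsto_linear[OF bounded_linear_mult_right u(3)]) measurable
    moreover have "(\<lambda>\<omega>. c * u n \<omega>) \<in> lin_space Y S t" for n by (rule lin_space_cmult[OF u(2)])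
    ultimately show ?thesis unfolding L_space_def
      by (intro CollectI conjI exI[of _ "\<lambda>n \<omega>. c * u n \<omega>"] allI L2_rv_cmult[OF u(1)])
  qed
  fix V assume "V \<in> L_space M Y S t"
  then obtain v where v: "L2_rv M V" "\<And>n. v n \<in> lin_space Y S t" "L2_tendsto M sequentially v V"
    unfolding L_space_def by blast
  note [measurable] = lin_space_L2[OF Y v(2), THEN L2_rv_measurable] L2_rv_measurable[OF v(1)]
  have "L2_tendsto M sequentially (\<lambda>n \<omega>. u n \<omega> + v n \<omega>) (\<lambda>\<omega>. U \<omega> + V \<omega>)"
    by (rule L2_tendsto_add[OF u(3) v(3)]) measurable
  moreover have "(\<lambda>\<omega>. u n \<omega> + v n \<omega>) \<in> lin_space Y S t" for n by (rule lin_space_add[OF u(2) v(2)])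
  ultimately show "(\<lambda>\<omega>. U \<omega> + V \<omega>) \<in> L_space M Y S t"
    unfolding L_space_def
    by (intro CollectI conjI exI[of _ "\<lambda>n \<omega>. u n \<omega> + v n \<omega>"] allI L2_rv_add[OF u(1) v(1)])
next
  fix W :: "nat \<Rightarrow> _" and Z assume W: "\<forall>n. W n \<in> L_space M Y S t" "L2_tendsto M sequentially W Z" "L2_rv M Z"
  have "\<exists>U\<in>lin_space Y S t. msq M (\<lambda>\<omega>. U \<omega> - W n \<omega>) < ennreal (1 / (real n + 1))" for n
  proof -
    obtain u where u: "\<And>n. u n \<in> lin_space Y S t" "L2_tendsto M sequentially u (W n)"
      using W(1) unfolding L_space_def by blast
    have "\<forall>\<^sub>F i in sequentially. msq M (\<lambda>\<omega>. u i \<omega> - W n \<omega>) < ennreal (1 / (real n + 1))"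
      using u(2) unfolding L2_tendsto_msq by (rule order_tendstoD) (simp add: ennreal_zero_less_divide)
    then show ?thesis using u(1) by (meson eventually_happens' sequentially_bot)
  qed
  then obtain U where U: "\<And>n. U n \<in> lin_space Y S t" "\<And>n. msq M (\<lambda>\<omega>. U n \<omega> - W n \<omega>) < ennreal (1 / (real n + 1))"
    by metis
  have WL: "L2_rv M (W n)" for n using W(1) by (simp add: L_space_def)
  note [measurable] = lin_space_L2[OF Y U(1), THEN L2_rv_measurable] WL[THEN L2_rv_measurable] W(3)[THEN L2_rv_measurable]
  have "(\<lambda>n. ennreal (1 / (real n + 1))) \<longlonglongrightarrow> ennreal 0"
    by (rule tendsto_ennrealI[OF inverse_Suc_tendsto])
  then have lim: "(\<lambda>n. ennreal (1 / (real n + 1))) \<longlonglongrightarrow> 0" by simp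
  have "(\<lambda>n. msq M (\<lambda>\<omega>. U n \<omega> - W n \<omega>)) \<longlonglongrightarrow> 0"
    by (rule ennreal_tendsto_0_le[OF lim always_eventually]) (intro allI less_imp_le U(2))
  then have "L2_tendsto M sequentially (\<lambda>n \<omega>. U n \<omega> - W n \<omega>) (\<lambda>_. 0)"
    unfolding L2_tendsto_msq by simp
  from L2_tendsto_add[OF this W(2)] have "L2_tendsto M sequentially U Z" by simp
  then show "Z \<in> L_space M Y S t" unfolding L_space_def using U(1) W(3) by blast
qed

section \<open>Exponentials of stable matrices\<close>

text \<open>The index range is a finite set and not a type, because the order of the block matrices
  depends on the numbers \<open>p\<close> and \<open>q\<close>. With scalar entries, each entry of
  the exponential is an ordinary real power series.\<close>

primrec mpow :: "'i set \<Rightarrow> ('i \<Rightarrow> 'i \<Rightarrow> real) \<Rightarrow> nat \<Rightarrow> 'i \<Rightarrow> 'i \<Rightarrow> real" where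
  "mpow I f 0 = (\<lambda>i j. if i = j then 1 else 0)"
| "mpow I f (Suc m) = (\<lambda>i j. \<Sum>l\<in>I. f i l * mpow I f m l j)"

definition mexp :: "'i set \<Rightarrow> ('i \<Rightarrow> 'i \<Rightarrow> real) \<Rightarrow> real \<Rightarrow> 'i \<Rightarrow> 'i \<Rightarrow> real" where
  "mexp I f x i j = (\<Sum>m. mpow I f m i j / fact m * x ^ m)"

lemma mpow_Suc_right:
  assumes "finite I" "i \<in> I" "j \<in> I"
  shows "mpow I f (Suc m) i j = (\<Sum>l\<in>I. mpow I f m i l * f l j)"
  using assms(2)
proof (induction m arbitrary: i)
  case 0
  have "(\<Sum>l\<in>I. f i l * (if l = j then 1 else 0)) = f i j"
    using assms by (simp add: if_distrib cong: if_cong)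
  moreover have "(\<Sum>l\<in>I. (if i = l then 1 else 0) * f l j) = (\<Sum>l\<in>I. if l = i then f l j else 0)"
    by (intro sum.cong) auto
  ultimately show ?case using assms(1) 0 by simp
next
  case (Suc m)
  have "mpow I f (Suc (Suc m)) i j = (\<Sum>l\<in>I. f i l * mpow I f (Suc m) l j)" by simp
  also have "\<dots> = (\<Sum>l\<in>I. f i l * (\<Sum>k\<in>I. mpow I f m l k * f k j))"
    by (intro sum.cong refl arg_cong2[where f="(*)"] Suc.IH)
  also have "\<dots> = (\<Sum>k\<in>I. (\<Sum>l\<in>I. f i l * mpow I f m l k) * f k j)"
    unfolding sum_distrib_left sum_distrib_right by (subst sum.swap) (simp add: mult.assoc)
  finally show ?case by simp
qed

text \<open>The sum of the absolute values of all entries dominates each absolute row sum, which is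
  the factor gained per power.\<close>

lemma mpow_bound:
  assumes "finite I" "i \<in> I"
  shows "\<bar>mpow I f m i j\<bar> \<le> (\<Sum>k\<in>I. \<Sum>l\<in>I. \<bar>f k l\<bar>) ^ m"
  using assms(2)
proof (induction m arbitrary: i)
  case (Suc m)
  let ?K = "\<Sum>k\<in>I. \<Sum>l\<in>I. \<bar>f k l\<bar>"
  have K: "?K \<ge> 0" by (intro sum_nonneg) auto
  have "\<bar>mpow I f (Suc m) i j\<bar> \<le> (\<Sum>l\<in>I. \<bar>f i l\<bar> * \<bar>mpow I f m l j\<bar>)"
    by (simp add: order_trans[OF sum_abs] abs_mult)
  also have "\<dots> \<le> (\<Sum>l\<in>I. \<bar>f i l\<bar> * ?K ^ m)"
    by (intro sum_mono mult_left_mono Suc.IH) auto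
  also have "\<dots> = (\<Sum>l\<in>I. \<bar>f i l\<bar>) * ?K ^ m" by (simp add: sum_distrib_right)
  also have "\<dots> \<le> ?K * ?K ^ m"
    using Suc.prems assms(1) K
    by (intro mult_right_mono zero_le_power member_le_sum[where f="\<lambda>k. \<Sum>l\<in>I. \<bar>f k l\<bar>"]) (auto intro: sum_nonneg)
  finally show ?case by simp
qed auto

lemma mexp_summable:
  assumes "finite I" "i \<in> I"
  shows "summable (\<lambda>m. mpow I f m i j / fact m * x ^ m)"
proof (rule summable_comparison_test'[where N=0])
  let ?K = "\<Sum>k\<in>I. \<Sum>l\<in>I. \<bar>f k l\<bar>"
  show "summable (\<lambda>m. inverse (fact m) * (?K * \<bar>x\<bar>) ^ m)" by (rule summable_exp)
  fix m
  have "norm (mpow I f m i j / fact m * x ^ m) = \<bar>mpow I f m i j\<bar> * (inverse (fact m) * \<bar>x\<bar> ^ m)"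
    by (simp add: abs_mult power_abs divide_inverse)
  also have "\<dots> \<le> ?K ^ m * (inverse (fact m) * \<bar>x\<bar> ^ m)"
    by (intro mult_right_mono mpow_bound assms) auto
  finally show "norm (mpow I f m i j / fact m * x ^ m) \<le> inverse (fact m) * (?K * \<bar>x\<bar>) ^ m"
    by (simp add: power_mult_distrib mult_ac)
qed

lemma mexp_0 [simp]: "mexp I f 0 i j = (if i = j then 1 else 0)"
  unfolding mexp_def by (subst powser_zero) simp

text \<open>Termwise differentiation raises the power of the matrix by one. The extra factor can
  then be split off on either side, which gives the two formulas that follow.\<close>

lemma mexp_deriv_aux:
  assumes "finite I" "i \<in> I"
  shows "((\<lambda>x. mexp I f x i j) has_real_derivative (\<Sum>m. mpow I f (Suc m) i j / fact m * x ^ m)) (at x)"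
proof -
  have "diffs (\<lambda>m. mpow I f m i j / fact m) = (\<lambda>m. mpow I f (Suc m) i j / fact m)"
    unfolding diffs_def fact_Suc by (auto simp: fun_eq_iff simp del: mpow.simps of_nat_Suc)
  then show ?thesis
    using termdiffs_strong_converges_everywhere[of "\<lambda>m. mpow I f m i j / fact m" x, OF mexp_summable[OF assms]]
    by (simp add: mexp_def[abs_def] del: mpow.simps)
qed

lemma mexp_deriv_left:
  assumes "finite I" "i \<in> I"
  shows "((\<lambda>x. mexp I f x i j) has_real_derivative (\<Sum>l\<in>I. f i l * mexp I f x l j)) (at x)"
proof -
  have "(\<Sum>l\<in>I. f i l * mexp I f x l j) = (\<Sum>l\<in>I. \<Sum>m. f i l * (mpow I f m l j / fact m * x ^ m))"
    unfolding mexp_def using mexp_summable[OF assms(1)] by (intro sum.cong refl suminf_mult[symmetric]) auto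
  also have "\<dots> = (\<Sum>m. \<Sum>l\<in>I. f i l * (mpow I f m l j / fact m * x ^ m))"
    using mexp_summable[OF assms(1)] by (intro suminf_sum[symmetric] summable_mult) auto
  also have "\<dots> = (\<Sum>m. mpow I f (Suc m) i j / fact m * x ^ m)"
    by (simp add: sum_distrib_right sum_divide_distrib mult.assoc)
  finally show ?thesis using mexp_deriv_aux[OF assms] by simp
qed

lemma mexp_deriv_right:
  assumes "finite I" "i \<in> I" "j \<in> I"
  shows "((\<lambda>x. mexp I f x i j) has_real_derivative (\<Sum>l\<in>I. mexp I f x i l * f l j)) (at x)"
proof -
  have "(\<Sum>l\<in>I. mexp I f x i l * f l j) = (\<Sum>l\<in>I. \<Sum>m. (mpow I f m i l / fact m * x ^ m) * f l j)"
    unfolding mexp_def using mexp_summable[OF assms(1,2)] by (intro sum.cong refl suminf_mult2) auto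
  also have "\<dots> = (\<Sum>m. \<Sum>l\<in>I. (mpow I f m i l / fact m * x ^ m) * f l j)"
    using mexp_summable[OF assms(1,2)] by (intro suminf_sum[symmetric] summable_mult2) auto
  also have "\<dots> = (\<Sum>m. mpow I f (Suc m) i j / fact m * x ^ m)"
    unfolding mpow_Suc_right[OF assms] by (simp add: sum_distrib_left sum_distrib_right sum_divide_distrib mult_ac)
  finally show ?thesis using mexp_deriv_aux[OF assms(1,2)] by simp
qed

text \<open>The function \<open>\<psi>\<close>, the product of the exponentials at
  \<open>x + y - s\<close> and at \<open>s\<close>, has derivative 0, since the right derivative of
  one factor cancels the left derivative of the other. Its values at \<open>s = 0\<close> and
  \<open>s = y\<close> are the two sides.\<close>

lemma mexp_add:
  assumes "finite I" "i \<in> I" "j \<in> I"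
  shows "mexp I f (x + y) i j = (\<Sum>l\<in>I. mexp I f x i l * mexp I f y l j)"
proof -
  define \<psi> where "\<psi> s = (\<Sum>l\<in>I. mexp I f (x + y - s) i l * mexp I f s l j)" for s
  have "(\<psi> has_real_derivative 0) (at s)" for s
  proof -
    have d: "((\<lambda>s. mexp I f (x + y - s) i l) has_real_derivative - (\<Sum>k\<in>I. mexp I f (x + y - s) i k * f k l)) (at s)"
      if "l \<in> I" for l
    proof -
      have "((\<lambda>s. x + y - s) has_real_derivative - 1) (at s)"
        by (auto intro!: derivative_eq_intros)
      from DERIV_chain2[OF mexp_deriv_right[OF assms(1,2) that] this] show ?thesis by simp
    qed
    have "(\<psi> has_real_derivative (\<Sum>l\<in>I. - (\<Sum>k\<in>I. mexp I f (x + y - s) i k * f k l) * mexp I f s l j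
        + (\<Sum>k\<in>I. f l k * mexp I f s k j) * mexp I f (x + y - s) i l)) (at s)"
      unfolding \<psi>_def[abs_def]
      by (intro DERIV_sum DERIV_mult d mexp_deriv_left assms(1))
    moreover have "(\<Sum>l\<in>I. (\<Sum>k\<in>I. mexp I f (x + y - s) i k * f k l) * mexp I f s l j)
        = (\<Sum>l\<in>I. (\<Sum>k\<in>I. f l k * mexp I f s k j) * mexp I f (x + y - s) i l)"
      unfolding sum_distrib_right by (subst sum.swap) (intro sum.cong refl, simp add: mult_ac)
    ultimately show ?thesis by (simp add: sum.distrib sum_negf sum_subtractf)
  qed
  then have "\<psi> 0 = \<psi> y" by (intro DERIV_isconst_all) auto
  moreover have "\<psi> 0 = mexp I f (x + y) i j"
    using assms unfolding \<psi>_def by (simp add: if_distrib cong: if_cong)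
  ultimately show ?thesis by (simp add: \<psi>_def)
qed

section \<open>Exponential decay of orbits of complex vectors\<close>

definition cact :: "'i set \<Rightarrow> ('i \<Rightarrow> 'i \<Rightarrow> real) \<Rightarrow> ('i \<Rightarrow> complex) \<Rightarrow> 'i \<Rightarrow> complex" where
  "cact I f v = (\<lambda>i. \<Sum>j\<in>I. of_real (f i j) * v j)"

abbreviation cshift :: "'i set \<Rightarrow> ('i \<Rightarrow> 'i \<Rightarrow> real) \<Rightarrow> complex \<Rightarrow> ('i \<Rightarrow> complex) \<Rightarrow> 'i \<Rightarrow> complex" where
  "cshift I f z v \<equiv> (\<lambda>i. cact I f v i - z * v i)"

definition decays :: "'i set \<Rightarrow> ('i \<Rightarrow> 'i \<Rightarrow> real) \<Rightarrow> ('i \<Rightarrow> complex) \<Rightarrow> bool" where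
  "decays I f v \<longleftrightarrow> (\<exists>K c. 0 < c \<and> (\<forall>x\<ge>0. \<forall>i\<in>I. norm (cact I (mexp I f x) v i) \<le> K * exp (- c * x)))"

lemma cact_diff: "cact I f (\<lambda>i. u i - v i) i = cact I f u i - cact I f v i"
  by (simp add: cact_def right_diff_distrib sum_subtractf)

lemma cact_cmult: "cact I f (\<lambda>i. c * v i) i = c * cact I f v i"
  by (simp add: cact_def sum_distrib_left mult_ac)

lemma cact_mexp_deriv:
  assumes "finite I" "i \<in> I"
  shows "((\<lambda>x. cact I (mexp I f x) v i) has_vector_derivative cact I (mexp I f x) (cact I f v) i) (at x)"
proof -
  have "((\<lambda>x. complex_of_real (mexp I f x i j)) has_vector_derivative of_real (\<Sum>l\<in>I. mexp I f x i l * f l j)) (at x)"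
    if "j \<in> I" for j
    using mexp_deriv_right[OF assms that] by (rule has_vector_derivative_of_real)
  then have "((\<lambda>x. cact I (mexp I f x) v i) has_vector_derivative
      (\<Sum>j\<in>I. of_real (\<Sum>l\<in>I. mexp I f x i l * f l j) * v j)) (at x)"
    unfolding cact_def by (intro has_vector_derivative_sum has_vector_derivative_mult_left)
  moreover have "(\<Sum>j\<in>I. of_real (\<Sum>l\<in>I. mexp I f x i l * f l j) * v j) = cact I (mexp I f x) (cact I f v) i"
    unfolding cact_def by (simp add: sum_distrib_left sum_distrib_right) (subst sum.swap, simp add: mult_ac)
  ultimately show ?thesis by simp
qed

text \<open>Variation of constants for one eigenvalue factor:
  \<open>u(x) = exp(-zx) exp(fx) v\<close> has derivative \<open>exp(-zx) exp(fx) (f - z) v\<close>,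
  which is controlled by the decay assumed for \<open>(f - z) v\<close>. Integrating from 0 and
  multiplying back by \<open>exp(zx)\<close> gives the decay for \<open>v\<close>.\<close>

lemma decays_step:
  assumes I: "finite I" and z: "Re z < 0" and w: "decays I f (cshift I f z v)"
  shows "decays I f v"
proof -
  obtain K0 c0 where c0: "0 < c0" and K0: "\<And>x i. x \<ge> 0 \<Longrightarrow> i \<in> I \<Longrightarrow>
      norm (cact I (mexp I f x) (cshift I f z v) i) \<le> K0 * exp (- c0 * x)"
    using w unfolding decays_def by blast
  \<comment> \<open>Halving \<open>- Re z\<close> keeps the new rate strictly below
    \<open>- Re z\<close>, so \<open>\<delta> > 0\<close>. The majorant
    \<open>K exp(\<delta> x)\<close> then grows, its integral is at most
    \<open>K / \<delta> exp(\<delta> x)\<close>, and no polynomial factor appears even for repeated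
    eigenvalues.\<close>
  define c where "c = min c0 (- Re z / 2)"
  define K where "K = max K0 0"
  define \<delta> where "\<delta> = - Re z - c"
  define Y where "Y = (\<Sum>i\<in>I. norm (v i))"
  have c: "0 < c" "c \<le> c0" "0 < \<delta>" using c0 z by (auto simp: c_def \<delta>_def)
  have K: "norm (cact I (mexp I f x) (cshift I f z v) i) \<le> K * exp (- c * x)" if "x \<ge> 0" "i \<in> I" for x i
  proof -
    have "K0 * exp (- c0 * x) \<le> K * exp (- c * x)"
      using c that by (intro mult_mono) (auto simp: K_def mult_right_mono)
    then show ?thesis using K0[OF that] by linarith
  qed
  have K_nn: "K \<ge> 0" by (simp add: K_def)
  have "norm (cact I (mexp I f x) v i) \<le> (Y + K / \<delta>) * exp (- c * x)" if x: "x \<ge> 0" and i: "i \<in> I" for x i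
  proof -
    define u where "u x = exp (- (of_real x * z)) * cact I (mexp I f x) v i" for x :: real
    have du: "(u has_vector_derivative exp (- (of_real x * z)) * cact I (mexp I f x) (cshift I f z v) i) (at x)" for x
    proof -
      have "((\<lambda>x. exp (- (complex_of_real x * z))) has_vector_derivative - z * exp (- (of_real x * z))) (at x)"
        by (auto intro!: derivative_eq_intros has_vector_derivative_real_field)
      then have "(u has_vector_derivative exp (- (of_real x * z)) * cact I (mexp I f x) (cact I f v) i
          + - z * exp (- (of_real x * z)) * cact I (mexp I f x) v i) (at x)"
        unfolding u_def[abs_def] by (intro has_vector_derivative_mult cact_mexp_deriv I i)
      then show ?thesis by (simp add: cact_diff cact_cmult algebra_simps)
    qed
    have u0: "u 0 = v i" 
    proof -
      have "cact I (mexp I f 0) v i = (\<Sum>j\<in>I. if j = i then v j else 0)"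
        unfolding cact_def by (intro sum.cong) auto
      then show ?thesis using I i by (simp add: u_def)
    qed
    have "norm (u x - u 0) \<le> K / \<delta> * exp (\<delta> * x)"
    proof (cases "x = 0")
      case True then show ?thesis using K_nn c by simp
    next
      case False
      then have "0 < x" using x by simp
      have dphi: "((\<lambda>x. K / \<delta> * exp (\<delta> * x)) has_vector_derivative K * exp (\<delta> * x)) (at x)" for x
        unfolding has_real_derivative_iff_has_vector_derivative[symmetric]
        using c(3) by (auto intro!: derivative_eq_intros)
      have "norm (u x - u 0) \<le> K / \<delta> * exp (\<delta> * x) - K / \<delta> * exp (\<delta> * 0)"
      proof (rule differentiable_bound_general[OF \<open>0 < x\<close> _ _ du dphi])
        show "continuous_on {0..x} u"
          using du by (intro continuous_at_imp_continuous_on ballI) (blast intro: has_vector_derivative_continuous)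
        show "continuous_on {0..x} (\<lambda>x. K / \<delta> * exp (\<delta> * x))"
          by (intro continuous_intros)
        fix s assume s: "0 < s" "s < x"
        have "norm (exp (- (of_real s * z)) * cact I (mexp I f s) (cshift I f z v) i)
            \<le> exp (- s * Re z) * (K * exp (- c * s))"
          unfolding norm_mult using K[of s i] s i by (intro mult_mono) auto
        also have "\<dots> = K * exp (\<delta> * s)"
          by (simp add: \<delta>_def algebra_simps flip: exp_add)
        finally show "norm (exp (- (of_real s * z)) * cact I (mexp I f s) (cshift I f z v) i) \<le> K * exp (\<delta> * s)" .
      qed
      also have "\<dots> \<le> K / \<delta> * exp (\<delta> * x)" using K_nn c by simp
      finally show ?thesis .
    qed
    then have "norm (u x) \<le> norm (v i) + K / \<delta> * exp (\<delta> * x)"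
      using norm_triangle_ineq2[of "u x" "u 0"] unfolding u0 by linarith
    moreover have "norm (v i) \<le> Y" unfolding Y_def using I i by (intro member_le_sum) auto
    ultimately have u: "norm (u x) \<le> Y + K / \<delta> * exp (\<delta> * x)" by linarith
    have "cact I (mexp I f x) v i = exp (of_real x * z) * u x"
      by (simp add: u_def mult.assoc[symmetric] flip: exp_add)
    then have "norm (cact I (mexp I f x) v i) = exp (x * Re z) * norm (u x)"
      by (simp add: norm_mult)
    also have "\<dots> \<le> exp (x * Re z) * (Y + K / \<delta> * exp (\<delta> * x))"
      using u by (intro mult_left_mono) auto
    also have "\<dots> = Y * exp (x * Re z) + K / \<delta> * exp (- c * x)"
      by (simp add: \<delta>_def algebra_simps flip: exp_add)
    also have "\<dots> \<le> Y * exp (- c * x) + K / \<delta> * exp (- c * x)"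
    proof -
      have "c \<le> - Re z" using c(3) by (simp add: \<delta>_def)
      then have "x * Re z \<le> - c * x" using mult_left_mono[of c "- Re z" x] x by (simp add: mult.commute)
      moreover have "Y \<ge> 0" by (auto simp: Y_def intro: sum_nonneg)
      moreover have "K / \<delta> \<ge> 0" using K_nn c(3) by simp
      ultimately show ?thesis by (intro add_mono mult_left_mono) auto
    qed
    finally show ?thesis by (simp add: algebra_simps)
  qed
  then show ?thesis unfolding decays_def using c(1) by blast
qed

text \<open>The product of the factors \<open>f - z\<close> over the list, applied to
  \<open>v\<close>. A list is used because zeros may be repeated.\<close>

primrec annih :: "'i set \<Rightarrow> ('i \<Rightarrow> 'i \<Rightarrow> real) \<Rightarrow> complex list \<Rightarrow> ('i \<Rightarrow> complex) \<Rightarrow> 'i \<Rightarrow> complex" where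
  "annih I f [] v = v"
| "annih I f (z # zs) v = annih I f zs (cshift I f z v)"

lemma decays_annih:
  assumes "finite I" "\<forall>z\<in>set zs. Re z < 0" "\<forall>i\<in>I. annih I f zs v i = 0"
  shows "decays I f v"
  using assms(2,3)
proof (induction zs arbitrary: v)
  case Nil
  then have "\<forall>x. \<forall>i\<in>I. cact I (mexp I f x) v i = 0" by (simp add: cact_def)
  then show ?case unfolding decays_def by (intro exI[of _ 0] exI[of _ 1]) simp
next
  case (Cons z zs)
  then have "decays I f (cshift I f z v)" by (intro Cons.IH) simp_all
  moreover have "Re z < 0" using Cons.prems(1) by simp
  ultimately show ?case by (rule decays_step[OF assms(1), rotated -1])
qed

text \<open>The factors commute. Moving one of them to the outside shows that a vector killed by the
  whole product yields either an eigenvector or 0 after the other factors have been applied.\<close>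

lemma annih_cshift: "annih I f zs (cshift I f z v) = cshift I f z (annih I f zs v)"
proof (induction zs arbitrary: v)
  case (Cons y zs)
  have "cshift I f y (cshift I f z v) = cshift I f z (cshift I f y v)"
    unfolding cact_diff cact_cmult by (auto simp: fun_eq_iff algebra_simps)
  then show ?case by (simp add: Cons.IH[symmetric])
qed simp

text \<open>The vector \<open>p(f) v\<close>.\<close>

definition pact :: "'i set \<Rightarrow> ('i \<Rightarrow> 'i \<Rightarrow> real) \<Rightarrow> complex poly \<Rightarrow> ('i \<Rightarrow> complex) \<Rightarrow> 'i \<Rightarrow> complex" where
  "pact I f p v i = (\<Sum>m\<le>degree p. coeff p m * (cact I f ^^ m) v i)"

lemma pact_bound:
  assumes "degree p \<le> N"
  shows "pact I f p v i = (\<Sum>m\<le>N. coeff p m * (cact I f ^^ m) v i)"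
  unfolding pact_def using assms
  by (intro sum.mono_neutral_left) (auto intro: coeff_eq_0)

lemma cact_power_cshift:
  "(cact I f ^^ m) (cshift I f z v) i = (cact I f ^^ Suc m) v i - z * (cact I f ^^ m) v i"
proof (induction m arbitrary: i)
  case (Suc m)
  have "(cact I f ^^ Suc m) (cshift I f z v) i = cact I f ((cact I f ^^ m) (cshift I f z v)) i" by simp
  also have "\<dots> = cact I f (\<lambda>i. (cact I f ^^ Suc m) v i - z * (cact I f ^^ m) v i) i"
    unfolding Suc.IH[abs_def] ..
  also have "\<dots> = (cact I f ^^ Suc (Suc m)) v i - z * (cact I f ^^ Suc m) v i"
    unfolding cact_diff cact_cmult by simp
  finally show ?case .
qed simp

text \<open>Multiplication by the linear polynomial shifts the coefficients by one and subtracts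
  \<open>z\<close> times the old ones; on the side of the vector this is the action of
  \<open>f - z\<close>.\<close>

lemma pact_linear_factor: "pact I f ([:- z, 1:] * q) v i = pact I f q (cshift I f z v) i"
proof (cases "q = 0")
  case False
  have deg: "degree ([:- z, 1:] * q) \<le> Suc (degree q)"
    using degree_mult_le[of "[:- z, 1:]" q] by simp
  have "pact I f ([:- z, 1:] * q) v i = (\<Sum>m\<le>Suc (degree q). coeff ([:- z, 1:] * q) m * (cact I f ^^ m) v i)"
    by (rule pact_bound[OF deg])
  also have "\<dots> = (\<Sum>m\<le>Suc (degree q). (case m of 0 \<Rightarrow> 0 | Suc l \<Rightarrow> coeff q l) * (cact I f ^^ m) v i)
      - (\<Sum>m\<le>Suc (degree q). z * coeff q m * (cact I f ^^ m) v i)"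
    unfolding sum_subtractf[symmetric]
    by (intro sum.cong refl) (simp add: coeff_pCons algebra_simps split: nat.splits)
  also have "(\<Sum>m\<le>Suc (degree q). (case m of 0 \<Rightarrow> 0 | Suc l \<Rightarrow> coeff q l) * (cact I f ^^ m) v i)
      = (\<Sum>m\<le>degree q. coeff q m * (cact I f ^^ Suc m) v i)"
    by (subst sum.atMost_Suc_shift) simp
  also have "(\<Sum>m\<le>Suc (degree q). z * coeff q m * (cact I f ^^ m) v i) = (\<Sum>m\<le>degree q. z * coeff q m * (cact I f ^^ m) v i)"
    by (simp add: coeff_eq_0)
  also have "(\<Sum>m\<le>degree q. coeff q m * (cact I f ^^ Suc m) v i) - (\<Sum>m\<le>degree q. z * coeff q m * (cact I f ^^ m) v i)
      = pact I f q (cshift I f z v) i"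
    unfolding pact_def cact_power_cshift sum_subtractf[symmetric]
    by (intro sum.cong refl) (simp add: algebra_simps del: funpow.simps)
  finally show ?thesis .
qed (simp add: pact_def)

text \<open>An eigenvalue factor with \<open>Re z \<ge> 0\<close> acts injectively, so it can be dropped from an annihilating
  polynomial; only factors to which \<open>decays_step\<close> applies remain.\<close>

lemma annih_exists:
  assumes eig: "\<And>z v. (\<exists>i\<in>I. v i \<noteq> 0) \<Longrightarrow> (\<forall>i\<in>I. cact I f v i = z * v i) \<Longrightarrow> Re z < 0"
    and "p \<noteq> 0" "\<forall>i\<in>I. pact I f p v i = 0"
  shows "\<exists>zs. (\<forall>z\<in>set zs. Re z < 0) \<and> (\<forall>i\<in>I. annih I f zs v i = 0)"
  using assms(2,3)
proof (induction "degree p" arbitrary: p v rule: less_induct)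
  case less
  show ?case
  proof (cases "degree p = 0")
    case True
    then obtain a where a: "p = [:a:]" using degree_eq_zeroE by blast
    with less.prems have "\<forall>i\<in>I. v i = 0" by (simp add: pact_def)
    then show ?thesis by (intro exI[of _ "[]"]) simp
  next
    case False
    then have "\<not> constant (poly p)" by (simp add: constant_degree)
    then obtain z where "poly p z = 0" using fundamental_theorem_of_algebra by blast
    then obtain q where q: "p = [:- z, 1:] * q" using poly_eq_0_iff_dvd[of p z] by (auto elim: dvdE)
    then have "q \<noteq> 0" using less.prems(1) by auto
    then have "degree p = Suc (degree q)" unfolding q by (subst degree_mult_eq) auto
    moreover have "\<forall>i\<in>I. pact I f q (cshift I f z v) i = 0"
      using less.prems(2) unfolding q pact_linear_factor .
    ultimately obtain zs where zs: "\<forall>z\<in>set zs. Re z < 0" "\<forall>i\<in>I. annih I f zs (cshift I f z v) i = 0"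
      using less.hyps[of q "cshift I f z v"] \<open>q \<noteq> 0\<close> by auto
    show ?thesis
    proof (cases "Re z < 0")
      case True
      with zs show ?thesis by (intro exI[of _ "z # zs"]) simp
    next
      case False
      have "\<forall>i\<in>I. cact I f (annih I f zs v) i = z * annih I f zs v i"
        using zs(2) unfolding annih_cshift by simp
      then have "\<forall>i\<in>I. annih I f zs v i = 0" using eig[of "annih I f zs v" z] False by blast
      with zs(1) show ?thesis by blast
    qed
  qed
qed

text \<open>More vectors than coordinates are linearly dependent. Gaussian elimination by induction
  on the coordinates: a vector \<open>v j0\<close> with nonzero entry at \<open>i0\<close> serves as
  pivot and clears that coordinate from all others.\<close>

lemma finite_dim_dependent:
  fixes v :: "'j \<Rightarrow> 'i \<Rightarrow> complex"
  assumes "finite I" "finite J" "card I < card J"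
  shows "\<exists>c. (\<exists>j\<in>J. c j \<noteq> 0) \<and> (\<forall>i\<in>I. (\<Sum>j\<in>J. c j * v j i) = 0)"
  using assms
proof (induction I arbitrary: J v rule: finite_induct)
  case empty
  then have "J \<noteq> {}" by auto
  then show ?case by (intro exI[of _ "\<lambda>_. 1"]) auto
next
  case (insert i0 I)
  show ?case
  proof (cases "\<forall>j\<in>J. v j i0 = 0")
    case True
    obtain c where "\<exists>j\<in>J. c j \<noteq> 0" "\<forall>i\<in>I. (\<Sum>j\<in>J. c j * v j i) = 0"
      using insert.IH[of J v] insert.prems insert.hyps by auto
    with True show ?thesis by (intro exI[of _ c]) auto
  next
    case False
    then obtain j0 where j0: "j0 \<in> J" "v j0 i0 \<noteq> 0" by blast
    define r where "r j = v j i0 / v j0 i0" for j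
    have "card I < card (J - {j0})" using insert.prems insert.hyps j0 by simp
    then obtain c where c: "\<exists>j\<in>J - {j0}. c j \<noteq> 0"
        "\<forall>i\<in>I. (\<Sum>j\<in>J - {j0}. c j * (v j i - r j * v j0 i)) = 0"
      using insert.IH[of "J - {j0}" "\<lambda>j i. v j i - r j * v j0 i"] insert.prems by auto
    \<comment> \<open>The coefficient of the pivot collects all multiples of \<open>v j0\<close>
      that were subtracted during the elimination.\<close>
    define d where "d j = (if j = j0 then - (\<Sum>j\<in>J - {j0}. c j * r j) else c j)" for j
    have sum_d: "(\<Sum>j\<in>J. d j * v j i) = (\<Sum>j\<in>J - {j0}. c j * (v j i - r j * v j0 i))" for i
    proof -
      have "(\<Sum>j\<in>J. d j * v j i) = d j0 * v j0 i + (\<Sum>j\<in>J - {j0}. d j * v j i)"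
        using insert.prems j0 by (simp add: sum.remove)
      also have "(\<Sum>j\<in>J - {j0}. d j * v j i) = (\<Sum>j\<in>J - {j0}. c j * v j i)"
        by (intro sum.cong) (auto simp: d_def)
      finally show ?thesis
        by (simp add: d_def right_diff_distrib sum_subtractf sum_distrib_right mult.assoc)
    qed
    have "(\<Sum>j\<in>J. d j * v j i) = 0" if "i \<in> insert i0 I" for i
      unfolding sum_d using that c(2) j0(2) by (auto simp: r_def)
    moreover have "\<exists>j\<in>J. d j \<noteq> 0" using c(1) by (auto simp: d_def)
    ultimately show ?thesis by blast
  qed
qed

text \<open>For every \<open>v\<close> the \<open>card I + 1\<close> iterates \<open>v\<close>,
  \<open>f v\<close>, \<open>f (f v)\<close>, ... are dependent, which provides a nonzero polynomial
  with \<open>p(f) v = 0\<close>. Applying the decay of orbits to the unit vectors bounds the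
  columns of the exponential.\<close>

lemma mexp_decay:
  assumes I: "finite I"
    and eig: "\<And>z v. (\<exists>i\<in>I. v i \<noteq> 0) \<Longrightarrow> (\<forall>i\<in>I. cact I f v i = z * v i) \<Longrightarrow> Re z < 0"
  obtains K c where "0 < c" "0 \<le> K" "\<And>x i j. x \<ge> 0 \<Longrightarrow> i \<in> I \<Longrightarrow> j \<in> I \<Longrightarrow> \<bar>mexp I f x i j\<bar> \<le> K * exp (- c * x)"
proof -
  have all: "decays I f v" for v
  proof -
    let ?J = "{..card I}"
    obtain c where c: "\<exists>m\<in>?J. c m \<noteq> 0" "\<forall>i\<in>I. (\<Sum>m\<in>?J. c m * (cact I f ^^ m) v i) = 0"
      using finite_dim_dependent[OF I, of ?J "\<lambda>m. (cact I f ^^ m) v"] by auto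
    define p where "p = (\<Sum>m\<le>card I. monom (c m) m)"
    have coeff_p: "coeff p m = (if m \<le> card I then c m else 0)" for m
      unfolding p_def by (simp add: coeff_sum)
    have "p \<noteq> 0" using c(1) coeff_p by (metis atMost_iff coeff_0)
    moreover have "degree p \<le> card I" by (rule degree_le) (simp add: coeff_p)
    then have "\<forall>i\<in>I. pact I f p v i = 0"
      using c(2) by (simp add: pact_bound coeff_p)
    ultimately have "\<exists>zs. (\<forall>z\<in>set zs. Re z < 0) \<and> (\<forall>i\<in>I. annih I f zs v i = 0)"
      by (intro annih_exists[of I f p v]) (auto intro: eig)
    then show ?thesis using decays_annih[OF I] by blast
  qed
  have "\<exists>K c. 0 < c \<and> (\<forall>x\<ge>0. \<forall>i\<in>I. \<bar>mexp I f x i j\<bar> \<le> K * exp (- c * x))" if j: "j \<in> I" for j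
  proof -
    have "cact I (mexp I f x) (\<lambda>i. if i = j then 1 else 0) i = of_real (mexp I f x i j)" for x i
      unfolding cact_def using I j by (simp add: if_distrib cong: if_cong)
    with all[of "\<lambda>i. if i = j then 1 else 0"] show ?thesis unfolding decays_def by simp
  qed
  then obtain K c where Kc: "\<And>j. j \<in> I \<Longrightarrow> 0 < c j"
    "\<And>j x i. j \<in> I \<Longrightarrow> x \<ge> 0 \<Longrightarrow> i \<in> I \<Longrightarrow> \<bar>mexp I f x i j\<bar> \<le> K j * exp (- c j * x)"
    by metis
  \<comment> \<open>The element 1 keeps the set nonempty when \<open>I\<close> is empty, so that
    \<open>Min\<close> is meaningful.\<close>
  define c' where "c' = Min (insert 1 (c ` I))"
  define K' where "K' = (\<Sum>j\<in>I. \<bar>K j\<bar>)"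
  have c': "0 < c'" "\<And>j. j \<in> I \<Longrightarrow> c' \<le> c j" unfolding c'_def using I Kc(1) by auto
  have "\<bar>mexp I f x i j\<bar> \<le> K' * exp (- c' * x)" if "x \<ge> 0" "i \<in> I" "j \<in> I" for x i j
  proof -
    have "\<bar>K j\<bar> \<le> K'" unfolding K'_def using I that by (intro member_le_sum) auto
    moreover have "exp (- c j * x) \<le> exp (- c' * x)" using c'(2)[OF that(3)] that by (simp add: mult_right_mono)
    ultimately have "K j * exp (- c j * x) \<le> K' * exp (- c' * x)"
      by (intro mult_mono) auto
    with Kc(2)[OF that(3,1,2)] show ?thesis by linarith
  qed
  moreover have "0 \<le> K'" unfolding K'_def by (intro sum_nonneg) auto
  ultimately show ?thesis using c'(1) that by blast
qed

section \<open>Block matrices\<close>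

text \<open>Reads a block matrix as a scalar matrix whose indices are pairs of a block number and a
  coordinate, so that the scalar theory of the exponential applies to \<open>bexp\<close>.\<close>

definition flat :: "'k::finite bmat \<Rightarrow> nat \<times> 'k \<Rightarrow> nat \<times> 'k \<Rightarrow> real" where
  "flat F x y = F (fst x) (fst y) $ snd x $ snd y"

abbreviation bidx :: "nat \<Rightarrow> (nat \<times> 'k::finite) set" where
  "bidx n \<equiv> {1..n} \<times> UNIV"

lemma bmult_flat:
  "bmult n F G i j $ a $ b = (\<Sum>l\<in>bidx n. flat F (i, a) l * flat G l (j, b))"
  unfolding bmult_def flat_def
  by (simp add: sum_component matrix_matrix_mult_def sum.cartesian_product case_prod_unfold)

lemma bpow_flat: "bpow n F m i j $ a $ b = mpow (bidx n) (flat F) m (i, a) (j, b)"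
proof (induction m arbitrary: i a)
  case 0
  then show ?case by (simp add: bid_def mat_def)
next
  case (Suc m)
  have "flat (bpow n F m) l (j, b) = mpow (bidx n) (flat F) m l (j, b)" for l
    using Suc.IH[of "fst l" "snd l"] by (simp add: flat_def[of "bpow n F m"])
  then show ?case by (simp add: bmult_flat)
qed

lemma sums_vecI: "(\<And>i. (\<lambda>m. f m $ i) sums (s $ i)) \<Longrightarrow> f sums s"
  for f :: "nat \<Rightarrow> 'a::real_normed_vector ^ 'k::finite"
  unfolding sums_def by (rule vec_tendstoI) (simp add: sum_component)

lemma bexp_flat:
  assumes "i \<in> {1..n}"
  shows "bexp n F x i j $ a $ b = mexp (bidx n) (flat F) x (i, a) (j, b)"
proof -
  let ?s = "\<chi> a b. mexp (bidx n) (flat F) x (i, a) (j, b)"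
  have "(\<lambda>m. (x ^ m / fact m) *\<^sub>R bpow n F m i j) sums ?s"
  proof (intro sums_vecI)
    fix a b
    have "(\<lambda>m. mpow (bidx n) (flat F) m (i, a) (j, b) / fact m * x ^ m) sums mexp (bidx n) (flat F) x (i, a) (j, b)"
      unfolding mexp_def using assms by (intro summable_sums mexp_summable) auto
    then show "(\<lambda>m. ((x ^ m / fact m) *\<^sub>R bpow n F m i j) $ a $ b) sums (?s $ a $ b)"
      by (simp add: bpow_flat mult_ac)
  qed
  then have "bexp n F x i j = ?s" unfolding bexp_def by (rule sums_unique[symmetric])
  then show ?thesis by simp
qed

lemma flat_bexp:
  assumes "l \<in> bidx n"
  shows "flat (bexp n F x) l y = mexp (bidx n) (flat F) x l y"
  using bexp_flat[of "fst l" n F x "fst y" "snd l" "snd y"] assms by (auto simp: flat_def)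

lemma has_vector_derivative_vecI:
  fixes f :: "real \<Rightarrow> 'a::real_normed_vector ^ 'k::finite"
  assumes "\<And>i. ((\<lambda>x. f x $ i) has_vector_derivative (f' $ i)) (at x within S)"
  shows "(f has_vector_derivative f') (at x within S)"
proof -
  have "((\<lambda>y. (1 / norm (y - x)) *\<^sub>R (f y - (f x + (y - x) *\<^sub>R f'))) \<longlongrightarrow> 0) (at x within S)"
  proof (rule vec_tendstoI)
    fix i
    show "((\<lambda>y. ((1 / norm (y - x)) *\<^sub>R (f y - (f x + (y - x) *\<^sub>R f'))) $ i) \<longlongrightarrow> 0 $ i) (at x within S)"
      using assms[of i] unfolding has_vector_derivative_def has_derivative_within by simp
  qed
  then show ?thesis
    unfolding has_vector_derivative_def has_derivative_within
    by (simp add: bounded_linear_scaleR_left)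
qed

lemma bexp_deriv_left:
  assumes "i \<in> {1..n}"
  shows "((\<lambda>x. bexp n F x i j) has_vector_derivative bmult n F (bexp n F x) i j) (at x)"
proof (intro has_vector_derivative_vecI)
  fix a b
  have "((\<lambda>x. mexp (bidx n) (flat F) x (i, a) (j, b)) has_real_derivative
      (\<Sum>l\<in>bidx n. flat F (i, a) l * mexp (bidx n) (flat F) x l (j, b))) (at x)"
    by (rule mexp_deriv_left) (use assms in auto)
  then show "((\<lambda>x. bexp n F x i j $ a $ b) has_vector_derivative bmult n F (bexp n F x) i j $ a $ b) (at x)"
    unfolding has_real_derivative_iff_has_vector_derivative bexp_flat[OF assms] bmult_flat
    by (simp add: flat_bexp)
qed

lemma bexp_deriv_right:
  assumes "i \<in> {1..n}" "j \<in> {1..n}"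
  shows "((\<lambda>x. bexp n F x i j) has_vector_derivative bmult n (bexp n F x) F i j) (at x)"
proof (intro has_vector_derivative_vecI)
  fix a b
  have "((\<lambda>x. mexp (bidx n) (flat F) x (i, a) (j, b)) has_real_derivative
      (\<Sum>l\<in>bidx n. mexp (bidx n) (flat F) x (i, a) l * flat F l (j, b))) (at x)"
    by (rule mexp_deriv_right) (use assms in auto)
  moreover have "flat (bexp n F x) (i, a) l = mexp (bidx n) (flat F) x (i, a) l" for l
    using assms(1) by (intro flat_bexp) auto
  ultimately show "((\<lambda>x. bexp n F x i j $ a $ b) has_vector_derivative bmult n (bexp n F x) F i j $ a $ b) (at x)"
    unfolding has_real_derivative_iff_has_vector_derivative bexp_flat[OF assms(1)] bmult_flat
    by simp
qed

lemma bexp_add: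
  assumes "i \<in> {1..n}" "j \<in> {1..n}"
  shows "bexp n F (x + y) i j = bmult n (bexp n F x) (bexp n F y) i j"
proof -
  have "bexp n F (x + y) i j $ a $ b = bmult n (bexp n F x) (bexp n F y) i j $ a $ b" for a b
  proof -
    have "mexp (bidx n) (flat F) (x + y) (i, a) (j, b)
        = (\<Sum>l\<in>bidx n. mexp (bidx n) (flat F) x (i, a) l * mexp (bidx n) (flat F) y l (j, b))"
      by (rule mexp_add) (use assms in auto)
    moreover have "flat (bexp n F x) (i, a) l = mexp (bidx n) (flat F) x (i, a) l" for l
      using assms(1) by (intro flat_bexp) auto
    ultimately show ?thesis unfolding bexp_flat[OF assms(1)] bmult_flat by (simp add: flat_bexp)
  qed
  then show ?thesis by (simp add: vec_eq_iff)
qed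

lemma bexp_0:
  assumes "i \<in> {1..n}"
  shows "bexp n F 0 i j = bid i j"
  using bexp_flat[OF assms, of F 0 j] by (auto simp: vec_eq_iff bid_def mat_def)

section \<open>Eigenvectors of block companion matrices and decay of their exponentials\<close>

lemma norm_matrix_le_sum:
  fixes G :: "real^'n::finite^'m::finite"
  shows "norm G \<le> (\<Sum>a\<in>UNIV. \<Sum>b\<in>UNIV. \<bar>G $ a $ b\<bar>)"
proof -
  have "norm G \<le> (\<Sum>a\<in>UNIV. norm (G $ a))" unfolding norm_vec_def by (rule L2_set_le_sum) auto
  also have "\<dots> \<le> (\<Sum>a\<in>UNIV. \<Sum>b\<in>UNIV. \<bar>G $ a $ b\<bar>)" by (intro sum_mono norm_le_l1_cart)
  finally show ?thesis .
qed

text \<open>The upper block rows force each block of an eigenvector to be \<open>z\<close> times the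
  preceding one, so it has the form \<open>(x, z x, ..., z^(n-1) x)\<close>, and
  \<open>x \<noteq> 0\<close>. The last block row is then a polynomial equation for
  \<open>x\<close>. Both \<open>A_mat\<close> and \<open>Lambda_mat\<close> have this shape, with
  different \<open>R\<close>.\<close>

lemma companion_eigenvector:
  fixes R :: "nat \<Rightarrow> real^'k^'k" and v :: "nat \<times> 'k::finite \<Rightarrow> complex"
  assumes n: "n > 0"
    and F: "\<And>i j. i \<in> {1..n} \<Longrightarrow> j \<in> {1..n} \<Longrightarrow> F i j = (if i < n then (if j = i + 1 then mat 1 else 0) else - R j)"
    and nz: "\<exists>i\<in>bidx n. v i \<noteq> 0"
    and eig: "\<forall>i\<in>bidx n. cact (bidx n) (flat F) v i = z * v i"
  obtains x :: "complex^'k" where "x \<noteq> 0"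
    "\<And>a. z ^ n * x $ a + (\<Sum>j=1..n. z ^ (j - 1) * (cmat (R j) *v x) $ a) = 0"
proof -
  have act: "cact (bidx n) (flat F) v (i, a) = (\<Sum>j=1..n. \<Sum>b\<in>UNIV. of_real (F i j $ a $ b) * v (j, b))" for i a
    unfolding cact_def flat_def by (simp add: sum.cartesian_product case_prod_unfold)
  have step: "v (Suc i, a) = z * v (i, a)" if "1 \<le> i" "i < n" for i a
  proof -
    have "cact (bidx n) (flat F) v (i, a) = z * v (i, a)"
      by (rule bspec[OF eig]) (use that in auto)
    then have "z * v (i, a) = (\<Sum>j=1..n. \<Sum>b\<in>UNIV. of_real (F i j $ a $ b) * v (j, b))"
      unfolding act by (rule sym)
    also have "\<dots> = (\<Sum>j=1..n. if j = Suc i then v (j, a) else 0)"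
    proof (intro sum.cong refl)
      fix j assume "j \<in> {1..n}"
      then have Fj: "F i j = (if j = i + 1 then mat 1 else 0)" using F[of i j] that by simp
      have "(\<Sum>b\<in>UNIV. of_real ((mat 1 :: real^'k^'k) $ a $ b) * v (j, b)) = (\<Sum>b\<in>UNIV. if b = a then v (j, b) else 0)"
        by (intro sum.cong) (auto simp: mat_def)
      then show "(\<Sum>b\<in>UNIV. of_real (F i j $ a $ b) * v (j, b)) = (if j = Suc i then v (j, a) else 0)"
        unfolding Fj by (cases "j = Suc i") simp_all
    qed
    also have "\<dots> = v (Suc i, a)" using that by simp
    finally show ?thesis by simp
  qed
  define x where "x = (\<chi> a. v (1, a))"
  have vx: "v (Suc m, a) = z ^ m * x $ a" if "m < n" for m a
    using that by (induction m) (simp_all add: x_def step)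
  have "x \<noteq> 0"
  proof
    assume "x = 0"
    then have "v (i, a) = 0" if "i \<in> {1..n}" for i a
      using vx[of "i - 1" a] that by (cases i) auto
    with nz show False by auto
  qed
  moreover have "z ^ n * x $ a + (\<Sum>j=1..n. z ^ (j - 1) * (cmat (R j) *v x) $ a) = 0" for a
  proof -
    have "cact (bidx n) (flat F) v (n, a) = z * v (n, a)"
      by (rule bspec[OF eig]) (use n in auto)
    then have "z * v (n, a) = (\<Sum>j=1..n. \<Sum>b\<in>UNIV. of_real (F n j $ a $ b) * v (j, b))"
      unfolding act by (rule sym)
    also have "\<dots> = - (\<Sum>j=1..n. z ^ (j - 1) * (cmat (R j) *v x) $ a)"
      unfolding sum_negf[symmetric]
    proof (intro sum.cong refl)
      fix j assume j: "j \<in> {1..n}"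
      have "F n j = - R j" using F[of n j] j n by simp
      moreover have "v (j, b) = z ^ (j - 1) * x $ b" for b using vx[of "j - 1" b] j by (cases j) auto
      ultimately show "(\<Sum>b\<in>UNIV. of_real (F n j $ a $ b) * v (j, b)) = - (z ^ (j - 1) * (cmat (R j) *v x) $ a)"
        by (simp add: matrix_vector_mult_def cmat_def sum_distrib_left mult_ac flip: sum_negf)
    qed
    also have "z * v (n, a) = z ^ n * x $ a"
      using vx[of "n - 1" a] n by (cases n) auto
    finally show ?thesis by simp
  qed
  ultimately show ?thesis using that by blast
qed

lemma det_eq_0_if_kernel:
  fixes G :: "complex^'k^'k"
  assumes "G *v x = 0" "x \<noteq> 0"
  shows "det G = 0"
proof (rule ccontr)
  assume "det G \<noteq> 0"
  then have "invertible G" by (simp add: invertible_det_nz)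
  then show False using assms unfolding invertible_def
    by (metis matrix_left_invertible_ker)
qed

lemma sum_matrix_vector_mult: "(\<Sum>i\<in>S. f i) *v x = (\<Sum>i\<in>S. f i *v x)"
  for f :: "'i \<Rightarrow> 'a::field^'n^'m"
  by (induction S rule: infinite_finite_induct) (auto simp: matrix_vector_mult_add_rdistrib)

lemma mat_vector_mult_component: "(mat c *v x) $ a = c * x $ a"
  for x :: "'a::field^'k"
proof -
  have "(mat c *v x) $ a = (\<Sum>b\<in>UNIV. if b = a then c * x $ b else 0)"
    unfolding matrix_vector_mult_def mat_def vec_lambda_beta by (intro sum.cong) auto
  then show ?thesis by simp
qed

lemma bexp_decay:
  fixes F :: "'k::finite bmat"
  assumes "\<And>z v. (\<exists>i\<in>bidx n. v i \<noteq> 0) \<Longrightarrow> (\<forall>i\<in>bidx n. cact (bidx n) (flat F) v i = z * v i) \<Longrightarrow> Re z < 0"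
  obtains K c where "0 < c" "0 \<le> K"
    "\<And>x i j. x \<ge> 0 \<Longrightarrow> i \<in> {1..n} \<Longrightarrow> j \<in> {1..n} \<Longrightarrow> norm (bexp n F x i j) \<le> K * exp (- c * x)"
proof -
  have fin: "finite (bidx n :: (nat \<times> 'k) set)" by simp
  obtain K c where c: "0 < c" "0 \<le> K"
    and K: "\<And>x i j. x \<ge> 0 \<Longrightarrow> i \<in> bidx n \<Longrightarrow> j \<in> bidx n \<Longrightarrow> \<bar>mexp (bidx n) (flat F) x i j\<bar> \<le> K * exp (- c * x)"
    by (rule mexp_decay[of "bidx n" "flat F"], rule fin, erule assms, assumption, rule that)
  have "norm (bexp n F x i j) \<le> (real CARD('k) * real CARD('k) * K) * exp (- c * x)"
    if "x \<ge> 0" "i \<in> {1..n}" "j \<in> {1..n}" for x i j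
  proof -
    have "norm (bexp n F x i j) \<le> (\<Sum>a\<in>UNIV. \<Sum>b\<in>UNIV. \<bar>bexp n F x i j $ a $ b\<bar>)"
      by (rule norm_matrix_le_sum)
    also have "\<dots> \<le> (\<Sum>a\<in>(UNIV :: 'k set). \<Sum>b\<in>(UNIV :: 'k set). K * exp (- c * x))"
      unfolding bexp_flat[OF that(2)] using that by (intro sum_mono K) auto
    finally show ?thesis by (simp add: mult.assoc)
  qed
  moreover have "real CARD('k) * real CARD('k) * K \<ge> 0" using c by simp
  ultimately show ?thesis using c(1) that by blast
qed

text \<open>The last block row of an eigenvector says \<open>P(z) x = 0\<close>, once the
  coefficients are listed in reverse order; hence \<open>z\<close> is a zero of the
  determinant.\<close>

lemma bexp_A_mat_decay:
  fixes A :: "nat \<Rightarrow> real^'k^'k"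
  assumes p: "p > 0" and stable: "\<And>z. det (P_poly p A z) = 0 \<Longrightarrow> Re z < 0"
  obtains K c where "0 < c" "0 \<le> K"
    "\<And>x i j. x \<ge> 0 \<Longrightarrow> i \<in> {1..p} \<Longrightarrow> j \<in> {1..p} \<Longrightarrow> norm (bexp p (A_mat p A) x i j) \<le> K * exp (- c * x)"
proof (rule bexp_decay[of p "A_mat p A"])
  fix z and v :: "nat \<times> 'k \<Rightarrow> complex"
  assume v: "\<exists>i\<in>bidx p. v i \<noteq> 0" "\<forall>i\<in>bidx p. cact (bidx p) (flat (A_mat p A)) v i = z * v i"
  obtain x :: "complex^'k" where x: "x \<noteq> 0"
    "\<And>a. z ^ p * x $ a + (\<Sum>j=1..p. z ^ (j - 1) * (cmat (A (p + 1 - j)) *v x) $ a) = 0"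
    by (rule companion_eigenvector[OF p _ v, of "\<lambda>j. A (p + 1 - j)"]) (auto simp: A_mat_def)
  have "P_poly p A z *v x = 0"
  proof (subst vec_eq_iff, intro allI)
    fix a
    have "(P_poly p A z *v x) $ a = z ^ p * x $ a + (\<Sum>i=1..p. z ^ (p - i) * (cmat (A i) *v x) $ a)"
      unfolding P_poly_def
      by (simp add: matrix_vector_mult_add_rdistrib sum_matrix_vector_mult mat_vector_mult_component
          flip: matrix_vector_mul_assoc)
    also have "(\<Sum>i=1..p. z ^ (p - i) * (cmat (A i) *v x) $ a) = (\<Sum>j=1..p. z ^ (j - 1) * (cmat (A (p + 1 - j)) *v x) $ a)"
      by (rule sum.reindex_bij_witness[of _ "\<lambda>i. p + 1 - i" "\<lambda>i. p + 1 - i"]) auto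
    finally show "(P_poly p A z *v x) $ a = 0 $ a" using x(2)[of a] by simp
  qed
  then show "Re z < 0" using stable det_eq_0_if_kernel x(1) by blast
qed (use that in blast)

lemma cmat_mult: "cmat (F ** G) = cmat F ** cmat G"
  by (simp add: cmat_def matrix_matrix_mult_def vec_eq_iff)

text \<open>The last block row of an eigenvector is the monic equation
  \<open>C_q^{-1} Q(z) x = 0\<close>. Multiplying by \<open>C_q\<close> gives
  \<open>Q(z) x = 0\<close>, so \<open>z\<close> is a zero of \<open>det Q\<close>.\<close>

lemma bexp_Lambda_mat_decay:
  fixes C :: "nat \<Rightarrow> real^'k^'k"
  assumes q: "q > 0" and inv: "C q ** matrix_inv (C q) = mat 1"
    and stable: "\<And>z. det (Q_poly q C z) = 0 \<Longrightarrow> Re z < 0"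
  obtains K c where "0 < c" "0 \<le> K"
    "\<And>x i j. x \<ge> 0 \<Longrightarrow> i \<in> {1..q} \<Longrightarrow> j \<in> {1..q} \<Longrightarrow> norm (bexp q (Lambda_mat q C) x i j) \<le> K * exp (- c * x)"
proof (rule bexp_decay[of q "Lambda_mat q C"])
  fix z and v :: "nat \<times> 'k \<Rightarrow> complex"
  assume v: "\<exists>i\<in>bidx q. v i \<noteq> 0" "\<forall>i\<in>bidx q. cact (bidx q) (flat (Lambda_mat q C)) v i = z * v i"
  obtain x :: "complex^'k" where x: "x \<noteq> 0"
    "\<And>a. z ^ q * x $ a + (\<Sum>j=1..q. z ^ (j - 1) * (cmat (matrix_inv (C q) ** C (j - 1)) *v x) $ a) = 0"
    by (rule companion_eigenvector[OF q _ v, of "\<lambda>j. matrix_inv (C q) ** C (j - 1)"]) (auto simp: Lambda_mat_def)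
  have monic: "mat (z ^ q) *v x + (\<Sum>j=1..q. mat (z ^ (j - 1)) *v (cmat (matrix_inv (C q) ** C (j - 1)) *v x)) = 0"
    using x(2) by (simp add: vec_eq_iff mat_vector_mult_component)
  have mat_commute: "cmat G *v (mat c *v y) = mat c *v (cmat G *v y)" for G :: "real^'k^'k" and c y
    by (simp add: vec_eq_iff mat_vector_mult_component)
      (simp add: matrix_vector_mult_def[of "cmat G"] mat_vector_mult_component sum_distrib_left mult_ac)
  have "Q_poly q C z *v x = mat (z ^ q) *v (cmat (C q) *v x) + (\<Sum>j=0..<q. mat (z ^ j) *v (cmat (C j) *v x))"
    unfolding Q_poly_def using q
    by (simp add: sum_matrix_vector_mult matrix_vector_mult_add_rdistrib add.commute atLeastLessThanSuc_atLeastAtMost[symmetric] matrix_vector_mul_assoc)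
  also have "\<dots> = mat (z ^ q) *v (cmat (C q) *v x) + (\<Sum>j=1..q. mat (z ^ (j - 1)) *v (cmat (C (j - 1)) *v x))"
    by (intro arg_cong2[where f="(+)"] refl sum.reindex_bij_witness[of _ "\<lambda>j. j - 1" Suc]) auto
  also have "\<dots> = cmat (C q) *v (mat (z ^ q) *v x + (\<Sum>j=1..q. mat (z ^ (j - 1)) *v (cmat (matrix_inv (C q) ** C (j - 1)) *v x)))"
  proof -
    have "cmat (C q) *v (cmat (matrix_inv (C q) ** G) *v y) = cmat G *v y" for G y
      by (simp add: matrix_vector_mul_assoc cmat_mult[symmetric] matrix_mul_assoc inv)
    then show ?thesis
      by (simp add: matrix_vector_right_distrib vec.linear_sum mat_commute
          linear_sum[OF matrix_vector_mul_linear] flip: mat_commute)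
  qed
  also have "\<dots> = 0" unfolding monic by simp
  finally show "Re z < 0" using stable det_eq_0_if_kernel x(1) by blast
qed (use that in blast)

lemma matrix_inv_full_rank:
  fixes G :: "real^'k^'k"
  assumes "rank G = CARD('k)"
  shows "G ** matrix_inv G = mat 1" "matrix_inv G ** G = mat 1"
proof -
  have "invertible G"
    using assms full_rank_injective[of G] matrix_left_invertible_injective[of G] invertible_left_inverse by blast
  then have "\<exists>B. G ** B = mat 1 \<and> B ** G = mat 1" by (simp add: invertible_def)
  from someI_ex[OF this] show "G ** matrix_inv G = mat 1" "matrix_inv G ** G = mat 1"
    by (auto simp: matrix_inv_def)
qed

section \<open>Covariance of the increments of the driving process\<close>

text \<open>Nonnegativity makes an additive function monotone. Comparing \<open>f (N t)\<close> with
  the values at the integers next to \<open>N t\<close> leaves an error of at most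
  \<open>f 1\<close>, and division by \<open>N\<close> removes it.\<close>

lemma additive_nonneg_linear:
  fixes f :: "real \<Rightarrow> real"
  assumes add: "\<And>s t. 0 \<le> s \<Longrightarrow> 0 \<le> t \<Longrightarrow> f (s + t) = f s + f t"
    and nn: "\<And>t. 0 \<le> t \<Longrightarrow> 0 \<le> f t" and t: "0 \<le> t"
  shows "f t = t * f 1"
proof -
  have f0: "f 0 = 0" using add[of 0 0] by simp
  have mult: "f (real n * s) = real n * f s" if "0 \<le> s" for n s
  proof (induction n)
    case (Suc n)
    have "f (real n * s + s) = f (real n * s) + f s" using that by (intro add) auto
    then show ?case using Suc by (simp add: algebra_simps)
  qed (simp add: f0)
  have mono: "f s \<le> f r" if "0 \<le> s" "s \<le> r" for s r
    using add[of s "r - s"] nn[of "r - s"] that by simp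
  have bound: "\<bar>f t - t * f 1\<bar> * real N \<le> f 1" for N :: nat
  proof -
    define n where "n = nat \<lfloor>real N * t\<rfloor>"
    have "0 \<le> real N * t" using t by simp
    then have n: "real n \<le> real N * t" "real N * t \<le> real n + 1" unfolding n_def by linarith+
    have "real n * f 1 \<le> f (real N * t)" using mono[of "real n" "real N * t"] n mult[of 1 n] by simp
    moreover have "f (real N * t) \<le> (real n + 1) * f 1"
      using mono[of "real N * t" "real (Suc n) * 1"] n t mult[of 1 "Suc n"] by (simp add: add.commute)
    moreover have "real n * f 1 \<le> real N * t * f 1" "real N * t * f 1 \<le> (real n + 1) * f 1"
      using n nn[of 1] by (auto intro!: mult_right_mono)
    ultimately have "\<bar>real N * f t - real N * t * f 1\<bar> \<le> f 1"
      unfolding mult[OF t] by (simp add: algebra_simps abs_le_iff)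
    moreover have "real N * f t - real N * t * f 1 = real N * (f t - t * f 1)" by (simp add: algebra_simps)
    ultimately show ?thesis by (simp add: abs_mult mult.commute)
  qed
  show ?thesis
  proof (rule ccontr)
    assume "f t \<noteq> t * f 1"
    then obtain N :: nat where "f 1 < real N * \<bar>f t - t * f 1\<bar>"
      using ex_less_of_nat_mult[of "\<bar>f t - t * f 1\<bar>" "f 1"] by auto
    with bound[of N] show False by (simp add: mult.commute)
  qed
qed

text \<open>Here \<open>f\<close> may change sign, so there is no monotonicity. Boundedness near 0
  spreads to the unit interval by additivity and, since \<open>f\<close> vanishes at all natural
  numbers, to the whole half-line. A bounded function with \<open>f (n t) = n f t\<close> is
  0.\<close>

lemma additive_small_zero:
  fixes f :: "real \<Rightarrow> real"
  assumes add: "\<And>s t. 0 \<le> s \<Longrightarrow> 0 \<le> t \<Longrightarrow> f (s + t) = f s + f t"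
    and f1: "f 1 = 0" and small: "0 < \<delta>" "\<And>s. 0 < s \<Longrightarrow> s < \<delta> \<Longrightarrow> \<bar>f s\<bar> \<le> B" and t: "0 \<le> t"
  shows "f t = 0"
proof -
  have f0: "f 0 = 0" using add[of 0 0] by simp
  have mult: "f (real n * s) = real n * f s" if "0 \<le> s" for n s
  proof (induction n)
    case (Suc n)
    have "f (real n * s + s) = f (real n * s) + f s" using that by (intro add) auto
    then show ?case using Suc by (simp add: algebra_simps)
  qed (simp add: f0)
  have B: "0 \<le> B" using small(2)[of "\<delta> / 2"] small(1) by auto
  \<comment> \<open>With \<open>N0 > 1 / \<delta>\<close> every point of the unit interval, divided
    by \<open>N0\<close>, falls into the range where \<open>f\<close> is bounded by
    \<open>B\<close>.\<close>
  obtain N0 :: nat where N0: "1 / \<delta> < real N0" using reals_Archimedean2 by blast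
  have N0pos: "0 < real N0" using N0 small(1) by (smt (verit) divide_pos_pos)
  have unit: "\<bar>f s\<bar> \<le> real N0 * B" if "0 \<le> s" "s < 1" for s
  proof (cases "s = 0")
    case True then show ?thesis using f0 B by simp
  next
    case False
    have "s / real N0 < \<delta>"
    proof -
      have "s < \<delta> * real N0" using N0 small(1) that(2) by (simp add: field_simps)
      then show ?thesis using N0pos by (simp add: field_simps)
    qed
    then have "\<bar>f (s / real N0)\<bar> \<le> B" using small(2)[of "s / real N0"] False that N0pos by simp
    moreover have "f s = real N0 * f (s / real N0)"
      using mult[of "s / real N0" N0] N0pos that by simp
    ultimately show ?thesis using N0pos by (simp add: abs_mult)
  qed
  have "\<bar>f t\<bar> * real n \<le> real N0 * B" for n
  proof -
    define m where "m = nat \<lfloor>real n * t\<rfloor>"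
    have "0 \<le> real n * t" using t by simp
    then have m: "real m \<le> real n * t" "real n * t - real m < 1" unfolding m_def by linarith+
    have "f (real n * t) = f (real m) + f (real n * t - real m)"
      using add[of "real m" "real n * t - real m"] m by simp
    moreover have "f (real m) = 0" using mult[of 1 m] f1 by simp
    ultimately have "\<bar>real n * f t\<bar> \<le> real N0 * B" using unit[of "real n * t - real m"] m mult[OF t] by simp
    then show ?thesis by (simp add: abs_mult mult.commute)
  qed
  note bound = this
  show ?thesis
  proof (rule ccontr)
    assume "f t \<noteq> 0"
    then obtain n :: nat where "real N0 * B < real n * \<bar>f t\<bar>"
      using ex_less_of_nat_mult[of "\<bar>f t\<bar>" "real N0 * B"] by auto
    with bound[of n] show False by (simp add: mult.commute)
  qed
qed

lemma measure_lborel_Ioc_max: "measure lborel {l<..r} = max 0 (r - l)" for l r :: real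
  by (cases "l \<le> r") auto

section \<open>Second moments of the increments\<close>

context prob_space
begin

text \<open>By independence the second moment of \<open>U + V\<close> is the average of
  \<open>E (U + v)^2\<close> over the law of \<open>V\<close>. If the average is finite, then
  \<open>E (U + v)^2\<close> is finite for some constant \<open>v\<close>, and subtracting a
  constant does not affect square-integrability.\<close>

lemma indep_square_integrable:
  fixes U V :: "'a \<Rightarrow> real"
  assumes ind: "indep_var borel U borel V" and L2: "L2_rv M (\<lambda>\<omega>. U \<omega> + V \<omega>)"
  shows "L2_rv M U"
proof -
  have [measurable]: "random_variable borel U" "random_variable borel V"
    using indep_var_rv1[OF ind] indep_var_rv2[OF ind] .
  interpret U: prob_space "distr M borel U" by (rule prob_space_distr) simp
  interpret V: prob_space "distr M borel V" by (rule prob_space_distr) simp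
  interpret P: pair_prob_space "distr M borel U" "distr M borel V" ..
  have "msq M (\<lambda>\<omega>. U \<omega> + V \<omega>) = (\<integral>\<^sup>+z. ennreal ((fst z + snd z)\<^sup>2) \<partial>distr M (borel \<Otimes>\<^sub>M borel) (\<lambda>\<omega>. (U \<omega>, V \<omega>)))"
    unfolding msq_def by (subst nn_integral_distr) auto
  also have "distr M (borel \<Otimes>\<^sub>M borel) (\<lambda>\<omega>. (U \<omega>, V \<omega>)) = distr M borel U \<Otimes>\<^sub>M distr M borel V"
    using ind unfolding indep_var_distribution_eq by simp
  also have "(\<integral>\<^sup>+z. ennreal ((fst z + snd z)\<^sup>2) \<partial>(distr M borel U \<Otimes>\<^sub>M distr M borel V))
      = (\<integral>\<^sup>+v. \<integral>\<^sup>+u. ennreal ((u + v)\<^sup>2) \<partial>distr M borel U \<partial>distr M borel V)"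
    by (subst P.nn_integral_snd[symmetric]) (auto simp: case_prod_unfold)
  finally have fin: "(\<integral>\<^sup>+v. \<integral>\<^sup>+u. ennreal ((u + v)\<^sup>2) \<partial>distr M borel U \<partial>distr M borel V) < \<infinity>"
    using L2 by (simp add: L2_rv_msq)
  have "\<exists>v. (\<integral>\<^sup>+u. ennreal ((u + v)\<^sup>2) \<partial>distr M borel U) < \<infinity>"
  proof (rule ccontr)
    assume "\<not> ?thesis"
    then have "(\<integral>\<^sup>+u. ennreal ((u + v)\<^sup>2) \<partial>distr M borel U) = \<infinity>" for v
      by (auto simp: not_less top_unique)
    then have "(\<integral>\<^sup>+v. \<integral>\<^sup>+u. ennreal ((u + v)\<^sup>2) \<partial>distr M borel U \<partial>distr M borel V) = \<infinity>"
      by (simp add: V.emeasure_space_1[simplified])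
    with fin show False by simp
  qed
  then obtain v where v: "(\<integral>\<^sup>+u. ennreal ((u + v)\<^sup>2) \<partial>distr M borel U) < \<infinity>" by blast
  have "(\<integral>\<^sup>+u. ennreal ((u + v)\<^sup>2) \<partial>distr M borel U) = msq M (\<lambda>\<omega>. U \<omega> + v)"
    unfolding msq_def by (subst nn_integral_distr) auto
  with v have "msq M (\<lambda>\<omega>. U \<omega> + v) < \<infinity>" by simp
  then have "L2_rv M (\<lambda>\<omega>. U \<omega> + v)" by (simp add: L2_rv_msq)
  moreover have "L2_rv M (\<lambda>_. v)" by (simp add: L2_rv_def)
  ultimately have "L2_rv M (\<lambda>\<omega>. (U \<omega> + v) - v)" by (rule L2_rv_diff)
  then show ?thesis by simp
qed

lemma L2_integrable:
  fixes f :: "'a \<Rightarrow> 'b::{real_normed_algebra_1, euclidean_space}"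
  assumes "L2_rv M f"
  shows "integrable M f"
proof -
  have "L2_rv M (\<lambda>_. 1 :: 'b)" by (simp add: L2_rv_def)
  from L2_Cauchy_Schwarz(1)[OF assms this] show ?thesis by simp
qed

end

locale square_integrable_levy = prob_space M for M :: "'w measure" +
  fixes L :: "real \<Rightarrow> 'w \<Rightarrow> real^'k::finite"
  assumes levy: "levy_process M L"
    and sq1: "integrable M (\<lambda>\<omega>. (norm (L 1 \<omega>))\<^sup>2)"
    and mean1: "(LINT \<omega>|M. L 1 \<omega>) = 0"
begin

abbreviation incr :: "real^'k \<Rightarrow> real \<Rightarrow> real \<Rightarrow> 'w \<Rightarrow> real" where
  "incr x s t \<equiv> (\<lambda>\<omega>. x \<bullet> (L t \<omega> - L s \<omega>))"

lemma L_measurable [measurable]: "L t \<in> borel_measurable M"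
  using levy unfolding levy_process_def by blast

lemma indep_increments:
  assumes "a < b" "b < c"
  shows "indep_var borel (incr x a b) borel (incr y b c)"
proof -
  \<comment> \<open>Independence is available along strictly increasing sequences of times, so
    \<open>a\<close>, \<open>b\<close>, \<open>c\<close> are continued by \<open>c + 1\<close>,
    \<open>c + 2\<close>, ...; the offset \<open>- 2\<close> makes \<open>r 2 = c\<close>.\<close>
  define r where "r n = (if n = 0 then a else if n = 1 then b else c + real n - 2)" for n :: nat
  have "strict_mono r" unfolding strict_mono_Suc_iff r_def using assms by auto
  then have ind: "indep_vars (\<lambda>_. borel) (\<lambda>i \<omega>. L (r (Suc i)) \<omega> - L (r i) \<omega>) {..<2}"
    using levy unfolding levy_process_def by blast
  have "indep_var borel ((\<lambda>f. x \<bullet> f 0) \<circ> (\<lambda>\<omega>. restrict (\<lambda>i. L (r (Suc i)) \<omega> - L (r i) \<omega>) {0::nat}))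
      borel ((\<lambda>f. y \<bullet> f 1) \<circ> (\<lambda>\<omega>. restrict (\<lambda>i. L (r (Suc i)) \<omega> - L (r i) \<omega>) {1::nat}))"
    by (rule indep_var_compose[OF indep_var_restrict[OF ind]]) auto
  moreover have "r 0 = a" "r (Suc 0) = b" "r (Suc (Suc 0)) = c" by (simp_all add: r_def)
  ultimately show ?thesis by (simp add: comp_def)
qed

lemma incr_distr:
  assumes "s \<le> t"
  shows "distr M borel (incr x (s + h) (t + h)) = distr M borel (incr x s t)"
proof -
  have "distr M borel (\<lambda>\<omega>. L (t + h) \<omega> - L (s + h) \<omega>) = distr M borel (\<lambda>\<omega>. L t \<omega> - L s \<omega>)"
    using levy assms unfolding levy_process_def by blast
  then have "distr (distr M borel (\<lambda>\<omega>. L (t + h) \<omega> - L (s + h) \<omega>)) borel (\<lambda>z. x \<bullet> z)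
      = distr (distr M borel (\<lambda>\<omega>. L t \<omega> - L s \<omega>)) borel (\<lambda>z. x \<bullet> z)" by simp
  then show ?thesis by (subst (asm) (1 2) distr_distr) (auto simp: comp_def)
qed

lemma incr_expectation:
  fixes g :: "real \<Rightarrow> real"
  assumes "s \<le> t" and [measurable]: "g \<in> borel_measurable borel"
  shows "(LINT \<omega>|M. g (incr x s t \<omega>)) = (LINT \<omega>|M. g (incr x 0 (t - s) \<omega>))"
proof -
  have "(LINT \<omega>|M. g (incr x s t \<omega>)) = (LINT z|distr M borel (incr x s t). g z)"
    by (subst integral_distr) auto
  also have "distr M borel (incr x s t) = distr M borel (incr x 0 (t - s))"
    using incr_distr[of 0 "t - s" x s] assms(1) by simp
  also have "(LINT z|distr M borel (incr x 0 (t - s)). g z) = (LINT \<omega>|M. g (incr x 0 (t - s) \<omega>))"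
    by (subst integral_distr) auto
  finally show ?thesis .
qed

lemma L2_incr_shift:
  assumes "s \<le> t" "L2_rv M (incr x 0 (t - s))"
  shows "L2_rv M (incr x s t)"
proof -
  have "msq M (incr x s t) = (\<integral>\<^sup>+z. ennreal (z\<^sup>2) \<partial>distr M borel (incr x s t))"
    unfolding msq_def by (subst nn_integral_distr) auto
  also have "distr M borel (incr x s t) = distr M borel (incr x 0 (t - s))"
    using incr_distr[of 0 "t - s" x s] assms(1) by simp
  also have "(\<integral>\<^sup>+z. ennreal (z\<^sup>2) \<partial>distr M borel (incr x 0 (t - s))) = msq M (incr x 0 (t - s))"
    unfolding msq_def by (subst nn_integral_distr) auto
  finally show ?thesis using assms(2) by (simp add: L2_rv_msq)
qed

lemma L0_AE: "AE \<omega> in M. L 0 \<omega> = 0"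
  using levy unfolding levy_process_def by blast

lemma L2_L1: "L2_rv M (L 1)"
  using sq1 by (simp add: L2_rv_def)

lemma L2_incr_0_1: "L2_rv M (incr x 0 1)"
proof -
  have "L2_rv M (\<lambda>\<omega>. x \<bullet> L 1 \<omega>)"
    by (rule L2_rv_linear[OF bounded_linear_inner_right L2_L1])
  moreover have "msq M (incr x 0 1) = msq M (\<lambda>\<omega>. x \<bullet> L 1 \<omega>)"
    using L0_AE by (intro msq_cong_AE) auto
  ultimately show ?thesis by (simp add: L2_rv_msq)
qed

text \<open>Only the unit increment is square-integrable by hypothesis. A shorter increment is an
  independent summand of it, and a longer one is a sum of increments of length at most 1.\<close>

lemma L2_incr:
  assumes "s \<le> t"
  shows "L2_rv M (incr x s t)"
proof -
  have le1: "L2_rv M (incr x 0 u)" if u: "0 \<le> u" "u \<le> 1" for u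
  proof -
    consider "u = 0" | "0 < u" "u < 1" | "u = 1" using u by linarith
    then show ?thesis
    proof cases
      case 1 then show ?thesis by (simp add: L2_rv_zero)
    next
      case 2
      have "incr x 0 1 = (\<lambda>\<omega>. incr x 0 u \<omega> + incr x u 1 \<omega>)"
        by (auto simp: inner_diff_right)
      then have "L2_rv M (\<lambda>\<omega>. incr x 0 u \<omega> + incr x u 1 \<omega>)" using L2_incr_0_1[of x] by simp
      with indep_increments[OF 2] show ?thesis by (rule indep_square_integrable)
    next
      case 3 then show ?thesis using L2_incr_0_1 by simp
    qed
  qed
  have "L2_rv M (incr x s t)" if "s \<le> t" "t - s \<le> real n" for n s t
    using that
  proof (induction n arbitrary: s)
    case 0
    then have "s = t" by simp
    then show ?case by (simp add: L2_rv_zero)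
  next
    case (Suc n)
    show ?case
    proof (cases "t - s \<le> 1")
      case True
      then show ?thesis using Suc.prems le1[of "t - s"] by (rule_tac L2_incr_shift) auto
    next
      case False
      have "L2_rv M (incr x s (s + 1))" using le1[of 1] by (rule_tac L2_incr_shift) auto
      moreover have "L2_rv M (incr x (s + 1) t)" using False Suc.prems by (intro Suc.IH) auto
      ultimately have "L2_rv M (\<lambda>\<omega>. incr x s (s + 1) \<omega> + incr x (s + 1) t \<omega>)" by (rule L2_rv_add)
      then show ?thesis by (simp add: inner_diff_right)
    qed
  qed
  moreover obtain n :: nat where "t - s \<le> real n" using real_arch_simple by blast
  ultimately show ?thesis using assms by blast
qed

lemma incr_uncorrelated_aux:
  assumes "a \<le> b" "b \<le> c"
  shows "(LINT \<omega>|M. incr x a b \<omega> * incr y b c \<omega>) = (LINT \<omega>|M. incr x a b \<omega>) * (LINT \<omega>|M. incr y b c \<omega>)"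
proof (cases "a = b \<or> b = c")
  case False
  then show ?thesis using assms
    by (intro indep_var_lebesgue_integral indep_increments L2_integrable L2_incr) auto
qed auto

lemma incr_mean_add:
  assumes "0 \<le> s" "0 \<le> t"
  shows "(LINT \<omega>|M. incr x 0 (s + t) \<omega>) = (LINT \<omega>|M. incr x 0 s \<omega>) + (LINT \<omega>|M. incr x 0 t \<omega>)"
proof -
  have "(LINT \<omega>|M. incr x 0 (s + t) \<omega>) = (LINT \<omega>|M. incr x 0 s \<omega> + incr x s (s + t) \<omega>)"
    by (simp add: inner_diff_right)
  also have "\<dots> = (LINT \<omega>|M. incr x 0 s \<omega>) + (LINT \<omega>|M. incr x s (s + t) \<omega>)"
    using assms by (intro Bochner_Integration.integral_add L2_integrable L2_incr) auto
  also have "(LINT \<omega>|M. incr x s (s + t) \<omega>) = (LINT \<omega>|M. incr x 0 t \<omega>)"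
    using incr_expectation[of s "s + t" "\<lambda>z. z" x] assms by simp
  finally show ?thesis .
qed

text \<open>Variances and not second moments, because additivity in \<open>t\<close> is needed
  before the means are known to vanish.\<close>

definition incr_var :: "real^'k \<Rightarrow> real \<Rightarrow> real" where
  "incr_var x t = (LINT \<omega>|M. (incr x 0 t \<omega>)\<^sup>2) - (LINT \<omega>|M. incr x 0 t \<omega>)\<^sup>2"

lemma L2_square_integrable:
  fixes f :: "'w \<Rightarrow> real"
  shows "L2_rv M f \<Longrightarrow> integrable M (\<lambda>\<omega>. (f \<omega>)\<^sup>2)"
  by (simp add: L2_rv_def)

lemma incr_var_eq:
  assumes "0 \<le> t"
  shows "incr_var x t = variance (incr x 0 t)"
  unfolding incr_var_def using assms
  by (intro variance_eq[symmetric] L2_integrable L2_square_integrable L2_incr)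

lemma incr_var_add:
  assumes "0 \<le> s" "0 \<le> t"
  shows "incr_var x (s + t) = incr_var x s + incr_var x t"
proof -
  note L = L2_incr[OF assms(1)] L2_incr[of s "s + t"]
  have t: "s \<le> s + t" using assms by simp
  have "(LINT \<omega>|M. (incr x 0 (s + t) \<omega>)\<^sup>2)
      = (LINT \<omega>|M. (incr x 0 s \<omega>)\<^sup>2 + (incr x s (s + t) \<omega>)\<^sup>2 + 2 * (incr x 0 s \<omega> * incr x s (s + t) \<omega>))"
    by (intro Bochner_Integration.integral_cong refl) (simp add: inner_diff_right power2_eq_square algebra_simps)
  also have "\<dots> = (LINT \<omega>|M. (incr x 0 s \<omega>)\<^sup>2) + (LINT \<omega>|M. (incr x s (s + t) \<omega>)\<^sup>2)
      + 2 * (LINT \<omega>|M. incr x 0 s \<omega> * incr x s (s + t) \<omega>)"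
    using L2_square_integrable[OF L(1)] L2_square_integrable[OF L(2)[OF t]] L2_Cauchy_Schwarz(1)[OF L(1) L(2)[OF t]]
    by simp
  also have "(LINT \<omega>|M. incr x 0 s \<omega> * incr x s (s + t) \<omega>) = (LINT \<omega>|M. incr x 0 s \<omega>) * (LINT \<omega>|M. incr x s (s + t) \<omega>)"
    by (rule incr_uncorrelated_aux) (use assms in auto)
  also have "(LINT \<omega>|M. incr x s (s + t) \<omega>) = (LINT \<omega>|M. incr x 0 t \<omega>)"
    using incr_expectation[of s "s + t" "\<lambda>z. z" x] assms by simp
  also have "(LINT \<omega>|M. (incr x s (s + t) \<omega>)\<^sup>2) = (LINT \<omega>|M. (incr x 0 t \<omega>)\<^sup>2)"
    using incr_expectation[of s "s + t" "\<lambda>z. z\<^sup>2" x] assms by simp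
  finally show ?thesis
    unfolding incr_var_def incr_mean_add[OF assms] by (simp add: power2_eq_square algebra_simps)
qed

lemma incr_var_linear:
  assumes "0 \<le> t"
  shows "incr_var x t = t * incr_var x 1"
  by (rule additive_nonneg_linear[OF incr_var_add _ assms]) (auto simp: incr_var_eq)

text \<open>Additivity of the mean alone does not exclude wild solutions of Cauchy's equation; stochastic
  continuity together with Chebyshev's inequality bounds it near 0.\<close>

lemma incr_mean_small: "\<exists>\<delta>>0. \<forall>s. 0 < s \<longrightarrow> s < \<delta> \<longrightarrow> \<bar>LINT \<omega>|M. incr x 0 s \<omega>\<bar> \<le> norm x + 1"
proof -
  have "\<forall>t. \<forall>\<epsilon>>0. ((\<lambda>s. prob {\<omega>\<in>space M. norm (L s \<omega> - L t \<omega>) > \<epsilon>}) \<longlongrightarrow> 0) (at t)"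
    using levy unfolding levy_process_def by (elim conjE)
  from this[rule_format, of 1 0] have "((\<lambda>s. prob {\<omega>\<in>space M. norm (L s \<omega> - L 0 \<omega>) > 1}) \<longlongrightarrow> 0) (at 0)"
    by simp
  then have "\<forall>\<^sub>F s in at 0. prob {\<omega>\<in>space M. norm (L s \<omega> - L 0 \<omega>) > 1} < 1 / 4"
    by (rule order_tendstoD) simp
  then obtain d where d: "d > 0" "\<And>s. s \<noteq> 0 \<Longrightarrow> \<bar>s\<bar> < d \<Longrightarrow> prob {\<omega>\<in>space M. norm (L s \<omega> - L 0 \<omega>) > 1} < 1 / 4"
    unfolding eventually_at by (auto simp: dist_real_def)
  \<comment> \<open>For \<open>s < \<delta>\<close> the variance \<open>s * incr_var x 1\<close> is
    at most 1/4. The summand 1 guards against a vanishing variance.\<close>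
  define \<delta> where "\<delta> = min d (1 / (4 * (incr_var x 1 + 1)))"
  have v1: "incr_var x 1 \<ge> 0" by (simp add: incr_var_eq)
  have "\<delta> > 0" using d(1) v1 by (simp add: \<delta>_def)
  moreover have "\<bar>LINT \<omega>|M. incr x 0 s \<omega>\<bar> \<le> norm x + 1" if s: "0 < s" "s < \<delta>" for s
  proof (rule ccontr)
    assume big: "\<not> ?thesis"
    define m where "m = (LINT \<omega>|M. incr x 0 s \<omega>)"
    have L2: "L2_rv M (incr x 0 s)" using s by (intro L2_incr) auto
    have "prob {\<omega>\<in>space M. \<bar>incr x 0 s \<omega> - m\<bar> \<ge> 1} \<le> variance (incr x 0 s) / 1\<^sup>2"
      unfolding m_def by (rule Chebyshev_inequality) (use L2_square_integrable[OF L2] in auto)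
    also have "\<dots> = s * incr_var x 1"
      using s incr_var_linear[of s x] by (simp add: incr_var_eq)
    also have "\<dots> \<le> 1 / (4 * (incr_var x 1 + 1)) * incr_var x 1"
      using s v1 by (intro mult_right_mono) (auto simp: \<delta>_def)
    also have "\<dots> \<le> 1 / 4" using v1 by (simp add: field_simps)
    finally have p1: "prob {\<omega>\<in>space M. \<bar>incr x 0 s \<omega> - m\<bar> \<ge> 1} \<le> 1 / 4" .
    have p2: "prob {\<omega>\<in>space M. norm (L s \<omega> - L 0 \<omega>) > 1} < 1 / 4"
      using d(2)[of s] s by (simp add: \<delta>_def)
    \<comment> \<open>If the mean \<open>m\<close> exceeded \<open>norm x + 1\<close> in absolute
      value, each outcome with a jump of size at most 1 would deviate from \<open>m\<close> by at
      least 1. Two events of probability at most 1/4 would then cover the whole space.\<close>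
    have "space M \<subseteq> {\<omega>\<in>space M. \<bar>incr x 0 s \<omega> - m\<bar> \<ge> 1} \<union> {\<omega>\<in>space M. norm (L s \<omega> - L 0 \<omega>) > 1}"
    proof
      fix \<omega> assume \<omega>: "\<omega> \<in> space M"
      have "\<bar>incr x 0 s \<omega>\<bar> \<le> norm x" if "norm (L s \<omega> - L 0 \<omega>) \<le> 1"
      proof -
        have "\<bar>incr x 0 s \<omega>\<bar> \<le> norm x * norm (L s \<omega> - L 0 \<omega>)" by (rule Cauchy_Schwarz_ineq2)
        also have "\<dots> \<le> norm x * 1" using that by (intro mult_left_mono) auto
        finally show ?thesis by simp
      qed
      then show "\<omega> \<in> {\<omega>\<in>space M. \<bar>incr x 0 s \<omega> - m\<bar> \<ge> 1} \<union> {\<omega>\<in>space M. norm (L s \<omega> - L 0 \<omega>) > 1}"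
        using \<omega> big unfolding m_def[symmetric] by force
    qed
    then have "prob (space M) \<le> prob ({\<omega>\<in>space M. \<bar>incr x 0 s \<omega> - m\<bar> \<ge> 1} \<union> {\<omega>\<in>space M. norm (L s \<omega> - L 0 \<omega>) > 1})"
      by (intro finite_measure_mono) auto
    also have "\<dots> \<le> prob {\<omega>\<in>space M. \<bar>incr x 0 s \<omega> - m\<bar> \<ge> 1} + prob {\<omega>\<in>space M. norm (L s \<omega> - L 0 \<omega>) > 1}"
      by (intro measure_Un_le) auto
    finally show False using p1 p2 by (simp add: prob_space)
  qed
  ultimately show ?thesis by blast
qed

text \<open>The mean is additive in the length of the interval, 0 at length 1, and bounded near
  length 0.\<close>

lemma incr_mean_zero:
  assumes "s \<le> t"
  shows "(LINT \<omega>|M. incr x s t \<omega>) = 0"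
proof -
  obtain \<delta> where "\<delta> > 0" "\<And>s. 0 < s \<Longrightarrow> s < \<delta> \<Longrightarrow> \<bar>LINT \<omega>|M. incr x 0 s \<omega>\<bar> \<le> norm x + 1"
    using incr_mean_small by blast
  moreover have "(LINT \<omega>|M. incr x 0 1 \<omega>) = 0"
  proof -
    have "(LINT \<omega>|M. incr x 0 1 \<omega>) = (LINT \<omega>|M. x \<bullet> L 1 \<omega>)"
      using L0_AE by (intro integral_cong_AE) auto
    also have "\<dots> = x \<bullet> (LINT \<omega>|M. L 1 \<omega>)"
    proof (rule integral_inner_right)
      have "integrable M (\<lambda>\<omega>. norm (L 1 \<omega>))"
        using L2_L1 by (intro L2_integrable) (auto simp: L2_rv_def)
      then show "integrable M (L 1)" by (simp add: integrable_norm_iff)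
    qed
    finally show ?thesis by (simp add: mean1)
  qed
  ultimately have "(LINT \<omega>|M. incr x 0 (t - s) \<omega>) = 0"
    using additive_small_zero[of "\<lambda>t. LINT \<omega>|M. incr x 0 t \<omega>" \<delta> "norm x + 1" "t - s"] incr_mean_add assms
    by simp
  then show ?thesis using incr_expectation[OF assms, of "\<lambda>z. z" x] by simp
qed

lemma incr_uncorrelated:
  assumes "a \<le> b" "b \<le> c"
  shows "(LINT \<omega>|M. incr x a b \<omega> * incr y b c \<omega>) = 0"
  using incr_uncorrelated_aux[OF assms] incr_mean_zero[OF assms(1)] by simp

lemma incr_square:
  assumes "s \<le> t"
  shows "(LINT \<omega>|M. (incr x s t \<omega>)\<^sup>2) = (t - s) * (LINT \<omega>|M. (incr x 0 1 \<omega>)\<^sup>2)"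
  using incr_expectation[OF assms, of "\<lambda>z. z\<^sup>2" x] incr_var_linear[of "t - s" x] assms
  by (simp add: incr_var_def incr_mean_zero)

definition cov :: "real^'k \<Rightarrow> real^'k \<Rightarrow> real" where
  "cov x y = (LINT \<omega>|M. incr x 0 1 \<omega> * incr y 0 1 \<omega>)"

text \<open>Polarization: so far only the squares of increments in one direction \<open>x\<close>
  are known to grow linearly.\<close>

lemma incr_same:
  assumes "s \<le> t"
  shows "(LINT \<omega>|M. incr x s t \<omega> * incr y s t \<omega>) = (t - s) * cov x y"
proof -
  have pol: "(LINT \<omega>|M. incr x s t \<omega> * incr y s t \<omega>) = ((LINT \<omega>|M. (incr (x + y) s t \<omega>)\<^sup>2)
      - (LINT \<omega>|M. (incr x s t \<omega>)\<^sup>2) - (LINT \<omega>|M. (incr y s t \<omega>)\<^sup>2)) / 2" if "s \<le> t" for s t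
  proof -
    have "(LINT \<omega>|M. (incr (x + y) s t \<omega>)\<^sup>2)
        = (LINT \<omega>|M. (incr x s t \<omega>)\<^sup>2 + (incr y s t \<omega>)\<^sup>2 + 2 * (incr x s t \<omega> * incr y s t \<omega>))"
      by (intro Bochner_Integration.integral_cong refl) (simp add: inner_add_left power2_eq_square algebra_simps)
    also have "\<dots> = (LINT \<omega>|M. (incr x s t \<omega>)\<^sup>2) + (LINT \<omega>|M. (incr y s t \<omega>)\<^sup>2) + 2 * (LINT \<omega>|M. incr x s t \<omega> * incr y s t \<omega>)"
      using L2_square_integrable[OF L2_incr[OF that]] L2_Cauchy_Schwarz(1)[OF L2_incr[OF that] L2_incr[OF that]]
      by simp
    finally show ?thesis by simp
  qed
  have "cov x y = ((LINT \<omega>|M. (incr (x + y) 0 1 \<omega>)\<^sup>2) - (LINT \<omega>|M. (incr x 0 1 \<omega>)\<^sup>2) - (LINT \<omega>|M. (incr y 0 1 \<omega>)\<^sup>2)) / 2"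
    unfolding cov_def by (rule pol) simp
  then show ?thesis unfolding pol[OF assms] incr_square[OF assms] by (simp only:) argo
qed

text \<open>The longer increment is the shorter one plus a later increment that is uncorrelated with
  it.\<close>

lemma incr_common_start:
  assumes "u \<le> s" "u \<le> t"
  shows "(LINT \<omega>|M. incr x u s \<omega> * incr y u t \<omega>) = (min s t - u) * cov x y"
proof (cases "s \<le> t")
  case True
  have "(LINT \<omega>|M. incr x u s \<omega> * incr y u t \<omega>) = (LINT \<omega>|M. incr x u s \<omega> * incr y u s \<omega> + incr x u s \<omega> * incr y s t \<omega>)"
    by (intro Bochner_Integration.integral_cong refl) (simp add: inner_diff_right algebra_simps)
  also have "\<dots> = (LINT \<omega>|M. incr x u s \<omega> * incr y u s \<omega>) + (LINT \<omega>|M. incr x u s \<omega> * incr y s t \<omega>)"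
    using assms True by (intro Bochner_Integration.integral_add L2_Cauchy_Schwarz(1) L2_incr)
  finally show ?thesis using assms True by (simp add: incr_same incr_uncorrelated)
next
  case False
  then have ts: "t \<le> s" by simp
  have "(LINT \<omega>|M. incr x u s \<omega> * incr y u t \<omega>) = (LINT \<omega>|M. incr x u t \<omega> * incr y u t \<omega> + incr y u t \<omega> * incr x t s \<omega>)"
    by (intro Bochner_Integration.integral_cong refl) (simp add: inner_diff_right algebra_simps)
  also have "\<dots> = (LINT \<omega>|M. incr x u t \<omega> * incr y u t \<omega>) + (LINT \<omega>|M. incr y u t \<omega> * incr x t s \<omega>)"
    using assms ts by (intro Bochner_Integration.integral_add L2_Cauchy_Schwarz(1) L2_incr)
  finally show ?thesis using assms ts by (simp add: incr_same incr_uncorrelated)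
qed

text \<open>The overlap of the two intervals is written as an integral of indicators, so that it
  extends bilinearly to step functions.\<close>

lemma incr_cov:
  assumes "b \<le> c" "b' \<le> c'"
  shows "(LINT \<omega>|M. incr x b c \<omega> * incr y b' c' \<omega>) = cov x y * (LINT u|lborel. indicator {b<..c} u * indicator {b'<..c'} u)"
proof -
  \<comment> \<open>Both increments become differences of increments that start at the common time
    \<open>u0\<close>; four terms of the form \<open>min s t - u0\<close> then combine to the length
    of the overlap.\<close>
  define u0 where "u0 = min b b'"
  have u0: "u0 \<le> b" "u0 \<le> c" "u0 \<le> b'" "u0 \<le> c'" using assms by (auto simp: u0_def)
  note int = L2_Cauchy_Schwarz(1)[OF L2_incr L2_incr]
  have "(LINT \<omega>|M. incr x b c \<omega> * incr y b' c' \<omega>) = (LINT \<omega>|M. incr x u0 c \<omega> * incr y u0 c' \<omega> - incr x u0 b \<omega> * incr y u0 c' \<omega>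
      - incr x u0 c \<omega> * incr y u0 b' \<omega> + incr x u0 b \<omega> * incr y u0 b' \<omega>)"
    by (intro Bochner_Integration.integral_cong refl) (simp add: inner_diff_right algebra_simps)
  also have "\<dots> = (min c c' - u0) * cov x y - (min b c' - u0) * cov x y - (min c b' - u0) * cov x y + (min b b' - u0) * cov x y"
    using u0 by (simp add: int incr_common_start)
  also have "\<dots> = cov x y * max 0 (min c c' - max b b')"
    using assms by (simp add: min_def max_def algebra_simps)
  also have "max 0 (min c c' - max b b') = measure lborel {max b b'<..min c c'}"
    by (rule measure_lborel_Ioc_max[symmetric])
  also have "\<dots> = (LINT u|lborel. indicator {b<..c} u * indicator {b'<..c'} u)"
  proof -
    have "{b<..c} \<inter> {b'<..c'} = {max b b'<..min c c'}" by auto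
    then show ?thesis by (simp add: indicator_inter_arith[symmetric])
  qed
  finally show ?thesis .
qed

end

section \<open>Integrals with respect to the driving process\<close>

lemma integrable_indicator_Ioc: "integrable lborel (indicator {b<..c::real} :: real \<Rightarrow> real)"
  by (cases "b \<le> c") (auto intro!: integrable_real_indicator)

lemma integrable_indicator_Ioc_Int:
  "integrable lborel (\<lambda>u. indicator {b<..c} u * indicator {b'<..c'} u :: real)" for b c b' c' :: real
proof -
  have "{b<..c} \<inter> {b'<..c'} = {max b b'<..min c c'}" by auto
  then have "(\<lambda>u. indicator {b<..c} u * indicator {b'<..c'} u :: real) = indicator {max b b'<..min c c'}"
    by (simp add: fun_eq_iff flip: indicator_inter_arith)
  then show ?thesis by (simp add: integrable_indicator_Ioc del: integrable_indicator_iff)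
qed

lemma L2_rv_indicator_Ioc: "L2_rv lborel (\<lambda>u. indicator {b<..c::real} u *\<^sub>R F)"
  for F :: "'b::euclidean_space"
proof -
  have "(norm (indicator {b<..c} u *\<^sub>R F))\<^sup>2 = indicator {b<..c} u * (norm F)\<^sup>2" for u
    by (simp add: indicator_def)
  moreover have "integrable lborel (\<lambda>u. indicator {b<..c} u * (norm F)\<^sup>2)"
    by (intro integrable_mult_left integrable_indicator_Ioc)
  ultimately show ?thesis by (simp add: L2_rv_def)
qed

context square_integrable_levy
begin

lemma cov_add_left: "cov (x + y) z = cov x z + cov y z"
  unfolding cov_def
  unfolding inner_add_left distrib_right
  by (intro Bochner_Integration.integral_add L2_Cauchy_Schwarz(1) L2_incr) auto

lemma cov_scaleR_left: "cov (c *\<^sub>R x) z = c * cov x z"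
  unfolding cov_def by (simp add: mult.assoc)

lemma cov_commute: "cov x y = cov y x"
  unfolding cov_def by (simp add: mult.commute)

lemma cov_zero_left: "cov 0 z = 0"
  unfolding cov_def by simp

lemma cov_sum_left: "cov (\<Sum>i\<in>I. c i *\<^sub>R x i) z = (\<Sum>i\<in>I. c i * cov (x i) z)"
  by (induction I rule: infinite_finite_induct) (auto simp: cov_add_left cov_scaleR_left cov_zero_left)

lemma cov_sum_right: "cov z (\<Sum>i\<in>I. c i *\<^sub>R x i) = (\<Sum>i\<in>I. c i * cov z (x i))"
  using cov_sum_left[of c x I z] by (simp add: cov_commute)

lemma cov_sum_sum:
  "cov (\<Sum>i\<in>I. c i *\<^sub>R x i) (\<Sum>j\<in>J. d j *\<^sub>R y j) = (\<Sum>i\<in>I. \<Sum>j\<in>J. cov (x i) (y j) * (c i * d j))"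
proof -
  have "c i * cov (x i) (\<Sum>j\<in>J. d j *\<^sub>R y j) = (\<Sum>j\<in>J. cov (x i) (y j) * (c i * d j))" for i
    unfolding cov_sum_right by (simp add: sum_distrib_left mult_ac)
  then show ?thesis unfolding cov_sum_left by simp
qed

lemma cov_component_sum: "cov x y = (\<Sum>a\<in>UNIV. \<Sum>b\<in>UNIV. x $ a * y $ b * cov (axis a 1) (axis b 1))"
proof -
  have e: "z = (\<Sum>a\<in>UNIV. z $ a *\<^sub>R axis a 1)" for z :: "real^'k"
    using basis_expansion[of z] by (simp add: scalar_mult_eq_scaleR)
  have "cov x y = (\<Sum>a\<in>UNIV. x $ a * cov (axis a 1) y)"
    by (subst e[of x]) (rule cov_sum_left)
  also have "\<dots> = (\<Sum>a\<in>UNIV. x $ a * (\<Sum>b\<in>UNIV. y $ b * cov (axis a 1) (axis b 1)))"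
    by (intro sum.cong refl arg_cong2[where f="(*)"]) (subst e[of y], rule cov_sum_right)
  finally show ?thesis by (simp add: sum_distrib_left mult.assoc)
qed

text \<open>A crude bound for the norm of the covariance form of the unit increment, through its
  entries in the standard basis.\<close>

definition noise_const :: real where
  "noise_const = (\<Sum>a\<in>UNIV. \<Sum>b\<in>UNIV. \<bar>cov (axis a 1) (axis b 1)\<bar>)"

lemma noise_const_nonneg: "0 \<le> noise_const"
  unfolding noise_const_def by (intro sum_nonneg) auto

lemma cov_bound: "\<bar>cov x y\<bar> \<le> noise_const * (norm x * norm y)"
proof -
  have "\<bar>cov x y\<bar> \<le> (\<Sum>a\<in>UNIV. \<Sum>b\<in>UNIV. \<bar>x $ a * y $ b * cov (axis a 1) (axis b 1)\<bar>)"
    by (subst cov_component_sum) (intro order_trans[OF sum_abs] sum_mono order_trans[OF sum_abs] order_refl)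
  also have "\<dots> \<le> (\<Sum>a\<in>UNIV. \<Sum>b\<in>UNIV. \<bar>cov (axis a 1) (axis b 1)\<bar> * (norm x * norm y))"
  proof (intro sum_mono)
    fix a b :: 'k
    have "\<bar>x $ a * y $ b * cov (axis a 1) (axis b 1)\<bar> = \<bar>cov (axis a 1) (axis b 1)\<bar> * (\<bar>x $ a\<bar> * \<bar>y $ b\<bar>)"
      by (simp add: abs_mult)
    also have "\<dots> \<le> \<bar>cov (axis a 1) (axis b 1)\<bar> * (norm x * norm y)"
      by (intro mult_left_mono mult_mono component_le_norm_cart) auto
    finally show "\<bar>x $ a * y $ b * cov (axis a 1) (axis b 1)\<bar> \<le> \<bar>cov (axis a 1) (axis b 1)\<bar> * (norm x * norm y)" .
  qed
  finally show ?thesis by (simp add: noise_const_def sum_distrib_right)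
qed

section \<open>Step functions and their integrals\<close>

abbreviation ordered_steps :: "(real \<times> real \<times> (real^'k^'k)) list \<Rightarrow> bool" where
  "ordered_steps \<phi> \<equiv> \<forall>(b, c, F)\<in>set \<phi>. b \<le> c"

lemma step_fun_nth:
  "step_fun \<phi> u $ i = (\<Sum>n<length \<phi>. indicator {fst (\<phi> ! n)<..fst (snd (\<phi> ! n))} u *\<^sub>R (snd (snd (\<phi> ! n)) $ i))"
  unfolding step_fun_def
  by (simp add: sum_list_sum_nth case_prod_unfold sum_component atLeast0LessThan)

lemma step_int_nth:
  "step_int L \<phi> \<omega> $ i = (\<Sum>n<length \<phi>. incr (snd (snd (\<phi> ! n)) $ i) (fst (\<phi> ! n)) (fst (snd (\<phi> ! n))) \<omega>)"
  unfolding step_int_def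
  by (simp add: sum_list_sum_nth case_prod_unfold sum_component atLeast0LessThan matrix_vector_mul_component)

lemma ordered_steps_nth:
  assumes "ordered_steps \<phi>" "n < length \<phi>"
  shows "fst (\<phi> ! n) \<le> fst (snd (\<phi> ! n))"
  using bspec[OF assms(1) nth_mem[OF assms(2)]] by (simp add: case_prod_unfold)

text \<open>Ito's isometry for step functions, in bilinear form and for single rows: both sides are
  expanded over all pairs of steps and agree by \<open>incr_cov\<close>. The steps of a list may
  overlap.\<close>

lemma step_cov:
  assumes "ordered_steps \<phi>" "ordered_steps \<psi>"
  shows "(LINT \<omega>|M. step_int L \<phi> \<omega> $ i * step_int L \<psi> \<omega> $ j)
    = (LINT u|lborel. cov (step_fun \<phi> u $ i) (step_fun \<psi> u $ j))"
    and "integrable lborel (\<lambda>u. cov (step_fun \<phi> u $ i) (step_fun \<psi> u $ j))"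
proof -
  let ?I = "\<lambda>\<phi> n. {fst (\<phi> ! n)<..fst (snd (\<phi> ! n))} :: real set"
  let ?x = "\<lambda>\<phi> i n. snd (snd (\<phi> ! n)) $ i :: real^'k"
  let ?D = "\<lambda>\<phi> i n. incr (?x \<phi> i n) (fst (\<phi> ! n)) (fst (snd (\<phi> ! n)))"
  have int1: "integrable M (\<lambda>\<omega>. ?D \<phi> i n \<omega> * ?D \<psi> j m \<omega>)" if "n < length \<phi>" "m < length \<psi>" for n m
    using that assms by (intro L2_Cauchy_Schwarz(1) L2_incr ordered_steps_nth)
  have int2: "integrable lborel (\<lambda>u. indicator (?I \<phi> n) u * (indicator (?I \<psi> m) u :: real))" for n m
    by (rule integrable_indicator_Ioc_Int)
  have eq: "cov (step_fun \<phi> u $ i) (step_fun \<psi> u $ j) = (\<Sum>n<length \<phi>. \<Sum>m<length \<psi>.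
      cov (?x \<phi> i n) (?x \<psi> j m) * (indicator (?I \<phi> n) u * indicator (?I \<psi> m) u))" for u
    unfolding step_fun_nth by (rule cov_sum_sum)
  show "integrable lborel (\<lambda>u. cov (step_fun \<phi> u $ i) (step_fun \<psi> u $ j))"
    unfolding eq by (intro Bochner_Integration.integrable_sum integrable_mult_right int2)
  have "(LINT \<omega>|M. step_int L \<phi> \<omega> $ i * step_int L \<psi> \<omega> $ j)
      = (LINT \<omega>|M. (\<Sum>n<length \<phi>. \<Sum>m<length \<psi>. ?D \<phi> i n \<omega> * ?D \<psi> j m \<omega>))"
    unfolding step_int_nth sum_product ..
  also have "\<dots> = (\<Sum>n<length \<phi>. \<Sum>m<length \<psi>. LINT \<omega>|M. ?D \<phi> i n \<omega> * ?D \<psi> j m \<omega>)"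
    using int1 by (subst Bochner_Integration.integral_sum) (auto intro!: Bochner_Integration.integrable_sum sum.cong Bochner_Integration.integral_sum)
  also have "\<dots> = (\<Sum>n<length \<phi>. \<Sum>m<length \<psi>. cov (?x \<phi> i n) (?x \<psi> j m) * (LINT u|lborel. indicator (?I \<phi> n) u * indicator (?I \<psi> m) u))"
    using assms by (intro sum.cong refl incr_cov ordered_steps_nth) auto
  also have "\<dots> = (LINT u|lborel. cov (step_fun \<phi> u $ i) (step_fun \<psi> u $ j))"
    unfolding eq using int2
    by (subst Bochner_Integration.integral_sum)
      (auto intro!: Bochner_Integration.integrable_sum integrable_mult_right sum.cong
        simp: Bochner_Integration.integral_sum integrable_mult_right)
  finally show "(LINT \<omega>|M. step_int L \<phi> \<omega> $ i * step_int L \<psi> \<omega> $ j)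
    = (LINT u|lborel. cov (step_fun \<phi> u $ i) (step_fun \<psi> u $ j))" .
qed

lemma step_int_measurable [measurable]: "step_int L \<phi> \<in> borel_measurable M"
proof -
  have "(\<lambda>\<omega>. step_int L \<phi> \<omega>) = (\<lambda>\<omega>. \<Sum>n<length \<phi>. snd (snd (\<phi> ! n)) *v (L (fst (snd (\<phi> ! n))) \<omega> - L (fst (\<phi> ! n)) \<omega>))"
    unfolding step_int_def by (simp add: sum_list_sum_nth case_prod_unfold atLeast0LessThan)
  moreover have "(\<lambda>\<omega>. F *v (L t \<omega> - L s \<omega>)) \<in> borel_measurable M" for F :: "real^'k^'k" and s t
    by (intro measurable_compose[OF _ borel_measurable_continuous_onI[OF linear_continuous_on[OF matrix_vector_mul_bounded_linear]]]) measurable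
  ultimately show ?thesis by simp
qed

lemma step_fun_measurable [measurable]: "step_fun \<phi> \<in> borel_measurable borel"
proof -
  have "step_fun \<phi> = (\<lambda>u. \<Sum>n<length \<phi>. indicator {fst (\<phi> ! n)<..fst (snd (\<phi> ! n))} u *\<^sub>R snd (snd (\<phi> ! n)))"
    unfolding step_fun_def by (simp add: sum_list_sum_nth case_prod_unfold atLeast0LessThan fun_eq_iff)
  moreover have "\<dots> \<in> borel_measurable borel"
    by (intro borel_measurable_sum borel_measurable_scaleR borel_measurable_indicator borel_measurable_const) auto
  ultimately show ?thesis by simp
qed

lemma step_fun_L2: "L2_rv lborel (step_fun \<phi>)"
proof -
  have "L2_rv lborel (\<lambda>u. \<Sum>n<length \<phi>. indicator {fst (\<phi> ! n)<..fst (snd (\<phi> ! n))} u *\<^sub>R snd (snd (\<phi> ! n)))"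
    by (intro L2_rv_sum L2_rv_indicator_Ioc)
  then show ?thesis
    unfolding step_fun_def[abs_def] by (simp add: sum_list_sum_nth case_prod_unfold atLeast0LessThan)
qed

lemma norm_sq_components: "(norm x)\<^sup>2 = (\<Sum>i\<in>UNIV. (norm (x $ i))\<^sup>2)" for x :: "'b::real_normed_vector^'n::finite"
  unfolding norm_vec_def L2_set_def by (simp add: sum_nonneg)

lemma step_int_component_L2:
  assumes "ordered_steps \<phi>"
  shows "L2_rv M (\<lambda>\<omega>. step_int L \<phi> \<omega> $ i)"
  unfolding step_int_nth using assms by (intro L2_rv_sum L2_incr ordered_steps_nth) auto

lemma L2_rv_vec:
  assumes "\<And>i. L2_rv N (\<lambda>\<omega>. f \<omega> $ i)" "f \<in> borel_measurable N"
  shows "L2_rv N (f :: _ \<Rightarrow> real^'n::finite)"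
  using assms unfolding L2_rv_def norm_sq_components by auto

text \<open>The diagonal case of the isometry, with the covariance form estimated by
  \<open>noise_const\<close>. This continuity is what extends linear statements from step functions
  to general kernels.\<close>

lemma step_int_bound:
  assumes "ordered_steps \<phi>"
  shows "msq M (step_int L \<phi>) \<le> ennreal noise_const * msq lborel (step_fun \<phi>)"
proof -
  note comp = step_int_component_L2[OF assms, THEN L2_square_integrable]
  have int: "integrable lborel (\<lambda>u. (norm (step_fun \<phi> u))\<^sup>2)" using step_fun_L2 by (simp add: L2_rv_def)
  have "msq M (step_int L \<phi>) = ennreal (LINT \<omega>|M. (norm (step_int L \<phi> \<omega>))\<^sup>2)"
    unfolding msq_def norm_sq_components using comp by (intro nn_integral_eq_integral AE_I2 sum_nonneg) auto
  also have "(LINT \<omega>|M. (norm (step_int L \<phi> \<omega>))\<^sup>2) = (\<Sum>i\<in>UNIV. LINT u|lborel. cov (step_fun \<phi> u $ i) (step_fun \<phi> u $ i))"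
    unfolding norm_sq_components using comp step_cov(1)[OF assms assms]
    by (simp add: power2_eq_square)
  also have "\<dots> = (LINT u|lborel. (\<Sum>i\<in>UNIV. cov (step_fun \<phi> u $ i) (step_fun \<phi> u $ i)))"
    by (subst Bochner_Integration.integral_sum) (auto intro!: step_cov(2) assms)
  also have "\<dots> \<le> (LINT u|lborel. noise_const * (norm (step_fun \<phi> u))\<^sup>2)"
  proof (rule integral_mono)
    show "integrable lborel (\<lambda>u. \<Sum>i\<in>UNIV. cov (step_fun \<phi> u $ i) (step_fun \<phi> u $ i))"
      by (intro Bochner_Integration.integrable_sum step_cov(2) assms)
    show "integrable lborel (\<lambda>u. noise_const * (norm (step_fun \<phi> u))\<^sup>2)" using int by simp
    fix u :: real
    have "(\<Sum>i\<in>UNIV. cov (step_fun \<phi> u $ i) (step_fun \<phi> u $ i)) \<le> (\<Sum>i\<in>UNIV. noise_const * (norm (step_fun \<phi> u $ i))\<^sup>2)"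
      using cov_bound[of "step_fun \<phi> u $ i" "step_fun \<phi> u $ i" for i]
      by (intro sum_mono) (simp add: power2_eq_square abs_le_iff)
    then show "(\<Sum>i\<in>UNIV. cov (step_fun \<phi> u $ i) (step_fun \<phi> u $ i)) \<le> noise_const * (norm (step_fun \<phi> u))\<^sup>2"
      by (simp add: norm_sq_components sum_distrib_left)
  qed
  also have "\<dots> = noise_const * (LINT u|lborel. (norm (step_fun \<phi> u))\<^sup>2)" by simp
  finally have "msq M (step_int L \<phi>) \<le> ennreal (noise_const * (LINT u|lborel. (norm (step_fun \<phi> u))\<^sup>2))"
    by (simp add: ennreal_leI)
  also have "\<dots> = ennreal noise_const * msq lborel (step_fun \<phi>)"
    unfolding msq_def using int noise_const_nonneg by (simp add: nn_integral_eq_integral ennreal_mult)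
  finally show ?thesis .
qed

text \<open>\<open>I\<close> is the integral of the deterministic kernel \<open>f\<close> over the
  whole line; a finite or half-infinite range is encoded by zeros of \<open>f\<close>. A relation is
  used because the integral is fixed only almost surely.\<close>

definition levy_rep :: "(real \<Rightarrow> real^'k^'k) \<Rightarrow> ('w \<Rightarrow> real^'k) \<Rightarrow> bool" where
  "levy_rep f I \<longleftrightarrow> f \<in> borel_measurable borel \<and> I \<in> borel_measurable M \<and>
     (\<exists>\<phi>. (\<forall>n. ordered_steps (\<phi> n)) \<and> L2_tendsto lborel sequentially (\<lambda>n. step_fun (\<phi> n)) f \<and>
        L2_tendsto M sequentially (\<lambda>n. step_int L (\<phi> n)) I)"

lemma levy_repI:
  assumes "f \<in> borel_measurable borel" "I \<in> borel_measurable M" "\<And>n. ordered_steps (\<phi> n)"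
    "L2_tendsto lborel sequentially (\<lambda>n. step_fun (\<phi> n)) f" "L2_tendsto M sequentially (\<lambda>n. step_int L (\<phi> n)) I"
  shows "levy_rep f I"
  unfolding levy_rep_def by (intro conjI exI[of _ \<phi>] allI) (rule assms)+

lemma has_levy_integral_rep:
  assumes "has_levy_integral M L s t f I"
  shows "levy_rep (\<lambda>u. indicator {s..t} u *\<^sub>R f u) I"
proof -
  note * = assms[unfolded has_levy_integral_def]
  have [measurable]: "f \<in> borel_measurable borel" by (rule *[THEN conjunct1])
  have I: "I \<in> borel_measurable M" by (rule *[THEN conjunct2, THEN conjunct1])
  have ex: "\<exists>\<phi>. (\<forall>n. ordered_steps (\<phi> n)) \<and>
        L2_tendsto lborel sequentially (\<lambda>n. step_fun (\<phi> n)) (\<lambda>u. indicator {s..t} u *\<^sub>R f u) \<and>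
        L2_tendsto M sequentially (\<lambda>n. step_int L (\<phi> n)) I"
    by (rule *[THEN conjunct2, THEN conjunct2])
  show ?thesis unfolding levy_rep_def
    by (intro conjI ex I) measurable
qed

lemma levy_repE:
  assumes "levy_rep f I"
  obtains \<phi> where "\<And>n. ordered_steps (\<phi> n)" "L2_tendsto lborel sequentially (\<lambda>n. step_fun (\<phi> n)) f"
    "L2_tendsto M sequentially (\<lambda>n. step_int L (\<phi> n)) I"
proof -
  have "\<exists>\<phi>. (\<forall>n. ordered_steps (\<phi> n)) \<and> L2_tendsto lborel sequentially (\<lambda>n. step_fun (\<phi> n)) f \<and>
        L2_tendsto M sequentially (\<lambda>n. step_int L (\<phi> n)) I"
    using assms unfolding levy_rep_def by (elim conjE)
  then obtain \<phi> where "\<forall>n. ordered_steps (\<phi> n)" "L2_tendsto lborel sequentially (\<lambda>n. step_fun (\<phi> n)) f"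
    "L2_tendsto M sequentially (\<lambda>n. step_int L (\<phi> n)) I"
    by (elim exE conjE)
  then show ?thesis by (intro that[of \<phi>]) (erule spec, assumption+)
qed

lemma levy_rep_measurable:
  assumes "levy_rep f I"
  shows "f \<in> borel_measurable borel" "f \<in> borel_measurable lborel" "I \<in> borel_measurable M"
  using assms unfolding levy_rep_def by auto

lemma levy_rep_L2:
  assumes "levy_rep f I"
  shows "L2_rv lborel f" "L2_rv M I"
proof -
  obtain \<phi> where \<phi>: "\<And>n. ordered_steps (\<phi> n)" "L2_tendsto lborel sequentially (\<lambda>n. step_fun (\<phi> n)) f"
    "L2_tendsto M sequentially (\<lambda>n. step_int L (\<phi> n)) I"
    by (rule levy_repE[OF assms], rule that)
  show "L2_rv lborel f"
    by (rule L2_tendsto_L2[OF \<phi>(2) _ step_fun_L2]) (auto intro: levy_rep_measurable[OF assms])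
  show "L2_rv M I"
    by (rule L2_tendsto_L2[OF \<phi>(3)]) (auto intro!: levy_rep_measurable[OF assms] L2_rv_vec step_int_component_L2 \<phi>(1))
qed

text \<open>The factor 4 comes from applying \<open>msq_add\<close> twice, once on the side of the
  integrals and once on the side of the kernels. Applied to differences, the bound shows that
  \<open>f\<close> determines \<open>I\<close> up to a null set.\<close>

lemma levy_rep_bound:
  assumes "levy_rep f I"
  shows "msq M I \<le> 4 * ennreal noise_const * msq lborel f"
proof -
  obtain \<phi> where \<phi>: "\<And>n. ordered_steps (\<phi> n)" "L2_tendsto lborel sequentially (\<lambda>n. step_fun (\<phi> n)) f"
    "L2_tendsto M sequentially (\<lambda>n. step_int L (\<phi> n)) I"
    by (rule levy_repE[OF assms], rule that)
  note [measurable] = levy_rep_measurable[OF assms]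
  let ?a = "\<lambda>n. msq M (\<lambda>\<omega>. step_int L (\<phi> n) \<omega> - I \<omega>)"
  let ?b = "\<lambda>n. msq lborel (\<lambda>u. step_fun (\<phi> n) u - f u)"
  have "msq M I \<le> 2 * ?a n + 4 * ennreal noise_const * ?b n + 4 * ennreal noise_const * msq lborel f" for n
  proof -
    have "msq M I \<le> 2 * msq M (\<lambda>\<omega>. I \<omega> - step_int L (\<phi> n) \<omega>) + 2 * msq M (step_int L (\<phi> n))"
      using msq_add[of "\<lambda>\<omega>. I \<omega> - step_int L (\<phi> n) \<omega>" M "step_int L (\<phi> n)"] by simp
    also have "msq M (\<lambda>\<omega>. I \<omega> - step_int L (\<phi> n) \<omega>) = ?a n" by (rule msq_minus_commute)
    also have "2 * ?a n + 2 * msq M (step_int L (\<phi> n)) \<le> 2 * ?a n + 2 * (ennreal noise_const * (2 * ?b n + 2 * msq lborel f))"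
    proof -
      have "msq lborel (step_fun (\<phi> n)) \<le> 2 * ?b n + 2 * msq lborel f"
        using msq_add[of "\<lambda>u. step_fun (\<phi> n) u - f u" lborel f] by simp
      then have "ennreal noise_const * msq lborel (step_fun (\<phi> n)) \<le> ennreal noise_const * (2 * ?b n + 2 * msq lborel f)"
        by (intro mult_left_mono) auto
      with step_int_bound[OF \<phi>(1)[of n]] have "msq M (step_int L (\<phi> n)) \<le> ennreal noise_const * (2 * ?b n + 2 * msq lborel f)"
        by (rule order_trans)
      then show ?thesis by (intro add_left_mono mult_left_mono) auto
    qed
    also have "\<dots> = 2 * ?a n + 4 * ennreal noise_const * ?b n + 4 * ennreal noise_const * msq lborel f"
    proof -
      have "(4 :: ennreal) = 2 * 2" by simp
      then show ?thesis by (simp only: distrib_left mult_ac add_ac)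
    qed
    finally show ?thesis .
  qed
  moreover have "(\<lambda>n. 2 * ?a n + 4 * ennreal noise_const * ?b n + 4 * ennreal noise_const * msq lborel f)
      \<longlonglongrightarrow> 0 + 0 + 4 * ennreal noise_const * msq lborel f"
    using \<phi>(2,3) unfolding L2_tendsto_msq
    by (intro tendsto_add tendsto_const ennreal_tendsto_0_cmult) (auto simp: ennreal_mult_less_top)
  ultimately show ?thesis using LIMSEQ_le_const[of _ "0 + 0 + 4 * ennreal noise_const * msq lborel f" "msq M I"] by auto
qed

section \<open>Linear operations and limits of represented integrals\<close>

lemma step_fun_append: "step_fun (\<phi> @ \<psi>) u = step_fun \<phi> u + step_fun \<psi> u"
  by (simp add: step_fun_def)

lemma step_int_append: "step_int L (\<phi> @ \<psi>) \<omega> = step_int L \<phi> \<omega> + step_int L \<psi> \<omega>"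
  by (simp add: step_int_def)

lemma levy_rep_add:
  assumes "levy_rep f I" "levy_rep g J"
  shows "levy_rep (\<lambda>u. f u + g u) (\<lambda>\<omega>. I \<omega> + J \<omega>)"
proof -
  obtain \<phi> where \<phi>: "\<And>n. ordered_steps (\<phi> n)" "L2_tendsto lborel sequentially (\<lambda>n. step_fun (\<phi> n)) f"
    "L2_tendsto M sequentially (\<lambda>n. step_int L (\<phi> n)) I"
    by (rule levy_repE[OF assms(1)], rule that)
  obtain \<psi> where \<psi>: "\<And>n. ordered_steps (\<psi> n)" "L2_tendsto lborel sequentially (\<lambda>n. step_fun (\<psi> n)) g"
    "L2_tendsto M sequentially (\<lambda>n. step_int L (\<psi> n)) J"
    by (rule levy_repE[OF assms(2)], rule that)
  note [measurable] = levy_rep_measurable[OF assms(1)] levy_rep_measurable[OF assms(2)]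
  have "L2_tendsto lborel sequentially (\<lambda>n. step_fun (\<phi> n @ \<psi> n)) (\<lambda>u. f u + g u)"
    using L2_tendsto_add[OF \<phi>(2) \<psi>(2)] by (simp add: step_fun_append[abs_def])
  moreover have "L2_tendsto M sequentially (\<lambda>n. step_int L (\<phi> n @ \<psi> n)) (\<lambda>\<omega>. I \<omega> + J \<omega>)"
    using L2_tendsto_add[OF \<phi>(3) \<psi>(3)] by (simp add: step_int_append[abs_def])
  moreover have "ordered_steps (\<phi> n @ \<psi> n)" for n using \<phi>(1)[of n] \<psi>(1)[of n] by auto
  ultimately show ?thesis by (intro levy_repI[where \<phi>="\<lambda>n. \<phi> n @ \<psi> n"]) measurable
qed

lemma bounded_linear_matrix_mult: "bounded_linear (\<lambda>F :: real^'k^'k. G ** F)" for G :: "real^'k^'k"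
proof -
  have "linear (\<lambda>F :: real^'k^'k. G ** F)"
    by (rule linearI) (simp_all add: matrix_add_ldistrib matrix_scalar_ac(1) vec_eq_iff matrix_matrix_mult_def sum_distrib_left sum_distrib_right algebra_simps sum.distrib)
  then show ?thesis by (rule linear_conv_bounded_linear[THEN iffD1])
qed

lemma levy_rep_mult:
  assumes "levy_rep f I"
  shows "levy_rep (\<lambda>u. G ** f u) (\<lambda>\<omega>. G *v I \<omega>)"
proof -
  obtain \<phi> where \<phi>: "\<And>n. ordered_steps (\<phi> n)" "L2_tendsto lborel sequentially (\<lambda>n. step_fun (\<phi> n)) f"
    "L2_tendsto M sequentially (\<lambda>n. step_int L (\<phi> n)) I"
    by (rule levy_repE[OF assms(1)], rule that)
  note [measurable] = levy_rep_measurable[OF assms]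
  define \<psi> where "\<psi> n = map (\<lambda>(b, c, F). (b, c, G ** F)) (\<phi> n)" for n
  have "step_fun (map (\<lambda>(b, c, F). (b, c, G ** F)) xs) u = G ** step_fun xs u" for xs u
    unfolding step_fun_def using bounded_linear.linear[OF bounded_linear_matrix_mult[of G]]
    by (induction xs) (auto simp: linear_0 linear_add linear_cmul)
  then have sf: "step_fun (\<psi> n) = (\<lambda>u. G ** step_fun (\<phi> n) u)" for n by (simp add: \<psi>_def fun_eq_iff)
  have "step_int L (map (\<lambda>(b, c, F). (b, c, G ** F)) xs) \<omega> = G *v step_int L xs \<omega>" for xs \<omega>
    unfolding step_int_def
    by (induction xs) (auto simp: matrix_vector_right_distrib matrix_vector_mul_assoc)
  then have si: "step_int L (\<psi> n) = (\<lambda>\<omega>. G *v step_int L (\<phi> n) \<omega>)" for n by (simp add: \<psi>_def fun_eq_iff)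
  have lim: "L2_tendsto lborel sequentially (\<lambda>n. step_fun (\<psi> n)) (\<lambda>u. G ** f u)"
    unfolding sf by (rule L2_tendsto_linear[OF bounded_linear_matrix_mult \<phi>(2)]) measurable
  have lim': "L2_tendsto M sequentially (\<lambda>n. step_int L (\<psi> n)) (\<lambda>\<omega>. G *v I \<omega>)"
    unfolding si by (rule L2_tendsto_linear[OF matrix_vector_mul_bounded_linear \<phi>(3)]) measurable
  have ord: "ordered_steps (\<psi> n)" for n using \<phi>(1)[of n] by (auto simp: \<psi>_def)
  have m1: "(\<lambda>u. G ** f u) \<in> borel_measurable borel"
    by (rule measurable_compose[OF _ borel_measurable_continuous_onI[OF linear_continuous_on[OF bounded_linear_matrix_mult]]]) measurable
  have m2: "(\<lambda>\<omega>. G *v I \<omega>) \<in> borel_measurable M"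
    by (rule measurable_compose[OF _ borel_measurable_continuous_onI[OF linear_continuous_on[OF matrix_vector_mul_bounded_linear]]]) measurable
  show ?thesis by (rule levy_repI[OF m1 m2 ord lim lim'])
qed

lemma levy_rep_scaleR:
  assumes "levy_rep f I"
  shows "levy_rep (\<lambda>u. c *\<^sub>R f u) (\<lambda>\<omega>. c *\<^sub>R I \<omega>)"
proof -
  have "(c *\<^sub>R mat 1) ** F = c *\<^sub>R F" for F :: "real^'k^'k"
    by (simp add: scalar_matrix_assoc[symmetric] scalar_mult_eq_scaleR)
  moreover have "(c *\<^sub>R mat 1 :: real^'k^'k) *v x = c *\<^sub>R x" for x
    by (simp add: scaleR_matrix_vector_assoc[symmetric])
  ultimately show ?thesis using levy_rep_mult[OF assms, of "c *\<^sub>R mat 1"] by simp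
qed

lemma levy_rep_zero: "levy_rep (\<lambda>_. 0) (\<lambda>_. 0)"
proof -
  have "step_fun [] = (\<lambda>_. 0 :: real^'k^'k)" "step_int L [] = (\<lambda>_. 0)"
    by (simp_all add: fun_eq_iff step_fun_def step_int_def)
  then have "L2_tendsto lborel sequentially (\<lambda>n. step_fun []) (\<lambda>_. 0 :: real^'k^'k)"
    "L2_tendsto M sequentially (\<lambda>n. step_int L []) (\<lambda>_. 0)"
    by (simp_all add: L2_tendsto_const)
  then show ?thesis by (intro levy_repI[where \<phi>="\<lambda>_. []"]) simp_all
qed

lemma levy_rep_sum:
  assumes "\<And>i. i \<in> A \<Longrightarrow> levy_rep (f i) (I i)"
  shows "levy_rep (\<lambda>u. \<Sum>i\<in>A. f i u) (\<lambda>\<omega>. \<Sum>i\<in>A. I i \<omega>)"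
  using assms
proof (induction A rule: infinite_finite_induct)
  case (insert i A)
  then have "levy_rep (\<lambda>u. f i u + (\<Sum>i\<in>A. f i u)) (\<lambda>\<omega>. I i \<omega> + (\<Sum>i\<in>A. I i \<omega>))"
    by (intro levy_rep_add) simp_all
  with insert.hyps show ?case by simp
next
  case empty
  show ?case unfolding sum.empty by (rule levy_rep_zero)
next
  case (infinite A)
  show ?case unfolding sum.infinite[OF infinite(1)] by (rule levy_rep_zero)
qed

lemma levy_rep_diff:
  assumes "levy_rep f I" "levy_rep g J"
  shows "levy_rep (\<lambda>u. f u - g u) (\<lambda>\<omega>. I \<omega> - J \<omega>)"
proof -
  have "levy_rep (\<lambda>u. f u + (- 1) *\<^sub>R g u) (\<lambda>\<omega>. I \<omega> + (- 1) *\<^sub>R J \<omega>)"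
    by (rule levy_rep_add[OF assms(1) levy_rep_scaleR[OF assms(2)]])
  then show ?thesis by simp
qed

text \<open>A diagonal choice of step functions that are within \<open>1/(n+1)\<close> of the
  \<open>n\<close>-th kernel and the \<open>n\<close>-th integral at the same time.\<close>

lemma levy_rep_limit:
  assumes rep: "\<And>n. levy_rep (f n) (I n)"
    and f: "L2_tendsto lborel sequentially f g" and [measurable]: "g \<in> borel_measurable borel"
    and I: "L2_tendsto M sequentially I J" and [measurable]: "J \<in> borel_measurable M"
  shows "levy_rep g J"
proof -
  have fm [measurable]: "f n \<in> borel_measurable borel" "I n \<in> borel_measurable M" for n
    by (fact levy_rep_measurable[OF rep[of n]])+
  have ex: "\<exists>\<phi>. ordered_steps \<phi> \<and> msq lborel (\<lambda>u. step_fun \<phi> u - f n u) \<le> ennreal (1 / (real n + 1))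
      \<and> msq M (\<lambda>\<omega>. step_int L \<phi> \<omega> - I n \<omega>) \<le> ennreal (1 / (real n + 1))" for n
  proof -
    obtain \<phi> where \<phi>: "\<And>m. ordered_steps (\<phi> m)" "L2_tendsto lborel sequentially (\<lambda>m. step_fun (\<phi> m)) (f n)"
      "L2_tendsto M sequentially (\<lambda>m. step_int L (\<phi> m)) (I n)"
      by (rule levy_repE[OF rep[of n]], rule that)
    have pos: "0 < ennreal (1 / (real n + 1))" by (rule ennreal_less_zero_iff[THEN iffD2]) simp
    have "\<forall>\<^sub>F m in sequentially. msq lborel (\<lambda>u. step_fun (\<phi> m) u - f n u) < ennreal (1 / (real n + 1))"
      using \<phi>(2) pos unfolding L2_tendsto_msq by (rule order_tendstoD)
    moreover have "\<forall>\<^sub>F m in sequentially. msq M (\<lambda>\<omega>. step_int L (\<phi> m) \<omega> - I n \<omega>) < ennreal (1 / (real n + 1))"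
      using \<phi>(3) pos unfolding L2_tendsto_msq by (rule order_tendstoD)
    ultimately have "\<forall>\<^sub>F m in sequentially. msq lborel (\<lambda>u. step_fun (\<phi> m) u - f n u) < ennreal (1 / (real n + 1))
        \<and> msq M (\<lambda>\<omega>. step_int L (\<phi> m) \<omega> - I n \<omega>) < ennreal (1 / (real n + 1))"
      by (rule eventually_conj)
    then obtain m where "msq lborel (\<lambda>u. step_fun (\<phi> m) u - f n u) < ennreal (1 / (real n + 1))"
      "msq M (\<lambda>\<omega>. step_int L (\<phi> m) \<omega> - I n \<omega>) < ennreal (1 / (real n + 1))"
      using eventually_happens' sequentially_bot by blast
    then show ?thesis using \<phi>(1)[of m] by (intro exI[of _ "\<phi> m"]) auto
  qed
  have "\<exists>\<phi>. \<forall>n. ordered_steps (\<phi> n) \<and> msq lborel (\<lambda>u. step_fun (\<phi> n) u - f n u) \<le> ennreal (1 / (real n + 1))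
      \<and> msq M (\<lambda>\<omega>. step_int L (\<phi> n) \<omega> - I n \<omega>) \<le> ennreal (1 / (real n + 1))"
    by (rule choice) (intro allI ex)
  then obtain \<phi> where all: "\<forall>n. ordered_steps (\<phi> n) \<and> msq lborel (\<lambda>u. step_fun (\<phi> n) u - f n u) \<le> ennreal (1 / (real n + 1))
      \<and> msq M (\<lambda>\<omega>. step_int L (\<phi> n) \<omega> - I n \<omega>) \<le> ennreal (1 / (real n + 1))" ..
  have \<phi>: "ordered_steps (\<phi> n)" "msq lborel (\<lambda>u. step_fun (\<phi> n) u - f n u) \<le> ennreal (1 / (real n + 1))"
    "msq M (\<lambda>\<omega>. step_int L (\<phi> n) \<omega> - I n \<omega>) \<le> ennreal (1 / (real n + 1))" for n
    by (rule all[THEN spec, THEN conjunct1] all[THEN spec, THEN conjunct2, THEN conjunct1]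
        all[THEN spec, THEN conjunct2, THEN conjunct2])+
  have "(\<lambda>n. ennreal (1 / (real n + 1))) \<longlonglongrightarrow> ennreal 0"
    by (rule tendsto_ennrealI[OF inverse_Suc_tendsto])
  then have lim0: "(\<lambda>n. ennreal (1 / (real n + 1))) \<longlonglongrightarrow> 0" by simp
  have "(\<lambda>n. msq lborel (\<lambda>u. step_fun (\<phi> n) u - f n u)) \<longlonglongrightarrow> 0"
    by (rule ennreal_tendsto_0_le[OF lim0 always_eventually]) (intro allI \<phi>(2))
  then have "L2_tendsto lborel sequentially (\<lambda>n u. step_fun (\<phi> n) u - f n u) (\<lambda>_. 0)"
    unfolding L2_tendsto_msq by simp
  from L2_tendsto_add[OF this f] have 1: "L2_tendsto lborel sequentially (\<lambda>n. step_fun (\<phi> n)) g" by simp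
  have "(\<lambda>n. msq M (\<lambda>\<omega>. step_int L (\<phi> n) \<omega> - I n \<omega>)) \<longlonglongrightarrow> 0"
    by (rule ennreal_tendsto_0_le[OF lim0 always_eventually]) (intro allI \<phi>(3))
  then have "L2_tendsto M sequentially (\<lambda>n \<omega>. step_int L (\<phi> n) \<omega> - I n \<omega>) (\<lambda>_. 0)"
    unfolding L2_tendsto_msq by simp
  from L2_tendsto_add[OF this I] have 2: "L2_tendsto M sequentially (\<lambda>n. step_int L (\<phi> n)) J" by simp
  show ?thesis by (rule levy_repI[OF assms(3,5) \<phi>(1) 1 2])
qed

text \<open>The step functions approximating \<open>f\<close> and \<open>g\<close> need not have
  disjoint supports. The limit is therefore taken on both sides of \<open>step_cov\<close>, and the
  disjointness is used only for the limits \<open>f\<close> and \<open>g\<close>, where the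
  integrand vanishes identically.\<close>

lemma levy_rep_orthogonal:
  assumes f: "levy_rep f I" and g: "levy_rep g J" and disj: "\<And>u. f u = 0 \<or> g u = 0"
  shows "(LINT \<omega>|M. I \<omega> $ i * J \<omega> $ j) = 0"
proof -
  obtain \<phi> where \<phi>: "\<And>n. ordered_steps (\<phi> n)" "L2_tendsto lborel sequentially (\<lambda>n. step_fun (\<phi> n)) f"
    "L2_tendsto M sequentially (\<lambda>n. step_int L (\<phi> n)) I"
    by (rule levy_repE[OF f], rule that)
  obtain \<psi> where \<psi>: "\<And>n. ordered_steps (\<psi> n)" "L2_tendsto lborel sequentially (\<lambda>n. step_fun (\<psi> n)) g"
    "L2_tendsto M sequentially (\<lambda>n. step_int L (\<psi> n)) J"
    by (rule levy_repE[OF g], rule that)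
  note [measurable] = levy_rep_measurable[OF f] levy_rep_measurable[OF g]
  note L = levy_rep_L2[OF f] levy_rep_L2[OF g]
  have bl: "bounded_linear (\<lambda>F :: real^'k^'k. F $ i $ a)" for i a
    by (rule bounded_linear_compose[OF bounded_linear_vec_nth bounded_linear_vec_nth])
  have l1: "(\<lambda>n. LINT \<omega>|M. step_int L (\<phi> n) \<omega> $ i * step_int L (\<psi> n) \<omega> $ j) \<longlonglongrightarrow> (LINT \<omega>|M. I \<omega> $ i * J \<omega> $ j)"
  proof (rule L2_tendsto_inner2)
    show "L2_tendsto M sequentially (\<lambda>n \<omega>. step_int L (\<phi> n) \<omega> $ i) (\<lambda>\<omega>. I \<omega> $ i)"
      by (rule L2_tendsto_linear[OF bounded_linear_vec_nth \<phi>(3)]) measurable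
    show "L2_tendsto M sequentially (\<lambda>n \<omega>. step_int L (\<psi> n) \<omega> $ j) (\<lambda>\<omega>. J \<omega> $ j)"
      by (rule L2_tendsto_linear[OF bounded_linear_vec_nth \<psi>(3)]) measurable
    show "L2_rv M (\<lambda>\<omega>. step_int L (\<phi> n) \<omega> $ i)" for n by (rule step_int_component_L2[OF \<phi>(1)])
    show "L2_rv M (\<lambda>\<omega>. step_int L (\<psi> n) \<omega> $ j)" for n by (rule step_int_component_L2[OF \<psi>(1)])
    show "L2_rv M (\<lambda>\<omega>. I \<omega> $ i)" by (rule L2_rv_linear[OF bounded_linear_vec_nth L(2)])
    show "L2_rv M (\<lambda>\<omega>. J \<omega> $ j)" by (rule L2_rv_linear[OF bounded_linear_vec_nth L(4)])
  qed
  have eq: "(LINT \<omega>|M. step_int L (\<phi> n) \<omega> $ i * step_int L (\<psi> n) \<omega> $ j)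
      = (\<Sum>a\<in>UNIV. \<Sum>b\<in>UNIV. (LINT u|lborel. step_fun (\<phi> n) u $ i $ a * step_fun (\<psi> n) u $ j $ b) * cov (axis a 1) (axis b 1))" for n
  proof -
    have int: "integrable lborel (\<lambda>u. step_fun (\<phi> n) u $ i $ a * step_fun (\<psi> n) u $ j $ b)" for a b
      by (rule L2_Cauchy_Schwarz(1)[OF L2_rv_linear[OF bl step_fun_L2] L2_rv_linear[OF bl step_fun_L2]])
    show ?thesis
      unfolding step_cov(1)[OF \<phi>(1) \<psi>(1)] cov_component_sum[of "step_fun (\<phi> n) _ $ i"]
      by (subst Bochner_Integration.integral_sum, intro Bochner_Integration.integrable_sum integrable_mult_left int,
          intro sum.cong refl, subst Bochner_Integration.integral_sum, intro integrable_mult_left int,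
          intro sum.cong refl integral_mult_left_zero)
  qed
  have l2: "(\<lambda>n. \<Sum>a\<in>UNIV. \<Sum>b\<in>UNIV. (LINT u|lborel. step_fun (\<phi> n) u $ i $ a * step_fun (\<psi> n) u $ j $ b) * cov (axis a 1) (axis b 1))
      \<longlonglongrightarrow> (\<Sum>a\<in>UNIV. \<Sum>b\<in>UNIV. (LINT u|lborel. f u $ i $ a * g u $ j $ b) * cov (axis a 1) (axis b 1))"
  proof (intro tendsto_sum tendsto_mult tendsto_const)
    fix a b
    show "(\<lambda>n. LINT u|lborel. step_fun (\<phi> n) u $ i $ a * step_fun (\<psi> n) u $ j $ b) \<longlonglongrightarrow> (LINT u|lborel. f u $ i $ a * g u $ j $ b)"
    proof (rule L2_tendsto_inner2)
      show "L2_tendsto lborel sequentially (\<lambda>n u. step_fun (\<phi> n) u $ i $ a) (\<lambda>u. f u $ i $ a)"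
        by (rule L2_tendsto_linear[OF bl \<phi>(2)]) measurable
      show "L2_tendsto lborel sequentially (\<lambda>n u. step_fun (\<psi> n) u $ j $ b) (\<lambda>u. g u $ j $ b)"
        by (rule L2_tendsto_linear[OF bl \<psi>(2)]) measurable
    qed (rule L2_rv_linear[OF bl step_fun_L2] L2_rv_linear[OF bl L(1)] L2_rv_linear[OF bl L(3)])+
  qed
  have z: "(\<Sum>a\<in>UNIV. \<Sum>b\<in>UNIV. (LINT u|lborel. f u $ i $ a * g u $ j $ b) * cov (axis a 1) (axis b 1)) = 0"
  proof -
    have "f u $ i $ a * g u $ j $ b = 0" for u a b using disj[of u] by auto
    then show ?thesis by (simp only: integral_zero mult_zero_left sum.neutral_const)
  qed
  from LIMSEQ_unique[OF l1[unfolded eq] l2] z show ?thesis by (rule trans)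
qed

end

section \<open>The input process\<close>

lemma exp_tail_integrable:
  fixes c a :: real
  assumes "0 < c"
  shows "integrable lborel (\<lambda>x. indicator {a..} x * exp (- c * x))"
proof -
  have "(\<integral>\<^sup>+x. ennreal (exp (- c * x)) * indicator {a..} x \<partial>lborel) = ennreal (0 - (- exp (- c * a) / c))"
  proof (rule nn_integral_FTC_atLeast)
    show "((\<lambda>x. - exp (- c * x) / c) has_real_derivative exp (- c * x)) (at x)" for x
      using assms by (auto intro!: derivative_eq_intros)
    have "((\<lambda>x. exp (- c * x)) \<longlongrightarrow> 0) at_top"
    proof (rule filterlim_compose[OF exp_at_bot])
      have "LIM x at_top. c * x :> at_top"
        by (rule filterlim_tendsto_pos_mult_at_top[OF tendsto_const assms filterlim_ident])
      then show "LIM x at_top. - c * x :> at_bot"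
        by (simp add: filterlim_uminus_at_bot)
    qed
    from tendsto_divide[OF tendsto_minus[OF this] tendsto_const, of c]
    show "((\<lambda>x. - exp (- c * x) / c) \<longlongrightarrow> 0) at_top" using assms by simp
  qed auto
  also have "\<dots> < \<infinity>" by simp
  finally have "(\<integral>\<^sup>+x. ennreal (exp (- c * x)) * indicator {a..} x \<partial>lborel) < \<infinity>" .
  moreover have "(\<integral>\<^sup>+x. ennreal (norm (indicator {a..} x * exp (- c * x))) \<partial>lborel)
      = (\<integral>\<^sup>+x. ennreal (exp (- c * x)) * indicator {a..} x \<partial>lborel)"
    by (intro nn_integral_cong) (simp add: indicator_def)
  ultimately show ?thesis by (simp add: integrable_iff_bounded)
qed

text \<open>Lebesgue measure is invariant under reflection and translation. This makes estimates for
  the kernel \<open>u \<mapsto> G j (t - u)\<close> uniform in \<open>t\<close>.\<close>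

lemma msq_reflect:
  assumes "f \<in> borel_measurable borel"
  shows "msq lborel (\<lambda>u. f (t - u)) = msq lborel (f :: real \<Rightarrow> 'b::euclidean_space)"
proof -
  have m: "(\<lambda>x. ennreal ((norm (f x))\<^sup>2)) \<in> borel_measurable borel" using assms by measurable
  have "msq lborel f = ennreal \<bar>- 1\<bar> * (\<integral>\<^sup>+u. ennreal ((norm (f (t + (- 1) * u)))\<^sup>2) \<partial>lborel)"
    unfolding msq_def by (rule nn_integral_real_affine[OF m]) simp
  then show ?thesis by (simp add: msq_def)
qed

lemma L2_tendsto_dominated:
  fixes f :: "nat \<Rightarrow> 'a \<Rightarrow> 'b::euclidean_space" and w :: "'a \<Rightarrow> real"
  assumes f: "\<And>n. f n \<in> borel_measurable N" and g: "g \<in> borel_measurable N"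
    and w: "L2_rv N w" and dom: "\<And>n x. norm (f n x - g x) \<le> w x"
    and lim: "AE x in N. (\<lambda>n. f n x) \<longlonglongrightarrow> g x"
  shows "L2_tendsto N sequentially f g"
proof -
  have "(\<lambda>n. \<integral>\<^sup>+x. ennreal ((norm (f n x - g x))\<^sup>2) \<partial>N) \<longlonglongrightarrow> (\<integral>\<^sup>+x. 0 \<partial>N)"
  proof (rule nn_integral_dominated_convergence[where w="\<lambda>x. ennreal ((norm (w x))\<^sup>2)"])
    show "(\<lambda>x. ennreal ((norm (f n x - g x))\<^sup>2)) \<in> borel_measurable N" for n
      using f g by measurable
    show "(\<lambda>x. ennreal ((norm (w x))\<^sup>2)) \<in> borel_measurable N"
      using L2_rv_measurable[OF w] by measurable
    show "(\<integral>\<^sup>+x. ennreal ((norm (w x))\<^sup>2) \<partial>N) < \<infinity>" using w by (simp add: L2_rv_msq msq_def)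
    show "AE x in N. ennreal ((norm (f n x - g x))\<^sup>2) \<le> ennreal ((norm (w x))\<^sup>2)" for n
    proof (rule AE_I2)
      fix x
      have "norm (f n x - g x) \<le> norm (w x)" using dom[of n x] by simp
      then show "ennreal ((norm (f n x - g x))\<^sup>2) \<le> ennreal ((norm (w x))\<^sup>2)"
        by (intro ennreal_leI power_mono) auto
    qed
    show "AE x in N. (\<lambda>n. ennreal ((norm (f n x - g x))\<^sup>2)) \<longlonglongrightarrow> 0"
      using lim
    proof eventually_elim
      case (elim x)
      have "(\<lambda>n. ennreal ((norm (f n x - g x))\<^sup>2)) \<longlonglongrightarrow> ennreal ((norm (g x - g x))\<^sup>2)"
        by (intro tendsto_ennrealI tendsto_power tendsto_norm tendsto_diff elim tendsto_const)
      then show ?case by simp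
    qed
  qed simp
  then show ?thesis by (simp add: L2_tendsto_def)
qed

lemma has_vector_derivative_slope:
  fixes f :: "real \<Rightarrow> 'b::real_normed_vector"
  assumes "(f has_vector_derivative f') (at x)"
  shows "((\<lambda>h. (f (x + h) - f x) /\<^sub>R h) \<longlongrightarrow> f') (at 0)"
proof -
  have "((\<lambda>h. norm (f (x + h) - f x - h *\<^sub>R f') / norm h) \<longlongrightarrow> 0) (at 0)"
    using assms unfolding has_vector_derivative_def has_derivative_at by (rule conjunct2)
  moreover have "\<forall>\<^sub>F h in at 0. norm (f (x + h) - f x - h *\<^sub>R f') / norm h = norm ((f (x + h) - f x) /\<^sub>R h - f')"
  proof (rule eventually_mono[OF eventually_neq_at_within[of 0]])
    fix h :: real assume "h \<noteq> 0"
    then have "(f (x + h) - f x) /\<^sub>R h - f' = (f (x + h) - f x - h *\<^sub>R f') /\<^sub>R h"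
      by (simp add: scaleR_diff_right)
    then show "norm (f (x + h) - f x - h *\<^sub>R f') / norm h = norm ((f (x + h) - f x) /\<^sub>R h - f')"
      by (simp add: divide_inverse mult.commute)
  qed
  ultimately have "((\<lambda>h. norm ((f (x + h) - f x) /\<^sub>R h - f')) \<longlongrightarrow> 0) (at 0)"
    by (rule Lim_transform_eventually)
  then show ?thesis by (rule LIM_zero_cancel[OF tendsto_norm_zero_cancel])
qed

section \<open>The state as a moving average with a causal kernel\<close>

locale ou_input = square_integrable_levy M L for M :: "'w measure" and L :: "real \<Rightarrow> 'w \<Rightarrow> real^'k::finite" +
  fixes p :: nat and A :: "nat \<Rightarrow> real^'k^'k" and X :: "real \<Rightarrow> 'w \<Rightarrow> nat \<Rightarrow> real^'k" and K c :: real
  assumes c_pos: "0 < c" and K_nonneg: "0 \<le> K"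
    and decay: "\<And>x i j. 0 \<le> x \<Longrightarrow> i \<in> {1..p} \<Longrightarrow> j \<in> {1..p} \<Longrightarrow> norm (bexp p (A_mat p A) x i j) \<le> K * exp (- c * x)"
    and input: "input_process M L p A X"
begin

definition g :: "nat \<Rightarrow> real \<Rightarrow> real^'k^'k" where
  "g j x = bexp p (A_mat p A) x j p"

text \<open>Extending \<open>g\<close> by 0 to negative arguments turns an integral up to
  \<open>t\<close> into one over the whole line, and makes kernels for different times
  comparable.\<close>

definition G :: "nat \<Rightarrow> real \<Rightarrow> real^'k^'k" where
  "G j x = (if 0 \<le> x then g j x else 0)"

lemma g_deriv_general:
  assumes "j \<in> {1..p}"
  shows "(g j has_vector_derivative bmult p (A_mat p A) (bexp p (A_mat p A) x) j p) (at x)"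
  unfolding g_def[abs_def] by (rule bexp_deriv_left[OF assms])

lemma g_deriv:
  assumes "1 \<le> j" "j < p"
  shows "(g j has_vector_derivative g (j + 1) x) (at x)"
proof -
  have "bmult p (A_mat p A) (bexp p (A_mat p A) x) j p = (\<Sum>l=1..p. if l = j + 1 then g l x else 0)"
    unfolding bmult_def g_def using assms by (intro sum.cong) (auto simp: A_mat_def)
  also have "\<dots> = g (j + 1) x" using assms by simp
  finally show ?thesis using g_deriv_general[of j x] assms by simp
qed

lemma g_continuous: "j \<in> {1..p} \<Longrightarrow> continuous_on UNIV (g j)"
  by (intro continuous_at_imp_continuous_on ballI has_vector_derivative_continuous[OF g_deriv_general])

lemma g_measurable [measurable]: "j \<in> {1..p} \<Longrightarrow> g j \<in> borel_measurable borel"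
  by (intro borel_measurable_continuous_onI g_continuous)

lemma G_measurable: "j \<in> {1..p} \<Longrightarrow> G j \<in> borel_measurable borel"
  unfolding G_def[abs_def] by measurable

text \<open>Hence \<open>G j\<close> is continuous at 0 for \<open>j < p\<close>, whereas
  \<open>G p\<close> jumps there from 0 to the identity. This is the reason why only the blocks
  before the last one are differentiable.\<close>

lemma g_0: "1 \<le> j \<Longrightarrow> j < p \<Longrightarrow> g j 0 = 0"
  unfolding g_def by (subst bexp_0) (auto simp: bid_def)

lemma g_add:
  assumes "j \<in> {1..p}"
  shows "g j (h + x) = (\<Sum>l=1..p. bexp p (A_mat p A) h j l ** g l x)"
  unfolding g_def using assms by (subst bexp_add) (auto simp: bmult_def)

lemma g_bound: "0 \<le> x \<Longrightarrow> j \<in> {1..p} \<Longrightarrow> norm (g j x) \<le> K * exp (- c * x)"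
  unfolding g_def by (rule decay) auto

text \<open>An envelope that starts at -1 and not at 0, so that it also dominates shifted kernels
  \<open>G j (x + d)\<close> with \<open>\<bar>d\<bar> \<le> 1\<close>.\<close>

definition env :: "real \<Rightarrow> real" where
  "env x = indicator {-1..} x * exp (- c * x)"

lemma env_L2: "L2_rv lborel (\<lambda>x. b * env x)"
proof -
  have "(norm (env x))\<^sup>2 = indicator {-1..} x * exp (- (2 * c) * x)" for x
    by (simp add: env_def indicator_def power2_eq_square flip: exp_add)
  moreover have "integrable lborel (\<lambda>x. indicator {-1..} x * exp (- (2 * c) * x))"
    using c_pos by (intro exp_tail_integrable) simp
  moreover have "env \<in> borel_measurable borel" unfolding env_def[abs_def] by measurable
  ultimately have "L2_rv lborel env" by (simp add: L2_rv_def)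
  then show ?thesis by (rule L2_rv_cmult)
qed

lemma G_env: "j \<in> {1..p} \<Longrightarrow> norm (G j x) \<le> K * env x"
  unfolding G_def env_def using g_bound[of x j] K_nonneg by (auto simp: indicator_def)

lemma G_L2: "j \<in> {1..p} \<Longrightarrow> L2_rv lborel (G j)"
proof -
  assume j: "j \<in> {1..p}"
  have "norm (G j x) \<le> 1 * norm (K * env x)" for x
    using G_env[OF j, of x] by simp
  from L2_rv_bound[OF this env_L2] show ?thesis using G_measurable[OF j] by simp
qed

lemma G_reflect_measurable [measurable]: "j \<in> {1..p} \<Longrightarrow> (\<lambda>u. G j (t - u)) \<in> borel_measurable borel"
  by (rule measurable_compose[OF _ G_measurable]) measurable

text \<open>The defining integrals over \<open>[s, t]\<close> are evaluated along
  \<open>s = t - n\<close>. Their kernels converge to the causal kernel by dominated convergence,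
  with the kernel itself as majorant.\<close>

lemma X_rep:
  assumes j: "j \<in> {1..p}"
  shows "levy_rep (\<lambda>u. G j (t - u)) (\<lambda>\<omega>. X t \<omega> j)"
proof -
  have kern: "bmult p (bexp p (A_mat p A) (t - u)) (B_mat p) j 1 = g j (t - u)" for u
  proof -
    have "bmult p (bexp p (A_mat p A) (t - u)) (B_mat p) j 1 = (\<Sum>l=1..p. if l = p then g j (t - u) else 0)"
      unfolding bmult_def B_mat_def E_col_def g_def by (intro sum.cong) auto
    then show ?thesis using j by simp
  qed
  have upto: "has_levy_integral_upto M L t (\<lambda>u. g j (t - u)) (\<lambda>\<omega>. X t \<omega> j)"
    using input[unfolded input_process_def, THEN conjunct2, THEN spec, of t, THEN bspec, OF j]
    unfolding kern .
  then have meas: "(\<lambda>\<omega>. X t \<omega> j) \<in> borel_measurable M"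
    and ex: "\<exists>J. (\<forall>s\<le>t. has_levy_integral M L s t (\<lambda>u. g j (t - u)) (J s)) \<and> L2_tendsto M at_bot J (\<lambda>\<omega>. X t \<omega> j)"
    unfolding has_levy_integral_upto_def by simp_all
  from ex obtain J where J: "\<forall>s\<le>t. has_levy_integral M L s t (\<lambda>u. g j (t - u)) (J s)"
    "L2_tendsto M at_bot J (\<lambda>\<omega>. X t \<omega> j)" by (elim exE conjE)
  have fl: "filterlim (\<lambda>n. t - real n) at_bot sequentially"
  proof -
    have "filterlim (\<lambda>n. - t + real n) at_top sequentially"
      by (rule filterlim_tendsto_add_at_top[OF tendsto_const filterlim_real_sequentially])
    then show ?thesis by (simp add: filterlim_uminus_at_bot)
  qed
  show ?thesis
  proof (rule levy_rep_limit[where I="\<lambda>n. J (t - real n)"])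
    show "levy_rep (\<lambda>u. indicator {t - real n..t} u *\<^sub>R g j (t - u)) (J (t - real n))" for n
      using J(1) by (intro has_levy_integral_rep) auto
    show "L2_tendsto M sequentially (\<lambda>n. J (t - real n)) (\<lambda>\<omega>. X t \<omega> j)"
      by (rule L2_tendsto_filter[OF J(2) fl])
    have G2: "L2_rv lborel (\<lambda>u. G j (t - u))"
      using G_L2[OF j] msq_reflect[OF G_measurable[OF j], of t] G_reflect_measurable[OF j, of t]
      by (simp add: L2_rv_msq)
    show "L2_tendsto lborel sequentially (\<lambda>n u. indicator {t - real n..t} u *\<^sub>R g j (t - u)) (\<lambda>u. G j (t - u))"
    proof (rule L2_tendsto_dominated[where w="\<lambda>u. norm (G j (t - u))"])
      show "(\<lambda>u. indicator {t - real n..t} u *\<^sub>R g j (t - u)) \<in> borel_measurable lborel" for n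
        using j by measurable
      show "(\<lambda>u. G j (t - u)) \<in> borel_measurable lborel" using j by measurable
      show "L2_rv lborel (\<lambda>u. norm (G j (t - u)))" using G2 by (auto simp: L2_rv_def)
      show "norm (indicator {t - real n..t} u *\<^sub>R g j (t - u) - G j (t - u)) \<le> norm (G j (t - u))" for n u
        by (auto simp: G_def indicator_def)
      show "AE u in lborel. (\<lambda>n. indicator {t - real n..t} u *\<^sub>R g j (t - u)) \<longlonglongrightarrow> G j (t - u)"
      proof (rule AE_I2)
        fix u
        obtain N :: nat where N: "t - u \<le> real N" using real_arch_simple by blast
        have "\<forall>\<^sub>F n in sequentially. indicator {t - real n..t} u *\<^sub>R g j (t - u) = G j (t - u)"
          using eventually_ge_at_top[of N]
        proof eventually_elim
          case (elim n)
          then have "t - u \<le> real n" using N by simp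
          then show ?case by (auto simp: G_def indicator_def)
        qed
        then show "(\<lambda>n. indicator {t - real n..t} u *\<^sub>R g j (t - u)) \<longlonglongrightarrow> G j (t - u)"
          by (rule tendsto_eventually)
      qed
    qed
  qed (use meas j in measurable)
qed

lemma X_L2: "j \<in> {1..p} \<Longrightarrow> L2_rv M (\<lambda>\<omega>. X t \<omega> j)"
  by (rule levy_rep_L2(2)[OF X_rep])

definition X_const :: ennreal where
  "X_const = (\<Sum>j=1..p. 4 * ennreal noise_const * msq lborel (G j))"

lemma X_const_finite: "X_const < \<infinity>"
  unfolding X_const_def using G_L2
  by (auto simp: L2_rv_msq ennreal_mult_less_top)

text \<open>The kernel at time \<open>t\<close> is a reflected translate of \<open>G j\<close>, so
  its norm, and with it the bound, does not depend on \<open>t\<close>.\<close>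

lemma X_bound:
  assumes "j \<in> {1..p}"
  shows "msq M (\<lambda>\<omega>. X t \<omega> j) \<le> X_const"
proof -
  have "msq M (\<lambda>\<omega>. X t \<omega> j) \<le> 4 * ennreal noise_const * msq lborel (\<lambda>u. G j (t - u))"
    by (rule levy_rep_bound[OF X_rep[OF assms]])
  also have "\<dots> = 4 * ennreal noise_const * msq lborel (G j)"
    by (simp only: msq_reflect[OF G_measurable[OF assms]])
  also have "\<dots> \<le> X_const" unfolding X_const_def
    using assms by (intro member_le_sum) auto
  finally show ?thesis .
qed

lemma g_increment:
  assumes j: "1 \<le> j" "j < p" and ab: "0 \<le> a" "a \<le> b"
  shows "norm (g j b - g j a) \<le> (b - a) * (K * exp (- c * a))"
proof (cases "a = b")
  case False
  then have "a < b" using ab by simp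
  have "norm (g j b - g j a) \<le> K * exp (- c * a) * b - K * exp (- c * a) * a"
  proof (rule differentiable_bound_general[OF \<open>a < b\<close>])
    show "continuous_on {a..b} (g j)"
      by (rule continuous_on_subset[OF g_continuous]) (use j in auto)
    show "continuous_on {a..b} (\<lambda>x. K * exp (- c * a) * x)" by (intro continuous_intros)
    show "(g j has_vector_derivative g (j + 1) x) (at x)" for x by (rule g_deriv[OF j])
    show "((\<lambda>x. K * exp (- c * a) * x) has_vector_derivative K * exp (- c * a)) (at x)" for x
      unfolding has_real_derivative_iff_has_vector_derivative[symmetric]
      by (auto intro!: derivative_eq_intros)
    fix x assume x: "a < x" "x < b"
    have "norm (g (j + 1) x) \<le> K * exp (- c * x)" using x ab j by (intro g_bound) auto
    also have "\<dots> \<le> K * exp (- c * a)" using x c_pos K_nonneg by (intro mult_left_mono) auto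
    finally show "norm (g (j + 1) x) \<le> K * exp (- c * a)" .
  qed
  then show ?thesis by (simp add: algebra_simps)
qed simp

text \<open>A Lipschitz bound whose constant decays with \<open>x\<close>: the mean value inequality
  for \<open>g j\<close>, together with continuity of \<open>G j\<close> at 0. The factor
  \<open>exp c\<close> pays for moving the evaluation point by at most 1.\<close>

lemma G_increment:
  assumes j: "1 \<le> j" "j < p" and d: "\<bar>d\<bar> \<le> 1"
  shows "norm (G j (x + d) - G j x) \<le> \<bar>d\<bar> * (K * exp c * env x)"
proof -
  have key: "norm (G j b - G j a) \<le> (b - a) * (K * exp c * env y)" if ab: "a \<le> b" "y - 1 \<le> a" "b \<le> y + 1" for a b y
  proof (cases "b < 0")
    case True
    then have "G j b = 0" "G j a = 0" using ab by (auto simp: G_def)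
    then show ?thesis using ab K_nonneg by (simp add: env_def)
  next
    case False
    \<comment> \<open>Left of 0 the kernel is constantly 0 and equals \<open>g j 0\<close>, so the
      left end point may be moved up to 0 without changing the increment.\<close>
    define a' where "a' = max a 0"
    have "G j a = g j a'" using g_0[OF j] by (auto simp: G_def a'_def max_def)
    moreover have "G j b = g j b" using False by (simp add: G_def)
    ultimately have "norm (G j b - G j a) \<le> (b - a') * (K * exp (- c * a'))"
      using g_increment[OF j, of a' b] ab False by (simp add: a'_def)
    also have "\<dots> \<le> (b - a) * (K * exp (- c * (y - 1)))"
      using ab c_pos K_nonneg False by (intro mult_mono mult_left_mono) (auto simp: a'_def)
    also have "K * exp (- c * (y - 1)) = K * exp c * env y"
      using ab False by (simp add: env_def algebra_simps flip: exp_add)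
    finally show ?thesis .
  qed
  show ?thesis
  proof (cases "0 \<le> d")
    case True then show ?thesis using key[of x "x + d" x] d by simp
  next
    case False then show ?thesis using key[of "x + d" x x] d by (simp add: norm_minus_commute)
  qed
qed

text \<open>Dominated convergence: \<open>G_increment\<close> and the envelope provide the majorant,
  and the quotients converge at every \<open>x\<close> except possibly at 0, where
  \<open>G (j + 1)\<close> may jump.\<close>

lemma G_deriv_L2:
  assumes j: "1 \<le> j" "j < p" and d: "d \<longlonglongrightarrow> 0" "\<And>n. d n \<noteq> 0" "\<And>n. \<bar>d n\<bar> \<le> 1"
  shows "L2_tendsto lborel sequentially (\<lambda>n x. (G j (x + d n) - G j x) /\<^sub>R d n) (G (j + 1))"
proof (rule L2_tendsto_dominated[where w="\<lambda>x. 2 * (K * exp c) * env x"])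
  have Gm: "G j \<in> borel_measurable borel" "G (j + 1) \<in> borel_measurable borel"
    using j by (auto intro!: G_measurable)
  show "(\<lambda>x. (G j (x + d n) - G j x) /\<^sub>R d n) \<in> borel_measurable lborel" for n
    using Gm by measurable
  show "G (j + 1) \<in> borel_measurable lborel" using Gm by simp
  show "L2_rv lborel (\<lambda>x. 2 * (K * exp c) * env x)" by (rule env_L2)
  fix n x
  have "norm ((G j (x + d n) - G j x) /\<^sub>R d n) \<le> K * exp c * env x"
  proof -
    have "norm ((G j (x + d n) - G j x) /\<^sub>R d n) = norm (G j (x + d n) - G j x) / \<bar>d n\<bar>"
      by (simp add: divide_inverse mult.commute)
    also have "\<dots> \<le> K * exp c * env x"
      using G_increment[OF j d(3)[of n], of x] d(2)[of n] by (simp add: field_simps)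
    finally show ?thesis .
  qed
  moreover have "norm (G (j + 1) x) \<le> K * exp c * env x"
  proof -
    have "norm (G (j + 1) x) \<le> K * env x" using j by (intro G_env) auto
    also have "\<dots> \<le> K * exp c * env x"
      using K_nonneg c_pos by (intro mult_right_mono) (auto simp: env_def mult_le_cancel_left1)
    finally show ?thesis .
  qed
  ultimately show "norm ((G j (x + d n) - G j x) /\<^sub>R d n - G (j + 1) x) \<le> 2 * (K * exp c) * env x"
    using norm_triangle_ineq4[of "(G j (x + d n) - G j x) /\<^sub>R d n" "G (j + 1) x"] by linarith
next
  have "AE x in lborel. x \<noteq> (0::real)" by (rule AE_lborel_singleton)
  then show "AE x in lborel. (\<lambda>n. (G j (x + d n) - G j x) /\<^sub>R d n) \<longlonglongrightarrow> G (j + 1) x"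
  proof eventually_elim
    case (elim x)
    have "((\<lambda>h. (G j (x + h) - G j x) /\<^sub>R h) \<longlongrightarrow> G (j + 1) x) (at 0)"
    proof (cases "0 < x")
      case True
      have lim: "((\<lambda>h. (g j (x + h) - g j x) /\<^sub>R h) \<longlongrightarrow> g (j + 1) x) (at 0)"
        by (rule has_vector_derivative_slope[OF g_deriv[OF j]])
      have "\<forall>\<^sub>F h in at 0. (g j (x + h) - g j x) /\<^sub>R h = (G j (x + h) - G j x) /\<^sub>R h"
        unfolding eventually_at using True by (intro exI[of _ x]) (auto simp: G_def dist_real_def)
      from Lim_transform_eventually[OF lim this] show ?thesis using True by (simp add: G_def[of "Suc j"])
    next
      case False
      have "\<forall>\<^sub>F h in at 0. (G j (x + h) - G j x) /\<^sub>R h = G (j + 1) x"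
        unfolding eventually_at using False elim by (intro exI[of _ "- x"]) (auto simp: G_def dist_real_def)
      then show ?thesis by (rule tendsto_eventually)
    qed
    moreover have "filterlim d (at 0) sequentially"
      using d(1,2) by (simp add: filterlim_at)
    ultimately show ?case by (rule filterlim_compose)
  qed
qed

text \<open>The error of the difference quotient is itself an integral with respect to
  \<open>L\<close>, so its second moment is controlled by the error of the quotient of
  kernels.\<close>

lemma X_ms_deriv:
  assumes j: "1 \<le> j" "j < p"
  shows "L2_tendsto M (at 0) (\<lambda>d \<omega>. (X (t + d) \<omega> j - X t \<omega> j) /\<^sub>R d) (\<lambda>\<omega>. X t \<omega> (j + 1))"
proof -
  have jp: "j \<in> {1..p}" "j + 1 \<in> {1..p}" using j by auto
  have nb: "msq M (\<lambda>\<omega>. (X (t + d) \<omega> j - X t \<omega> j) /\<^sub>R d - X t \<omega> (j + 1))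
      \<le> 4 * ennreal noise_const * msq lborel (\<lambda>x. (G j (x + d) - G j x) /\<^sub>R d - G (j + 1) x)" for d
  proof -
    have "levy_rep (\<lambda>u. (G j (t + d - u) - G j (t - u)) /\<^sub>R d - G (j + 1) (t - u))
        (\<lambda>\<omega>. (X (t + d) \<omega> j - X t \<omega> j) /\<^sub>R d - X t \<omega> (j + 1))"
      by (intro levy_rep_diff levy_rep_scaleR X_rep jp)
    from levy_rep_bound[OF this]
    have "msq M (\<lambda>\<omega>. (X (t + d) \<omega> j - X t \<omega> j) /\<^sub>R d - X t \<omega> (j + 1))
      \<le> 4 * ennreal noise_const * msq lborel (\<lambda>u. (G j (t + d - u) - G j (t - u)) /\<^sub>R d - G (j + 1) (t - u))" .
    also have "(\<lambda>u. (G j (t + d - u) - G j (t - u)) /\<^sub>R d - G (j + 1) (t - u))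
        = (\<lambda>u. (\<lambda>x. (G j (x + d) - G j x) /\<^sub>R d - G (j + 1) x) (t - u))"
      by (simp add: algebra_simps)
    also have "msq lborel \<dots> = msq lborel (\<lambda>x. (G j (x + d) - G j x) /\<^sub>R d - G (j + 1) x)"
    proof (rule msq_reflect)
      show "(\<lambda>x. (G j (x + d) - G j x) /\<^sub>R d - G (j + 1) x) \<in> borel_measurable borel"
        using G_measurable[OF jp(1)] G_measurable[OF jp(2)] by measurable
    qed
    finally show ?thesis .
  qed
  \<comment> \<open>The envelope works only for increments of size at most 1, so the limit is taken
    inside an open interval around 0, which does not change it.\<close>
  have open1: "at 0 within {-1<..<1} = at (0::real)" by (rule at_within_open) auto
  have "((\<lambda>d. msq M (\<lambda>\<omega>. (X (t + d) \<omega> j - X t \<omega> j) /\<^sub>R d - X t \<omega> (j + 1))) \<longlongrightarrow> 0) (at 0 within {-1<..<1})"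
    unfolding tendsto_at_iff_sequentially
  proof (intro allI impI)
    fix d assume d: "\<forall>i. d i \<in> {- 1<..<1} - {0::real}" "d \<longlonglongrightarrow> 0"
    have "L2_tendsto lborel sequentially (\<lambda>n x. (G j (x + d n) - G j x) /\<^sub>R d n) (G (j + 1))"
      by (rule G_deriv_L2[OF j d(2)]) (use d(1) in \<open>auto simp: abs_le_iff less_imp_le\<close>)
    then have "(\<lambda>n. 4 * ennreal noise_const * msq lborel (\<lambda>x. (G j (x + d n) - G j x) /\<^sub>R d n - G (j + 1) x)) \<longlonglongrightarrow> 0"
      unfolding L2_tendsto_msq by (rule ennreal_tendsto_0_cmult) (simp add: ennreal_mult_less_top)
    then show "((\<lambda>d. msq M (\<lambda>\<omega>. (X (t + d) \<omega> j - X t \<omega> j) /\<^sub>R d - X t \<omega> (j + 1))) \<circ> d) \<longlonglongrightarrow> 0"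
      unfolding comp_def by (rule ennreal_tendsto_0_le) (intro always_eventually allI nb)
  qed
  then show ?thesis unfolding L2_tendsto_msq open1 .
qed

text \<open>The error of predicting block \<open>j\<close> at time \<open>t + h\<close> from the
  state at time \<open>t\<close>; it is generated by the increments of \<open>L\<close> after
  \<open>t\<close>.\<close>

definition innov :: "real \<Rightarrow> real \<Rightarrow> nat \<Rightarrow> 'w \<Rightarrow> real^'k" where
  "innov t h j \<omega> = X (t + h) \<omega> j - (\<Sum>l=1..p. bexp p (A_mat p A) h j l *v X t \<omega> l)"

lemma innov_rep:
  assumes j: "j \<in> {1..p}"
  shows "levy_rep (\<lambda>u. G j (t + h - u) - (\<Sum>l=1..p. bexp p (A_mat p A) h j l ** G l (t - u))) (innov t h j)"
  unfolding innov_def[abs_def]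
  by (intro levy_rep_diff levy_rep_sum levy_rep_mult X_rep j)

lemma innov_L2: "j \<in> {1..p} \<Longrightarrow> L2_rv M (innov t h j)"
  by (rule levy_rep_L2(2)[OF innov_rep])

text \<open>The kernel of the prediction error vanishes up to time \<open>t\<close> by the semigroup
  property, and the kernel of \<open>X s\<close> vanishes after \<open>s \<le> t\<close>; so the
  supports are disjoint.\<close>

lemma innov_orthogonal:
  assumes j: "j \<in> {1..p}" and l: "l \<in> {1..p}" and h: "0 \<le> h" and s: "s \<le> t"
  shows "(LINT \<omega>|M. innov t h j \<omega> $ a * X s \<omega> l $ b) = 0"
proof (rule levy_rep_orthogonal[OF innov_rep[OF j] X_rep[OF l]])
  fix u
  show "G j (t + h - u) - (\<Sum>i=1..p. bexp p (A_mat p A) h j i ** G i (t - u)) = 0 \<or> G l (s - u) = 0"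
  proof (cases "u \<le> t")
    case True
    then have "G j (t + h - u) = g j (h + (t - u))" using h by (simp add: G_def algebra_simps)
    also have "\<dots> = (\<Sum>i=1..p. bexp p (A_mat p A) h j i ** G i (t - u))"
      unfolding g_add[OF j] using True by (simp add: G_def)
    finally show ?thesis by simp
  next
    case False
    then show ?thesis using s by (simp add: G_def)
  qed
qed

end

section \<open>Kernel integrals of bounded processes\<close>

lemma integral_indicator_at_bot:
  fixes f :: "real \<Rightarrow> 'b::{banach, second_countable_topology}"
  assumes f: "integrable lborel f"
  shows "((\<lambda>s. LINT u|lborel. indicator {s..} u *\<^sub>R f u) \<longlongrightarrow> (LINT u|lborel. f u)) at_bot"
  unfolding filterlim_at_bot_mirror
proof (rule integral_dominated_convergence_at_top[where w="\<lambda>u. norm (f u)"])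
  show "f \<in> borel_measurable lborel" "integrable lborel (\<lambda>u. norm (f u))" using f by auto
  show "(\<lambda>u. indicator {- s..} u *\<^sub>R f u) \<in> borel_measurable lborel" for s
    using f by auto
  show "\<forall>\<^sub>F s in at_top. AE u in lborel. norm (indicator {- s..} u *\<^sub>R f u) \<le> norm (f u)"
    by (auto simp: indicator_def)
  show "AE u in lborel. ((\<lambda>s. indicator {- s..} u *\<^sub>R f u) \<longlongrightarrow> f u) at_top"
  proof (rule AE_I2)
    fix u
    have "\<forall>\<^sub>F s in at_top. indicator {- s..} u *\<^sub>R f u = f u"
      using eventually_ge_at_top[of "- u"] by eventually_elim (auto simp: indicator_def)
    then show "((\<lambda>s. indicator {- s..} u *\<^sub>R f u) \<longlongrightarrow> f u) at_top" by (rule tendsto_eventually)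
  qed
qed

text \<open>The scalar type is left open because the output is needed twice: with real values for
  pairings with real test variables, and with complex values for projections.\<close>

locale bounded_L2_process = prob_space M for M :: "'w measure" +
  fixes Z :: "real \<Rightarrow> 'w \<Rightarrow> 'b::{real_normed_field, euclidean_space}" and B :: ennreal
  assumes Z_joint: "(\<lambda>(u, \<omega>). Z u \<omega>) \<in> borel_measurable (lborel \<Otimes>\<^sub>M M)"
    and Z_bound: "\<And>u. msq M (Z u) \<le> B" and B_finite: "B < \<infinity>"
begin

interpretation P: pair_sigma_finite lborel M ..

lemma Z_measurable [measurable]: "Z u \<in> borel_measurable M"
  using measurable_compose[OF measurable_Pair1'[of u lborel M] Z_joint] by simp

lemma Z_path_measurable: "\<omega> \<in> space M \<Longrightarrow> (\<lambda>u. Z u \<omega>) \<in> borel_measurable lborel"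
  using measurable_compose[OF measurable_Pair2'[of \<omega> M lborel] Z_joint] by simp

text \<open>A pathwise Lebesgue integral. It takes the default value 0 on paths where the integrand
  is not integrable; for an integrable kernel these form a null set.\<close>

definition KI :: "(real \<Rightarrow> real) \<Rightarrow> 'w \<Rightarrow> 'b" where
  "KI k \<omega> = (LINT u|lborel. k u *\<^sub>R Z u \<omega>)"

lemma joint_measurable:
  assumes "k \<in> borel_measurable borel"
  shows "(\<lambda>(u, \<omega>). k u *\<^sub>R Z u \<omega>) \<in> borel_measurable (lborel \<Otimes>\<^sub>M M)"
proof -
  have "(\<lambda>z. k (fst z)) \<in> borel_measurable (lborel \<Otimes>\<^sub>M M)"
    by (rule measurable_compose[OF measurable_fst]) (use assms in simp)
  then have "(\<lambda>z. k (fst z) *\<^sub>R (\<lambda>(u, \<omega>). Z u \<omega>) z) \<in> borel_measurable (lborel \<Otimes>\<^sub>M M)"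
    using Z_joint by (rule borel_measurable_scaleR)
  then show ?thesis by (simp add: case_prod_unfold)
qed

lemma KI_measurable [measurable]:
  assumes "k \<in> borel_measurable borel"
  shows "KI k \<in> borel_measurable M"
proof -
  have "(\<lambda>(\<omega>, u). k u *\<^sub>R Z u \<omega>) \<in> borel_measurable (M \<Otimes>\<^sub>M lborel)"
    using measurable_compose[OF measurable_pair_swap' joint_measurable[OF assms]]
    by (simp add: case_prod_unfold)
  then show ?thesis unfolding KI_def[abs_def]
    by (rule lborel.borel_measurable_lebesgue_integral)
qed

text \<open>The estimate \<open>\<bar>Z W\<bar> \<le> \<bar>Z\<bar>^2 + \<bar>W\<bar>^2\<close> and
  the uniform bound \<open>B\<close> give integrability on the product space. With
  \<open>W = 1\<close> it covers the process itself.\<close>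

lemma integrable_joint_mult:
  assumes k: "integrable lborel k" and W: "L2_rv M W"
  shows "integrable (lborel \<Otimes>\<^sub>M M) (\<lambda>(u, \<omega>). (k u *\<^sub>R Z u \<omega>) * W \<omega>)"
proof -
  have km [measurable]: "k \<in> borel_measurable borel" using k by auto
  have Wm [measurable]: "W \<in> borel_measurable M" using W by auto
  have meas: "(\<lambda>z. (case z of (u, \<omega>) \<Rightarrow> (k u *\<^sub>R Z u \<omega>) * W \<omega>)) \<in> borel_measurable (lborel \<Otimes>\<^sub>M M)"
  proof -
    have "(\<lambda>z. (\<lambda>(u, \<omega>). k u *\<^sub>R Z u \<omega>) z * W (snd z)) \<in> borel_measurable (lborel \<Otimes>\<^sub>M M)"
      by (intro borel_measurable_times joint_measurable km measurable_compose[OF measurable_snd Wm])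
    then show ?thesis by (simp add: case_prod_unfold)
  qed
  have "(\<integral>\<^sup>+z. ennreal (norm (case z of (u, \<omega>) \<Rightarrow> (k u *\<^sub>R Z u \<omega>) * W \<omega>)) \<partial>(lborel \<Otimes>\<^sub>M M))
      = (\<integral>\<^sup>+u. \<integral>\<^sup>+\<omega>. ennreal (norm ((k u *\<^sub>R Z u \<omega>) * W \<omega>)) \<partial>M \<partial>lborel)"
    using nn_integral_fst[OF measurable_compose[OF measurable_compose[OF meas borel_measurable_norm] measurable_ennreal]] by simp
  also have "\<dots> \<le> (\<integral>\<^sup>+u. ennreal (norm (k u)) * (B + msq M W) \<partial>lborel)"
  proof (rule nn_integral_mono)
    fix u :: real
    have pt: "norm ((k u *\<^sub>R Z u \<omega>) * W \<omega>) \<le> norm (k u) * ((norm (Z u \<omega>))\<^sup>2 + (norm (W \<omega>))\<^sup>2)" for \<omega>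
    proof -
      have "norm (Z u \<omega>) * norm (W \<omega>) \<le> (norm (Z u \<omega>))\<^sup>2 + (norm (W \<omega>))\<^sup>2"
      proof -
        have "0 \<le> norm (Z u \<omega>) * norm (W \<omega>)" by simp
        then show ?thesis using sum_squares_bound[of "norm (Z u \<omega>)" "norm (W \<omega>)"] by linarith
      qed
      then show ?thesis by (simp add: norm_mult mult.assoc mult_left_mono)
    qed
    have "(\<integral>\<^sup>+\<omega>. ennreal (norm ((k u *\<^sub>R Z u \<omega>) * W \<omega>)) \<partial>M)
        \<le> (\<integral>\<^sup>+\<omega>. ennreal (norm (k u)) * (ennreal ((norm (Z u \<omega>))\<^sup>2) + ennreal ((norm (W \<omega>))\<^sup>2)) \<partial>M)"
      using pt by (intro nn_integral_mono) (simp add: ennreal_leI flip: ennreal_plus ennreal_mult)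
    also have "\<dots> = ennreal (norm (k u)) * (msq M (Z u) + msq M W)"
      unfolding msq_def by (simp add: nn_integral_cmult nn_integral_add)
    also have "\<dots> \<le> ennreal (norm (k u)) * (B + msq M W)"
      by (intro mult_left_mono add_right_mono Z_bound) auto
    finally show "(\<integral>\<^sup>+\<omega>. ennreal (norm ((k u *\<^sub>R Z u \<omega>) * W \<omega>)) \<partial>M) \<le> ennreal (norm (k u)) * (B + msq M W)" .
  qed
  also have "\<dots> = (\<integral>\<^sup>+u. ennreal (norm (k u)) \<partial>lborel) * (B + msq M W)"
    by (rule nn_integral_multc) simp
  also have "\<dots> < \<infinity>"
    using k W B_finite by (auto simp: integrable_iff_bounded L2_rv_msq ennreal_mult_less_top)
  finally show ?thesis using meas by (simp add: integrable_iff_bounded)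
qed

lemma integrable_joint:
  assumes "integrable lborel k"
  shows "integrable (lborel \<Otimes>\<^sub>M M) (\<lambda>(u, \<omega>). k u *\<^sub>R Z u \<omega>)"
proof -
  have "L2_rv M (\<lambda>_. 1 :: 'b)" by (simp add: L2_rv_def)
  from integrable_joint_mult[OF assms this] show ?thesis by simp
qed

lemma AE_integrable_path:
  assumes "integrable lborel k"
  shows "AE \<omega> in M. integrable lborel (\<lambda>u. k u *\<^sub>R Z u \<omega>)"
  by (rule P.AE_integrable_snd[OF integrable_joint[OF assms]])

text \<open>Fubini's theorem reduces a question about the random integral to the deterministic
  functions \<open>u \<mapsto> E(Z u W)\<close>.\<close>

lemma KI_pairing:
  assumes k: "integrable lborel k" and W: "L2_rv M W"
  shows "(LINT \<omega>|M. KI k \<omega> * W \<omega>) = (LINT u|lborel. k u *\<^sub>R (LINT \<omega>|M. Z u \<omega> * W \<omega>))"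
    and "integrable lborel (\<lambda>u. k u *\<^sub>R (LINT \<omega>|M. Z u \<omega> * W \<omega>))"
proof -
  note int = integrable_joint_mult[OF assms]
  have inner: "(LINT \<omega>|M. (k u *\<^sub>R Z u \<omega>) * W \<omega>) = k u *\<^sub>R (LINT \<omega>|M. Z u \<omega> * W \<omega>)" for u
    by simp
  have "(LINT \<omega>|M. KI k \<omega> * W \<omega>) = (LINT \<omega>|M. LINT u|lborel. (k u *\<^sub>R Z u \<omega>) * W \<omega>)"
    unfolding KI_def by (simp only: integral_mult_left_zero)
  also have "\<dots> = (LINT u|lborel. LINT \<omega>|M. (k u *\<^sub>R Z u \<omega>) * W \<omega>)"
    by (rule P.Fubini_integral[OF int])
  finally show "(LINT \<omega>|M. KI k \<omega> * W \<omega>) = (LINT u|lborel. k u *\<^sub>R (LINT \<omega>|M. Z u \<omega> * W \<omega>))"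
    unfolding inner .
  show "integrable lborel (\<lambda>u. k u *\<^sub>R (LINT \<omega>|M. Z u \<omega> * W \<omega>))"
    using P.integrable_fst[OF int] unfolding inner .
qed

text \<open>Cauchy-Schwarz for each path with respect to the weight \<open>\<bar>k\<bar>\<close>,
  followed by an exchange of the two integrations, so that only \<open>msq M (Z u) \<le> B\<close>
  enters.\<close>

lemma KI_msq:
  assumes k: "integrable lborel k"
  shows "msq M (KI k) \<le> (\<integral>\<^sup>+u. ennreal \<bar>k u\<bar> \<partial>lborel)\<^sup>2 * B"
proof -
  have km [measurable]: "k \<in> borel_measurable borel" using k by auto
  let ?k = "\<integral>\<^sup>+u. ennreal \<bar>k u\<bar> \<partial>lborel"
  have meas: "(\<lambda>z. ennreal (\<bar>k (fst z)\<bar> * (norm (Z (fst z) (snd z)))\<^sup>2)) \<in> borel_measurable (lborel \<Otimes>\<^sub>M M)"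
  proof -
    have "(\<lambda>z. Z (fst z) (snd z)) \<in> borel_measurable (lborel \<Otimes>\<^sub>M M)" using Z_joint by (simp add: case_prod_unfold)
    moreover have "(\<lambda>z. k (fst z)) \<in> borel_measurable (lborel \<Otimes>\<^sub>M M)"
      by (rule measurable_compose[OF measurable_fst]) simp
    ultimately show ?thesis by measurable
  qed
  have pt: "ennreal ((norm (KI k \<omega>))\<^sup>2) \<le> ?k * (\<integral>\<^sup>+u. ennreal (\<bar>k u\<bar> * (norm (Z u \<omega>))\<^sup>2) \<partial>lborel)"
    if \<omega>: "\<omega> \<in> space M" for \<omega>
  proof -
    have [measurable]: "(\<lambda>u. Z u \<omega>) \<in> borel_measurable borel" using Z_path_measurable[OF \<omega>] by simp
    \<comment> \<open>On a path without integrability the left-hand side is 0 by convention, so the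
      bound holds there as well.\<close>
    have "ennreal (norm (KI k \<omega>)) \<le> (\<integral>\<^sup>+u. ennreal (norm (k u *\<^sub>R Z u \<omega>)) \<partial>lborel)"
    proof (cases "integrable lborel (\<lambda>u. k u *\<^sub>R Z u \<omega>)")
      case True
      then show ?thesis unfolding KI_def by (rule integral_norm_bound_ennreal)
    next
      case False
      then show ?thesis unfolding KI_def by (simp add: not_integrable_integral_eq)
    qed
    \<comment> \<open>The kernel is split as \<open>sqrt \<bar>k\<bar> * sqrt \<bar>k\<bar>\<close>,
      so that one factor produces the integral of \<open>\<bar>k\<bar>\<close> and the other the
      weighted square of the path.\<close>
    also have "\<dots> = (\<integral>\<^sup>+u. ennreal (sqrt \<bar>k u\<bar>) * ennreal (sqrt \<bar>k u\<bar> * norm (Z u \<omega>)) \<partial>lborel)"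
      by (intro nn_integral_cong) (simp add: mult.assoc[symmetric] flip: ennreal_mult)
    finally have "(ennreal (norm (KI k \<omega>)))\<^sup>2 \<le> (\<integral>\<^sup>+u. ennreal (sqrt \<bar>k u\<bar>) * ennreal (sqrt \<bar>k u\<bar> * norm (Z u \<omega>)) \<partial>lborel)\<^sup>2"
      by (intro power_mono) auto
    also have "\<dots> \<le> (\<integral>\<^sup>+u. (ennreal (sqrt \<bar>k u\<bar>))\<^sup>2 \<partial>lborel) * (\<integral>\<^sup>+u. (ennreal (sqrt \<bar>k u\<bar> * norm (Z u \<omega>)))\<^sup>2 \<partial>lborel)"
      by (intro Cauchy_Schwarz_nn_integral) simp_all
    finally show ?thesis by (simp add: ennreal_power power_mult_distrib)
  qed
  have "msq M (KI k) \<le> (\<integral>\<^sup>+\<omega>. ?k * (\<integral>\<^sup>+u. ennreal (\<bar>k u\<bar> * (norm (Z u \<omega>))\<^sup>2) \<partial>lborel) \<partial>M)"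
    unfolding msq_def using pt by (intro nn_integral_mono) auto
  also have "\<dots> = ?k * (\<integral>\<^sup>+\<omega>. (\<integral>\<^sup>+u. ennreal (\<bar>k u\<bar> * (norm (Z u \<omega>))\<^sup>2) \<partial>lborel) \<partial>M)"
  proof (rule nn_integral_cmult)
    have "(\<lambda>(\<omega>, u). ennreal (\<bar>k u\<bar> * (norm (Z u \<omega>))\<^sup>2)) \<in> borel_measurable (M \<Otimes>\<^sub>M lborel)"
      using measurable_compose[OF measurable_pair_swap' meas] by (simp add: case_prod_unfold)
    then show "(\<lambda>\<omega>. \<integral>\<^sup>+u. ennreal (\<bar>k u\<bar> * (norm (Z u \<omega>))\<^sup>2) \<partial>lborel) \<in> borel_measurable M"
      by (rule lborel.borel_measurable_nn_integral)
  qed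
  also have "(\<integral>\<^sup>+\<omega>. (\<integral>\<^sup>+u. ennreal (\<bar>k u\<bar> * (norm (Z u \<omega>))\<^sup>2) \<partial>lborel) \<partial>M)
      = (\<integral>\<^sup>+u. (\<integral>\<^sup>+\<omega>. ennreal (\<bar>k u\<bar> * (norm (Z u \<omega>))\<^sup>2) \<partial>M) \<partial>lborel)"
    using P.Fubini[OF meas] by simp
  also have "\<dots> = (\<integral>\<^sup>+u. ennreal \<bar>k u\<bar> * msq M (Z u) \<partial>lborel)"
    unfolding msq_def by (intro nn_integral_cong) (simp add: ennreal_mult nn_integral_cmult)
  also have "\<dots> \<le> (\<integral>\<^sup>+u. ennreal \<bar>k u\<bar> * B \<partial>lborel)"
    by (intro nn_integral_mono mult_left_mono Z_bound) auto
  also have "\<dots> = ?k * B" by (rule nn_integral_multc) simp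
  finally show ?thesis
    by (simp add: power2_eq_square mult.assoc mult_left_mono)
qed

lemma KI_L2:
  assumes k: "integrable lborel k"
  shows "L2_rv M (KI k)"
proof -
  have "(\<integral>\<^sup>+u. ennreal \<bar>k u\<bar> \<partial>lborel)\<^sup>2 * B < \<infinity>"
    using k B_finite by (auto simp: integrable_iff_bounded ennreal_mult_less_top power_less_top_ennreal)
  with KI_msq[OF k] have "msq M (KI k) < \<infinity>" by (rule le_less_trans)
  moreover have "k \<in> borel_measurable borel" using k by auto
  ultimately show ?thesis by (simp add: L2_rv_msq)
qed

lemma integrable_cut:
  fixes k :: "real \<Rightarrow> real"
  assumes "integrable lborel k"
  shows "integrable lborel (\<lambda>u. indicator {s..} u * k u)"
proof -
  have "{s..} \<in> sets lborel" by simp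
  from integrable_mult_indicator[OF this assms] show ?thesis by simp
qed

text \<open>The difference is the integral with the discarded part of the kernel, and
  \<open>KI_msq\<close> bounds it by the square of a tail of \<open>\<bar>k\<bar>\<close>.\<close>

lemma KI_cut_L2:
  assumes k: "integrable lborel k"
  shows "L2_tendsto M at_bot (\<lambda>s. KI (\<lambda>u. indicator {s..} u * k u)) (KI k)"
proof -
  note cut = integrable_cut[OF k]
  have le: "msq M (\<lambda>\<omega>. KI (\<lambda>u. indicator {s..} u * k u) \<omega> - KI k \<omega>)
      \<le> (ennreal (LINT u|lborel. \<bar>k u\<bar> - indicator {s..} u * \<bar>k u\<bar>))\<^sup>2 * B" for s
  proof -
    let ?d = "\<lambda>u. indicator {s..} u * k u - k u"
    have d: "integrable lborel ?d" by (intro Bochner_Integration.integrable_diff cut k)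
    have "AE \<omega> in M. KI (\<lambda>u. indicator {s..} u * k u) \<omega> - KI k \<omega> = KI ?d \<omega>"
      using AE_integrable_path[OF cut[of s]] AE_integrable_path[OF k]
      by eventually_elim (simp add: KI_def scaleR_diff_left)
    then have "msq M (\<lambda>\<omega>. KI (\<lambda>u. indicator {s..} u * k u) \<omega> - KI k \<omega>) = msq M (KI ?d)"
      by (rule msq_cong_AE)
    also have "\<dots> \<le> (\<integral>\<^sup>+u. ennreal \<bar>?d u\<bar> \<partial>lborel)\<^sup>2 * B" by (rule KI_msq[OF d])
    also have "(\<integral>\<^sup>+u. ennreal \<bar>?d u\<bar> \<partial>lborel) = ennreal (LINT u|lborel. \<bar>?d u\<bar>)"
      by (rule nn_integral_eq_integral) (use d in auto)
    also have "(\<lambda>u. \<bar>?d u\<bar>) = (\<lambda>u. \<bar>k u\<bar> - indicator {s..} u * \<bar>k u\<bar>)"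
      by (auto simp: indicator_def)
    finally show ?thesis .
  qed
  have "((\<lambda>s. LINT u|lborel. \<bar>k u\<bar> - indicator {s..} u * \<bar>k u\<bar>) \<longlongrightarrow> (LINT u|lborel. \<bar>k u\<bar>) - (LINT u|lborel. \<bar>k u\<bar>)) at_bot"
  proof -
    have ka: "integrable lborel (\<lambda>u. \<bar>k u\<bar>)" using k by simp
    have "(LINT u|lborel. \<bar>k u\<bar> - indicator {s..} u * \<bar>k u\<bar>)
        = (LINT u|lborel. \<bar>k u\<bar>) - (LINT u|lborel. indicator {s..} u *\<^sub>R \<bar>k u\<bar>)" for s
      using ka integrable_cut[OF ka] by (subst Bochner_Integration.integral_diff) simp_all
    then show ?thesis
      by (simp only:) (intro tendsto_diff tendsto_const integral_indicator_at_bot ka)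
  qed
  then have "((\<lambda>s. ennreal ((LINT u|lborel. \<bar>k u\<bar> - indicator {s..} u * \<bar>k u\<bar>)\<^sup>2))
      \<longlongrightarrow> ennreal (((LINT u|lborel. \<bar>k u\<bar>) - (LINT u|lborel. \<bar>k u\<bar>))\<^sup>2)) at_bot"
    by (rule tendsto_ennrealI[OF tendsto_power])
  moreover have "ennreal ((LINT u|lborel. \<bar>k u\<bar> - indicator {s..} u * \<bar>k u\<bar>)\<^sup>2)
      = (ennreal (LINT u|lborel. \<bar>k u\<bar> - indicator {s..} u * \<bar>k u\<bar>))\<^sup>2" for s
    by (rule ennreal_power[symmetric]) (rule Bochner_Integration.integral_nonneg, simp add: indicator_def)
  ultimately have "((\<lambda>s. (ennreal (LINT u|lborel. \<bar>k u\<bar> - indicator {s..} u * \<bar>k u\<bar>))\<^sup>2) \<longlongrightarrow> 0) at_bot"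
    by simp
  then have "((\<lambda>s. B * (ennreal (LINT u|lborel. \<bar>k u\<bar> - indicator {s..} u * \<bar>k u\<bar>))\<^sup>2) \<longlongrightarrow> 0) at_bot"
    using B_finite by (intro ennreal_tendsto_0_cmult) simp_all
  then show ?thesis unfolding L2_tendsto_msq
    by (rule ennreal_tendsto_0_le) (intro always_eventually allI, simp only: mult.commute[of B] le)
qed

lemma KI_cut_AE:
  assumes k: "integrable lborel k"
  shows "AE \<omega> in M. ((\<lambda>s. KI (\<lambda>u. indicator {s..} u * k u) \<omega>) \<longlongrightarrow> KI k \<omega>) at_bot"
  using AE_integrable_path[OF k]
proof eventually_elim
  case (elim \<omega>)
  from integral_indicator_at_bot[OF this] show ?case by (simp add: KI_def)
qed

end

text \<open>\<open>KI k\<close> witnesses that a value with the required properties exists, so the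
  chosen one has them too, and uniqueness of limits in mean square identifies the two.
  \<open>F\<close> has to agree with the kernel expression only up to time \<open>t\<close>.\<close>

lemma integral_upto_kernel:
  assumes P: "bounded_L2_process M Z B" and k: "integrable lborel k" and supp: "\<And>u. t < u \<Longrightarrow> k u = 0"
    and F: "\<And>u \<omega>. u \<le> t \<Longrightarrow> F u \<omega> = k u *\<^sub>R Z u \<omega>"
  shows "integral_upto M t F \<in> borel_measurable M"
    and "AE \<omega> in M. integral_upto M t F \<omega> = bounded_L2_process.KI Z k \<omega>"
proof -
  interpret bounded_L2_process M Z B by fact
  have km [measurable]: "k \<in> borel_measurable borel" using k by auto
  have cut: "(LINT u:{s..t}|lborel. F u \<omega>) = KI (\<lambda>u. indicator {s..} u * k u) \<omega>" for s \<omega>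
    unfolding set_lebesgue_integral_def KI_def
    by (intro Bochner_Integration.integral_cong refl) (auto simp: indicator_def F supp not_le)
  have "\<exists>J. J \<in> borel_measurable M \<and>
        (AE \<omega> in M. ((\<lambda>s. LINT u:{s..t}|lborel. F u \<omega>) \<longlongrightarrow> J \<omega>) at_bot) \<and>
        L2_tendsto M at_bot (\<lambda>s \<omega>. LINT u:{s..t}|lborel. F u \<omega>) J"
    unfolding cut
    by (intro exI[of _ "KI k"] conjI KI_measurable km KI_cut_AE KI_cut_L2 k)
  from someI_ex[OF this]
  have m: "integral_upto M t F \<in> borel_measurable M"
    and lim: "L2_tendsto M at_bot (\<lambda>s. KI (\<lambda>u. indicator {s..} u * k u)) (integral_upto M t F)"
    unfolding integral_upto_def cut by (rule conjunct1, rule conjunct2[OF conjunct2])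
  show "integral_upto M t F \<in> borel_measurable M" by (rule m)
  show "AE \<omega> in M. integral_upto M t F \<omega> = KI k \<omega>"
  proof (rule L2_tendsto_unique[OF lim KI_cut_L2[OF k]])
    show "KI (\<lambda>u. indicator {s..} u * k u) \<in> borel_measurable M" for s
      by (intro KI_measurable) measurable
  qed (auto simp: m)
qed

text \<open>Let \<open>W\<close> be \<open>KI k\<close> minus its projection. It is orthogonal to
  every \<open>Z u\<close> with \<open>k u \<noteq> 0\<close>, hence to \<open>KI k\<close> by
  \<open>KI_pairing\<close>, hence to itself. This replaces an approximation by Riemann sums, which
  would ask for regularity of the paths.\<close>

lemma KI_in_subspace:
  assumes P: "bounded_L2_process M Z B" and k: "integrable lborel k"
    and H: "L2_subspace M H" and Z: "\<And>u. k u \<noteq> 0 \<Longrightarrow> Z u \<in> H"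
  shows "bounded_L2_process.KI Z k \<in> H"
proof -
  interpret bounded_L2_process M Z B by fact
  let ?J = "KI k" and ?P = "L2_proj M H (KI k)"
  note PS = L2_proj_spec[OF prob_space_axioms H KI_L2[OF k]]
  define W where "W = (\<lambda>\<omega>. ?J \<omega> - ?P \<omega>)"
  have WL: "L2_rv M W" unfolding W_def by (intro L2_rv_diff KI_L2 k L2_subspaceD(1)[OF H PS(1)])
  have orth: "(LINT \<omega>|M. U \<omega> * cnj (W \<omega>)) = 0" if U: "U \<in> H" for U
  proof -
    have "(LINT \<omega>|M. U \<omega> * cnj (W \<omega>)) = (LINT \<omega>|M. cnj (W \<omega> * cnj (U \<omega>)))" by (simp add: mult.commute)
    also have "\<dots> = cnj (LINT \<omega>|M. W \<omega> * cnj (U \<omega>))" by (rule Bochner_Integration.integral_cnj)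
    finally show ?thesis using PS(2)[OF U] by (simp add: W_def)
  qed
  have "(LINT \<omega>|M. ?J \<omega> * cnj (W \<omega>)) = (LINT u|lborel. k u *\<^sub>R (LINT \<omega>|M. Z u \<omega> * cnj (W \<omega>)))"
    by (rule KI_pairing(1)[OF k L2_rv_cnj[OF WL]])
  also have "(\<lambda>u. k u *\<^sub>R (LINT \<omega>|M. Z u \<omega> * cnj (W \<omega>))) = (\<lambda>_. 0)"
    using orth[OF Z] by (auto simp: fun_eq_iff)
  finally have J0: "(LINT \<omega>|M. ?J \<omega> * cnj (W \<omega>)) = 0" by simp
  have "(LINT \<omega>|M. W \<omega> * cnj (W \<omega>)) = (LINT \<omega>|M. ?J \<omega> * cnj (W \<omega>) - ?P \<omega> * cnj (W \<omega>))"
    by (intro Bochner_Integration.integral_cong refl) (simp add: W_def left_diff_distrib)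
  also have "\<dots> = 0"
    by (subst Bochner_Integration.integral_diff)
      (simp_all add: J0 orth[OF PS(1)] integrable_mult_cnj KI_L2 k WL L2_subspaceD(1)[OF H PS(1)])
  finally have "AE \<omega> in M. W \<omega> = 0" by (rule AE_zero_if_energy_zero[OF WL])
  then have "AE \<omega> in M. ?P \<omega> = ?J \<omega>" by eventually_elim (simp add: W_def)
  moreover have "k \<in> borel_measurable borel" using k by auto
  ultimately show ?thesis by (intro L2_subspace_AE[OF H PS(1)]) auto
qed

section \<open>The output process and its derivatives\<close>

lemma bounded_bilinear_matrix_vector: "bounded_bilinear (\<lambda>(G :: real^'n::finite^'m::finite) x. G *v x)"
proof -
  have "linear (\<lambda>G :: real^'n^'m. G *v x)" for x
    by (rule linearI) (simp_all add: matrix_vector_mult_add_rdistrib scaleR_matrix_vector_assoc)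
  then have "bilinear (\<lambda>(G :: real^'n^'m) x. G *v x)"
    unfolding bilinear_def by (simp add: matrix_vector_mul_linear)
  then show ?thesis by (simp only: bilinear_conv_bounded_bilinear)
qed

lemma matrix_vector_mult_minus: "(- G) *v x = - (G *v x)" for G :: "real^'n^'m"
  by (simp add: vec_eq_iff matrix_vector_mult_def sum_negf)

context prob_space
begin

definition ubdd :: "(real \<Rightarrow> 'a \<Rightarrow> 'b::euclidean_space) \<Rightarrow> bool" where
  "ubdd f \<longleftrightarrow> (\<forall>u. f u \<in> borel_measurable M) \<and> (\<exists>B<\<infinity>. \<forall>u. msq M (f u) \<le> B)"

lemma ubdd_zero: "ubdd (\<lambda>u \<omega>. 0)"
  unfolding ubdd_def by (auto simp: msq_def intro!: exI[of _ 0])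

lemma ubdd_add:
  assumes "ubdd f" "ubdd g"
  shows "ubdd (\<lambda>u \<omega>. f u \<omega> + g u \<omega>)"
proof -
  obtain B where B: "B < \<infinity>" "\<And>u. msq M (f u) \<le> B" using assms(1) unfolding ubdd_def by blast
  obtain D where D: "D < \<infinity>" "\<And>u. msq M (g u) \<le> D" using assms(2) unfolding ubdd_def by blast
  have m: "\<And>u. f u \<in> borel_measurable M" "\<And>u. g u \<in> borel_measurable M" using assms unfolding ubdd_def by auto
  have "msq M (\<lambda>\<omega>. f u \<omega> + g u \<omega>) \<le> 2 * B + 2 * D" for u
    by (rule order_trans[OF msq_add[OF m(1) m(2)]]) (intro add_mono mult_left_mono B D, simp_all)
  moreover have "2 * B + 2 * D < \<infinity>" using B D by (simp add: ennreal_mult_less_top)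
  ultimately show ?thesis unfolding ubdd_def using m by (auto intro!: exI[of _ "2 * B + 2 * D"])
qed

lemma ubdd_linear:
  assumes "bounded_linear T" "ubdd f"
  shows "ubdd (\<lambda>u \<omega>. T (f u \<omega>))"
proof -
  obtain B where B: "B < \<infinity>" "\<And>u. msq M (f u) \<le> B" using assms(2) unfolding ubdd_def by blast
  have m: "\<And>u. f u \<in> borel_measurable M" using assms unfolding ubdd_def by auto
  obtain K where K: "\<And>x. norm (T x) \<le> norm x * K"
    using bounded_linear.bounded[OF assms(1)] by blast
  have "msq M (\<lambda>\<omega>. T (f u \<omega>)) \<le> ennreal (K\<^sup>2) * B" for u
  proof -
    have "msq M (\<lambda>\<omega>. T (f u \<omega>)) \<le> ennreal (K\<^sup>2) * msq M (f u)"
      using K m by (intro msq_bound) (simp_all add: mult.commute)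
    also have "\<dots> \<le> ennreal (K\<^sup>2) * B" by (intro mult_left_mono B) simp
    finally show ?thesis .
  qed
  moreover have "ennreal (K\<^sup>2) * B < \<infinity>" using B by (simp add: ennreal_mult_less_top)
  moreover have "(\<lambda>\<omega>. T (f u \<omega>)) \<in> borel_measurable M" for u
    by (rule measurable_compose[OF m borel_measurable_continuous_onI[OF linear_continuous_on[OF assms(1)]]])
  ultimately show ?thesis unfolding ubdd_def by blast
qed

lemma ubdd_sum:
  assumes "\<And>i. i \<in> I \<Longrightarrow> ubdd (f i)"
  shows "ubdd (\<lambda>u \<omega>. \<Sum>i\<in>I. f i u \<omega>)"
  using assms
proof (induction I rule: infinite_finite_induct)
  case (insert i I)
  then have "ubdd (\<lambda>u \<omega>. f i u \<omega> + (\<Sum>i\<in>I. f i u \<omega>))" by (intro ubdd_add) simp_all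
  with insert.hyps show ?case by simp
next
  case empty show ?case unfolding sum.empty by (rule ubdd_zero)
next
  case (infinite A) show ?case unfolding sum.infinite[OF infinite(1)] by (rule ubdd_zero)
qed

end

text \<open>Decay enters with explicit constants; for a given process they come from
  \<open>bexp_A_mat_decay\<close> and \<open>bexp_Lambda_mat_decay\<close>.\<close>

locale iccss = ou_input M L p A X K c
  for M :: "'w measure" and L :: "real \<Rightarrow> 'w \<Rightarrow> real^'k::finite" and p :: nat and A :: "nat \<Rightarrow> real^'k^'k"
    and X :: "real \<Rightarrow> 'w \<Rightarrow> nat \<Rightarrow> real^'k" and K c :: real +
  fixes q :: nat and C :: "nat \<Rightarrow> real^'k^'k" and Kq cq :: real
  assumes q_pos: "0 < q" and qp: "q < p"
    and C_inv: "matrix_inv (C q) ** C q = mat 1"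
    and cq_pos: "0 < cq" and Kq_nonneg: "0 \<le> Kq"
    and decay_q: "\<And>x i j. 0 \<le> x \<Longrightarrow> i \<in> {1..q} \<Longrightarrow> j \<in> {1..q} \<Longrightarrow> norm (bexp q (Lambda_mat q C) x i j) \<le> Kq * exp (- cq * x)"
begin

abbreviation "E \<equiv> bexp q (Lambda_mat q C)"
abbreviation "Ci \<equiv> matrix_inv (C q)"

text \<open>Since \<open>X_j' = X_{j+1}\<close> in mean square only for \<open>j < p\<close>, this is the \<open>m\<close>-th derivative of \<open>Y\<close> only if
  \<open>m + q < p\<close>.\<close>

definition YD :: "nat \<Rightarrow> real \<Rightarrow> 'w \<Rightarrow> real^'k" where
  "YD m t \<omega> = (\<Sum>j=0..q. C j *v X t \<omega> (j + 1 + m))"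

abbreviation "Y \<equiv> output_process p q C X"

lemma Y_YD: "Y = YD 0"
proof (intro ext)
  fix t \<omega>
  have "Y t \<omega> = (\<Sum>j\<in>{1..q + 1}. C (j - 1) *v X t \<omega> j)"
    unfolding output_process_def using qp
    by (intro sum.mono_neutral_cong_right) (auto simp: C_mat_def)
  also have "\<dots> = YD 0 t \<omega>" unfolding YD_def
    by (rule sum.reindex_bij_witness[of _ Suc "\<lambda>j. j - 1"]) auto
  finally show "Y t \<omega> = YD 0 t \<omega>" .
qed

lemma X_ubdd:
  assumes "j \<in> {1..p}"
  shows "ubdd (\<lambda>u \<omega>. X u \<omega> j)"
  unfolding ubdd_def
proof (intro conjI allI exI[of _ X_const])
  show "(\<lambda>\<omega>. X u \<omega> j) \<in> borel_measurable M" for u using X_L2[OF assms] by auto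
qed (rule X_const_finite, rule X_bound[OF assms])

lemma YD_ubdd: "m + q < p \<Longrightarrow> ubdd (YD m)"
  unfolding YD_def[abs_def]
  by (intro ubdd_sum ubdd_linear[OF matrix_vector_mul_bounded_linear] X_ubdd) auto

lemma YD_L2: "m + q < p \<Longrightarrow> L2_rv M (YD m t)"
  using YD_ubdd[of m] unfolding ubdd_def L2_rv_msq by (auto intro: le_less_trans)

lemma X_joint: "j \<in> {1..p} \<Longrightarrow> (\<lambda>(t, \<omega>). X t \<omega> j) \<in> borel_measurable (lborel \<Otimes>\<^sub>M M)"
  using input unfolding input_process_def by blast

lemma YD_joint:
  assumes "m + q < p"
  shows "(\<lambda>(t, \<omega>). YD m t \<omega>) \<in> borel_measurable (lborel \<Otimes>\<^sub>M M)"
proof -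
  have mv: "(\<lambda>x. G *v x) \<in> borel_measurable borel" for G :: "real^'k^'k"
    by (rule borel_measurable_continuous_onI[OF linear_continuous_on[OF matrix_vector_mul_bounded_linear]])
  have "(\<lambda>z. \<Sum>j=0..q. C j *v (\<lambda>(t, \<omega>). X t \<omega> (j + 1 + m)) z) \<in> borel_measurable (lborel \<Otimes>\<^sub>M M)"
    by (intro borel_measurable_sum measurable_compose[OF X_joint mv]) (use assms in auto)
  then show ?thesis by (simp add: YD_def case_prod_unfold)
qed

lemma YD_deriv:
  assumes "Suc m + q < p"
  shows "L2_tendsto M (at 0) (\<lambda>d \<omega>. (YD m (t + d) \<omega> - YD m t \<omega>) /\<^sub>R d) (YD (Suc m) t)"
proof -
  have Xm: "(\<lambda>\<omega>. X u \<omega> j) \<in> borel_measurable M" if "j \<in> {1..p}" for u j using X_L2[OF that] by auto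
  have quot: "(YD m (t + d) \<omega> - YD m t \<omega>) /\<^sub>R d = (\<Sum>j=0..q. C j *v ((X (t + d) \<omega> (j + 1 + m) - X t \<omega> (j + 1 + m)) /\<^sub>R d))" for d \<omega>
    unfolding YD_def
    by (simp add: matrix_vector_mult_diff_distrib matrix_vector_mult_scaleR sum_subtractf scaleR_sum_right
        scaleR_diff_right)
  have "YD (Suc m) t = (\<lambda>\<omega>. \<Sum>j=0..q. C j *v X t \<omega> ((j + 1 + m) + 1))" by (simp add: YD_def fun_eq_iff)
  then show ?thesis unfolding quot
  proof (simp only:, intro L2_tendsto_sum)
    fix j assume j: "j \<in> {0..q}"
    have jp: "1 \<le> j + 1 + m" "j + 1 + m < p" "j + 1 + m \<in> {1..p}" "j + 1 + m + 1 \<in> {1..p}" using j assms by auto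
    note [measurable] = Xm[OF jp(3)] Xm[OF jp(4)]
    have mv [measurable]: "(\<lambda>x. C j *v x) \<in> borel_measurable borel"
      by (rule borel_measurable_continuous_onI[OF linear_continuous_on[OF matrix_vector_mul_bounded_linear]])
    show "L2_tendsto M (at 0) (\<lambda>d \<omega>. C j *v ((X (t + d) \<omega> (j + 1 + m) - X t \<omega> (j + 1 + m)) /\<^sub>R d))
        (\<lambda>\<omega>. C j *v X t \<omega> (j + 1 + m + 1))"
      by (rule L2_tendsto_linear[OF matrix_vector_mul_bounded_linear X_ms_deriv[OF jp(1,2)]]) measurable
    show "(\<lambda>\<omega>. C j *v ((X (t + d) \<omega> (j + 1 + m) - X t \<omega> (j + 1 + m)) /\<^sub>R d)) \<in> borel_measurable M" for d
      by measurable
    show "(\<lambda>\<omega>. C j *v X t \<omega> (j + 1 + m + 1)) \<in> borel_measurable M" by measurable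
  qed
qed

definition cY :: "'k \<Rightarrow> nat \<Rightarrow> real \<Rightarrow> 'w \<Rightarrow> complex" where
  "cY v m t \<omega> = complex_of_real (YD m t \<omega> $ v)"

lemma coord_cY: "coord Y v = cY v 0"
  by (simp add: fun_eq_iff coord_def cY_def Y_YD)

lemma bounded_linear_coord: "bounded_linear (\<lambda>x :: real^'k. complex_of_real (x $ v))"
  by (rule bounded_linear_compose[OF bounded_linear_of_real bounded_linear_vec_nth])

lemma cY_L2: "m + q < p \<Longrightarrow> L2_rv M (cY v m t)"
  unfolding cY_def[abs_def] by (rule L2_rv_linear[OF bounded_linear_coord YD_L2])

lemma coord_L2: "L2_rv M (coord Y v t)"
  unfolding coord_cY by (rule cY_L2) (use qp in simp)

lemma cY_deriv:
  assumes "Suc m + q < p"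
  shows "L2_tendsto M (at 0) (\<lambda>d \<omega>. (cY v m (t + d) \<omega> - cY v m t \<omega>) /\<^sub>R d) (cY v (Suc m) t)"
proof -
  have m: "m + q < p" using assms by simp
  note [measurable] = YD_L2[OF m, THEN L2_rv_measurable] YD_L2[OF assms, THEN L2_rv_measurable]
  have "L2_tendsto M (at 0) (\<lambda>d \<omega>. complex_of_real (((YD m (t + d) \<omega> - YD m t \<omega>) /\<^sub>R d) $ v)) (\<lambda>\<omega>. complex_of_real (YD (Suc m) t \<omega> $ v))"
    by (rule L2_tendsto_linear[OF bounded_linear_coord YD_deriv[OF assms]]) measurable
  moreover have "complex_of_real (((YD m (t + d) \<omega> - YD m t \<omega>) /\<^sub>R d) $ v) = (cY v m (t + d) \<omega> - cY v m t \<omega>) /\<^sub>R d" for d \<omega>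
    by (simp add: cY_def scaleR_conv_of_real[where 'a=complex])
  ultimately show ?thesis by (simp add: cY_def[abs_def])
qed

text \<open>Induction on \<open>m\<close>, for all times simultaneously in the hypothesis: the
  difference quotient of the chosen derivatives agrees almost surely with that of
  \<open>cY v m\<close>, so both have the same limits in mean square.\<close>

lemma ms_deriv_Y:
  assumes "m + q < p"
  shows "ms_deriv M m (coord Y v) t \<in> borel_measurable M \<and> (AE \<omega> in M. ms_deriv M m (coord Y v) t \<omega> = cY v m t \<omega>)"
  using assms
proof (induction m arbitrary: t)
  case 0
  then show ?case using cY_L2[of 0 v t] by (auto simp: coord_cY)
next
  case (Suc m)
  then have m: "m + q < p" by simp
  let ?D = "ms_deriv M m (coord Y v)"
  have Dm: "?D u \<in> borel_measurable M" and De: "AE \<omega> in M. ?D u \<omega> = cY v m u \<omega>" for u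
    using Suc.IH[OF m, of u] by (rule conjunct1, rule conjunct2)
  have cm: "cY v (Suc m) t \<in> borel_measurable M" using cY_L2[OF Suc.prems] by auto
  have cong: "L2_tendsto M (at 0) (\<lambda>d \<omega>. (?D (t + d) \<omega> - ?D t \<omega>) /\<^sub>R d) W
      \<longleftrightarrow> L2_tendsto M (at 0) (\<lambda>d \<omega>. (cY v m (t + d) \<omega> - cY v m t \<omega>) /\<^sub>R d) W" for W
  proof (rule L2_tendsto_cong_AE)
    fix d
    show "AE \<omega> in M. (?D (t + d) \<omega> - ?D t \<omega>) /\<^sub>R d = (cY v m (t + d) \<omega> - cY v m t \<omega>) /\<^sub>R d"
      using De[of "t + d"] De[of t] by eventually_elim simp
  qed simp
  let ?P = "\<lambda>W. W \<in> borel_measurable M \<and> L2_tendsto M (at 0) (\<lambda>d \<omega>. (?D (t + d) \<omega> - ?D t \<omega>) /\<^sub>R d) W"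
  have "?P (cY v (Suc m) t)" using cm cY_deriv[OF Suc.prems] cong by simp
  then have ex: "\<exists>W. ?P W" by (rule exI[of ?P])
  have "?P (SOME W. ?P W)" by (rule someI_ex[OF ex])
  moreover have "(SOME W. ?P W) = ms_deriv M (Suc m) (coord Y v) t" by simp
  ultimately have S: "ms_deriv M (Suc m) (coord Y v) t \<in> borel_measurable M"
    "L2_tendsto M (at 0) (\<lambda>d \<omega>. (cY v m (t + d) \<omega> - cY v m t \<omega>) /\<^sub>R d) (ms_deriv M (Suc m) (coord Y v) t)"
    unfolding cong by (simp_all only:)
  have "AE \<omega> in M. ms_deriv M (Suc m) (coord Y v) t \<omega> = cY v (Suc m) t \<omega>"
  proof (rule L2_tendsto_unique[OF S(2) cY_deriv[OF Suc.prems]])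
    show "(\<lambda>\<omega>. (cY v m (t + d) \<omega> - cY v m t \<omega>) /\<^sub>R d) \<in> borel_measurable M" for d
      using cY_L2[OF m, THEN L2_rv_measurable] by measurable
  qed (use S cm in simp_all)
  with S(1) show ?case by blast
qed

section \<open>Membership in the closed span of the past\<close>

lemma L_space_mono:
  assumes "s \<le> t"
  shows "L_space M Y S s \<subseteq> L_space M Y S t"
proof -
  have "lin_space Y S s \<subseteq> lin_space Y S t"
  proof
    fix U assume "U \<in> lin_space Y S s"
    then obtain F d where F: "finite F" "F \<subseteq> S \<times> {..s}" "U = (\<lambda>\<omega>. \<Sum>(v, r)\<in>F. d (v, r) * coord Y v r \<omega>)"
      unfolding lin_space_def by blast
    from F(2) assms have "F \<subseteq> S \<times> {..t}" by auto
    with F show "U \<in> lin_space Y S t" by (intro lin_spaceI[where F=F and c=d])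
  qed
  then show ?thesis unfolding L_space_def by blast
qed

lemmas L_subspace = L2_subspace_L_space[of M Y, OF coord_L2]

lemma coord_in_L_space: "v \<in> S \<Longrightarrow> r \<le> t \<Longrightarrow> coord Y v r \<in> L_space M Y S t"
  by (intro lin_space_in_L_space coord_L2 lin_space_generator)

lemma cY_in_L_space:
  assumes "m + q < p" "v \<in> S"
  shows "cY v m t \<in> L_space M Y S t"
  using assms(1)
proof (induction m arbitrary: t)
  case 0
  show ?case using coord_in_L_space[OF assms(2) order_refl, of t] by (simp add: coord_cY)
next
  case (Suc m)
  \<comment> \<open>Negative increments: left difference quotients involve only values of the output
    up to time \<open>t\<close>, so the derivative stays in the span of the past.\<close>
  define d where "d n = - (1 / (real n + 1))" for n :: nat
  have d: "filterlim d (at 0) sequentially"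
    unfolding filterlim_at using tendsto_minus[OF inverse_Suc_tendsto] by (auto simp: d_def[abs_def])
  have lim: "L2_tendsto M sequentially (\<lambda>n \<omega>. (cY v m (t + d n) \<omega> - cY v m t \<omega>) /\<^sub>R d n) (cY v (Suc m) t)"
    by (rule L2_tendsto_filter[OF cY_deriv[OF Suc.prems] d])
  have mem: "(\<lambda>\<omega>. (cY v m (t + d n) \<omega> - cY v m t \<omega>) /\<^sub>R d n) \<in> L_space M Y S t" for n
  proof -
    have "cY v m (t + d n) \<in> L_space M Y S (t + d n)" "cY v m t \<in> L_space M Y S t"
      using Suc.prems by (intro Suc.IH; simp)+
    moreover have "L_space M Y S (t + d n) \<subseteq> L_space M Y S t" by (rule L_space_mono) (simp add: d_def)
    ultimately have "(\<lambda>\<omega>. cY v m (t + d n) \<omega> - cY v m t \<omega>) \<in> L_space M Y S t"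
      by (intro L2_subspace_diff[OF L_subspace]) auto
    from L2_subspaceD(4)[OF L_subspace this, of "of_real (inverse (d n))"]
    show ?thesis by (simp add: scaleR_conv_of_real)
  qed
  show ?case by (rule L2_subspaceD(5)[OF L_subspace mem lim cY_L2[OF Suc.prems]])
qed

lemma ms_deriv_in_L_space:
  assumes "m + q < p" "v \<in> S"
  shows "ms_deriv M m (coord Y v) t \<in> L_space M Y S t"
proof (rule L2_subspace_AE[OF L_subspace cY_in_L_space[OF assms]])
  show "ms_deriv M m (coord Y v) t \<in> borel_measurable M" using ms_deriv_Y[OF assms(1)] by blast
  show "AE \<omega> in M. cY v m t \<omega> = ms_deriv M m (coord Y v) t \<omega>"
    using ms_deriv_Y[OF assms(1), of v t] by (auto elim: eventually_mono)
qed

text \<open>Multiplication by \<open>Lambda_mat\<close> shifts a sequence of blocks by one; only the last block needs the output.\<close>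

lemma Lambda_step:
  assumes r: "r \<in> {1..q}"
  shows "(\<Sum>l=1..q. Lambda_mat q C r l *v y l)
    = y (r + 1) - (if r = q then Ci *v (\<Sum>j=0..q. C j *v y (j + 1)) else 0)"
proof (cases "r = q")
  case False
  then have "(\<Sum>l=1..q. Lambda_mat q C r l *v y l) = (\<Sum>l=1..q. if l = r + 1 then y l else 0)"
    using r by (intro sum.cong) (auto simp: Lambda_mat_def)
  also have "\<dots> = y (r + 1)" using r False by simp
  finally show ?thesis using False by simp
next
  case True
  have "(\<Sum>j=0..q. C j *v y (j + 1)) = C q *v y (q + 1) + (\<Sum>j=0..<q. C j *v y (j + 1))"
    by (simp add: atLeastLessThanSuc_atLeastAtMost[symmetric] add.commute)
  also have "(\<Sum>j=0..<q. C j *v y (j + 1)) = (\<Sum>l=1..q. C (l - 1) *v y l)"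
    by (rule sum.reindex_bij_witness[of _ "\<lambda>l. l - 1" Suc]) auto
  finally have "Ci *v (\<Sum>j=0..q. C j *v y (j + 1)) = y (q + 1) + Ci *v (\<Sum>l=1..q. C (l - 1) *v y l)"
    by (simp add: matrix_vector_right_distrib matrix_vector_mul_assoc C_inv)
  moreover have "(\<Sum>l=1..q. Lambda_mat q C r l *v y l) = - (Ci *v (\<Sum>l=1..q. C (l - 1) *v y l))"
    unfolding linear_sum[OF matrix_vector_mul_linear] sum_negf[symmetric] using True
    by (intro sum.cong) (simp_all add: Lambda_mat_def matrix_vector_mul_assoc matrix_vector_mult_minus)
  ultimately show ?thesis using True by simp
qed

text \<open>\<open>kap \<mu> v x\<close> is \<open>\<mu>\<^sup>T exp (\<Lambda> x) \<Theta> e_v\<close> for the block column \<open>\<mu>\<close>.\<close>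

definition kap :: "(nat \<Rightarrow> real^'k) \<Rightarrow> 'k \<Rightarrow> real \<Rightarrow> real" where
  "kap \<mu> v x = (\<Sum>i=1..q. \<Sum>b\<in>UNIV. \<mu> i $ b * (E x i q ** Ci) $ b $ v)"

definition kk :: "(nat \<Rightarrow> real^'k) \<Rightarrow> 'k \<Rightarrow> real \<Rightarrow> real \<Rightarrow> real" where
  "kk \<mu> v t u = indicator {..t} u * kap \<mu> v (t - u)"

section \<open>Integrals of the output against the decaying kernel\<close>

lemma E_continuous: "i \<in> {1..q} \<Longrightarrow> continuous_on UNIV (\<lambda>x. E x i j)"
  by (intro continuous_at_imp_continuous_on ballI has_vector_derivative_continuous[OF bexp_deriv_left])

lemma E_integrable:
  assumes i: "i \<in> {1..q}"
  shows "integrable lborel (\<lambda>u. indicator {..t} u * E (t - u) i q $ b $ d)"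
proof (rule Bochner_Integration.integrable_bound)
  have "integrable lborel (\<lambda>x. Kq * (indicator {0..} x * exp (- cq * x)))"
    by (intro integrable_mult_right exp_tail_integrable cq_pos)
  from lborel_integrable_real_affine[OF this, of "- 1" t]
  show "integrable lborel (\<lambda>u. Kq * (indicator {0..} (t - u) * exp (- cq * (t - u))))" by simp
  have "continuous_on UNIV (\<lambda>u. E (t - u) i q $ b $ d)"
    by (intro continuous_intros continuous_on_compose2[OF E_continuous[OF i]]) auto
  then have "(\<lambda>u. E (t - u) i q $ b $ d) \<in> borel_measurable borel" by (rule borel_measurable_continuous_onI)
  then show "(\<lambda>u. indicator {..t} u * E (t - u) i q $ b $ d) \<in> borel_measurable lborel" by measurable
  show "AE u in lborel. norm (indicator {..t} u * E (t - u) i q $ b $ d) \<le> norm (Kq * (indicator {0..} (t - u) * exp (- cq * (t - u))))"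
  proof (rule AE_I2)
    fix u
    show "norm (indicator {..t} u * E (t - u) i q $ b $ d) \<le> norm (Kq * (indicator {0..} (t - u) * exp (- cq * (t - u))))"
    proof (cases "u \<le> t")
      case True
      have "\<bar>E (t - u) i q $ b $ d\<bar> \<le> norm (E (t - u) i q $ b)" by (rule component_le_norm_cart)
      also have "\<dots> \<le> norm (E (t - u) i q)" by (rule Finite_Cartesian_Product.norm_nth_le)
      also have "\<dots> \<le> Kq * exp (- cq * (t - u))" using True i q_pos by (intro decay_q) auto
      finally show ?thesis using True Kq_nonneg by simp
    qed simp
  qed
qed

lemma kk_integrable: "integrable lborel (kk \<mu> v t)"
proof -
  have "kk \<mu> v t = (\<lambda>u. \<Sum>i=1..q. \<Sum>b\<in>UNIV. \<Sum>d\<in>UNIV. \<mu> i $ b * Ci $ d $ v * (indicator {..t} u * E (t - u) i q $ b $ d))"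
    by (simp add: fun_eq_iff kk_def kap_def matrix_matrix_mult_def sum_distrib_left mult_ac)
  moreover have "integrable lborel \<dots>"
    by (intro Bochner_Integration.integrable_sum integrable_mult_right E_integrable)
  ultimately show ?thesis by simp
qed

lemma Y_process:
  "\<exists>B. bounded_L2_process M (\<lambda>u \<omega>. YD 0 u \<omega> $ v) B"
  "\<exists>B. bounded_L2_process M (coord Y v) B"
proof -
  have qp0: "0 + q < p" using qp by simp
  have "ubdd (\<lambda>u \<omega>. YD 0 u \<omega> $ v)" by (rule ubdd_linear[OF bounded_linear_vec_nth YD_ubdd[OF qp0]])
  then obtain B where B: "B < \<infinity>" "\<And>u. msq M (\<lambda>\<omega>. YD 0 u \<omega> $ v) \<le> B" unfolding ubdd_def by blast
  have "(\<lambda>z. (\<lambda>(t, \<omega>). YD 0 t \<omega>) z $ v) \<in> borel_measurable (lborel \<Otimes>\<^sub>M M)"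
    by (rule measurable_compose[OF YD_joint[OF qp0] borel_measurable_continuous_onI[OF linear_continuous_on[OF bounded_linear_vec_nth]]])
  then have j1: "(\<lambda>(t, \<omega>). YD 0 t \<omega> $ v) \<in> borel_measurable (lborel \<Otimes>\<^sub>M M)" by (simp add: case_prod_unfold)
  then have "(\<lambda>z. complex_of_real ((\<lambda>(t, \<omega>). YD 0 t \<omega> $ v) z)) \<in> borel_measurable (lborel \<Otimes>\<^sub>M M)" by measurable
  then have j2: "(\<lambda>(t, \<omega>). coord Y v t \<omega>) \<in> borel_measurable (lborel \<Otimes>\<^sub>M M)"
    by (simp add: case_prod_unfold coord_cY cY_def)
  have "msq M (coord Y v u) = msq M (\<lambda>\<omega>. YD 0 u \<omega> $ v)" for u
    by (simp add: msq_def coord_cY cY_def)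
  then have "bounded_L2_process M (coord Y v) B"
    using B j2 by unfold_locales simp_all
  then show "\<exists>B. bounded_L2_process M (coord Y v) B" by blast
  have "bounded_L2_process M (\<lambda>u \<omega>. YD 0 u \<omega> $ v) B"
    using B j1 by unfold_locales simp_all
  then show "\<exists>B. bounded_L2_process M (\<lambda>u \<omega>. YD 0 u \<omega> $ v) B" by blast
qed

definition J :: "(nat \<Rightarrow> real^'k) \<Rightarrow> real \<Rightarrow> 'k \<Rightarrow> 'w \<Rightarrow> real" where
  "J \<mu> t v \<omega> = (LINT u|lborel. kk \<mu> v t u * YD 0 u \<omega> $ v)"

lemma J_L2: "L2_rv M (J \<mu> t v)"
  and J_pairing: "L2_rv M W \<Longrightarrow> (LINT \<omega>|M. J \<mu> t v \<omega> * W \<omega>) = (LINT u|lborel. kk \<mu> v t u * (LINT \<omega>|M. YD 0 u \<omega> $ v * W \<omega>))"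
  and J_integrable: "L2_rv M W \<Longrightarrow> integrable lborel (\<lambda>u. kk \<mu> v t u * (LINT \<omega>|M. YD 0 u \<omega> $ v * W \<omega>))"
proof -
  obtain B where "bounded_L2_process M (\<lambda>u \<omega>. YD 0 u \<omega> $ v) B" using Y_process(1) by blast
  then interpret P: bounded_L2_process M "\<lambda>u \<omega>. YD 0 u \<omega> $ v" B .
  have J: "J \<mu> t v = P.KI (kk \<mu> v t)" by (simp add: fun_eq_iff J_def P.KI_def)
  show "L2_rv M (J \<mu> t v)" unfolding J by (rule P.KI_L2[OF kk_integrable])
  assume W: "L2_rv M W"
  show "(LINT \<omega>|M. J \<mu> t v \<omega> * W \<omega>) = (LINT u|lborel. kk \<mu> v t u * (LINT \<omega>|M. YD 0 u \<omega> $ v * W \<omega>))"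
    using P.KI_pairing(1)[OF kk_integrable W, of \<mu> v t] unfolding J by simp
  show "integrable lborel (\<lambda>u. kk \<mu> v t u * (LINT \<omega>|M. YD 0 u \<omega> $ v * W \<omega>))"
    using P.KI_pairing(2)[OF kk_integrable W, of \<mu> v t] by simp
qed

text \<open>Connects the chosen improper integral with the concrete pathwise integral
  \<open>J\<close>, and puts it into the span of the past: the kernel \<open>kk\<close> vanishes
  after \<open>t\<close>, so only values of the output up to \<open>t\<close> contribute.\<close>

lemma integral_upto_Y:
  assumes F: "\<And>u \<omega>. F u \<omega> = of_real (kap \<mu> v (t - u)) * coord Y v u \<omega>"
  shows "integral_upto M t F \<in> borel_measurable M"
    and "AE \<omega> in M. integral_upto M t F \<omega> = of_real (J \<mu> t v \<omega>)"
    and "v \<in> S \<Longrightarrow> integral_upto M t F \<in> L_space M Y S t"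
proof -
  obtain B where P: "bounded_L2_process M (coord Y v) B" using Y_process(2) by blast
  interpret P: bounded_L2_process M "coord Y v" B by (rule P)
  have KI: "P.KI (kk \<mu> v t) \<omega> = of_real (J \<mu> t v \<omega>)" for \<omega>
  proof -
    have "P.KI (kk \<mu> v t) \<omega> = (LINT u|lborel. complex_of_real (kk \<mu> v t u * YD 0 u \<omega> $ v))"
      unfolding P.KI_def by (simp add: coord_cY cY_def scaleR_conv_of_real)
    then show ?thesis unfolding J_def by (simp only: integral_complex_of_real)
  qed
  have supp: "kk \<mu> v t u = 0" if "t < u" for u using that by (simp add: kk_def)
  have Fk: "F u \<omega> = kk \<mu> v t u *\<^sub>R coord Y v u \<omega>" if "u \<le> t" for u \<omega>
    using that by (simp add: F kk_def scaleR_conv_of_real)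
  note U = integral_upto_kernel[where t=t and F=F and k="kk \<mu> v t", OF P kk_integrable supp Fk]
  show m: "integral_upto M t F \<in> borel_measurable M" by (rule U(1))
  show ae: "AE \<omega> in M. integral_upto M t F \<omega> = of_real (J \<mu> t v \<omega>)" using U(2) unfolding KI .
  assume v: "v \<in> S"
  have "P.KI (kk \<mu> v t) \<in> L_space M Y S t"
  proof (rule KI_in_subspace[OF P kk_integrable L_subspace])
    fix u assume "kk \<mu> v t u \<noteq> 0"
    then have "u \<le> t" using supp[of u] by (auto simp: not_less[symmetric])
    then show "coord Y v u \<in> L_space M Y S t" by (rule coord_in_L_space[OF v])
  qed
  then show "integral_upto M t F \<in> L_space M Y S t"
    by (rule L2_subspace_AE[OF L_subspace _ m]) (use U(2) in \<open>auto elim: eventually_mono\<close>)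
qed

end

section \<open>Inversion of the state equation\<close>

lemma ennreal_sq_bound:
  assumes "ennreal (r\<^sup>2) \<le> B" "B < \<infinity>"
  shows "\<bar>r\<bar> \<le> sqrt (enn2real B)"
proof -
  have "r\<^sup>2 \<le> enn2real B" using assms enn2real_mono[of "ennreal (r\<^sup>2)" B] by simp
  then have "sqrt (r\<^sup>2) \<le> sqrt (enn2real B)" by (rule real_sqrt_le_mono)
  then show ?thesis by simp
qed

context iccss
begin

context
  fixes W :: "'w \<Rightarrow> real"
  assumes W: "L2_rv M W"
begin

text \<open>Testing against a fixed \<open>W\<close> turns the mean-square differential equation into one for deterministic
  functions.\<close>

definition corr :: "nat \<Rightarrow> real \<Rightarrow> real^'k" where
  "corr j u = (\<chi> a. LINT \<omega>|M. X u \<omega> j $ a * W \<omega>)"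

lemma X_component_L2: "j \<in> {1..p} \<Longrightarrow> L2_rv M (\<lambda>\<omega>. X u \<omega> j $ a)"
  by (rule L2_rv_linear[OF bounded_linear_vec_nth X_L2])

text \<open>The pairing with \<open>W\<close> is continuous in mean square, so it turns the limit of
  the difference quotients of \<open>X\<close> into a derivative in the classical sense.\<close>

lemma corr_deriv:
  assumes j: "1 \<le> j" "j < p"
  shows "(corr j has_vector_derivative corr (j + 1) u) (at u)"
proof (rule has_vector_derivative_vecI)
  fix a
  have jp: "j \<in> {1..p}" "j + 1 \<in> {1..p}" using j by auto
  note [measurable] = X_L2[OF jp(1), THEN L2_rv_measurable] X_L2[OF jp(2), THEN L2_rv_measurable]
  have lim: "L2_tendsto M (at 0) (\<lambda>d \<omega>. ((X (u + d) \<omega> j - X u \<omega> j) /\<^sub>R d) $ a) (\<lambda>\<omega>. X u \<omega> (j + 1) $ a)"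
    by (rule L2_tendsto_linear[OF bounded_linear_vec_nth X_ms_deriv[OF j]]) measurable
  have quot: "((X (u + d) \<omega> j - X u \<omega> j) /\<^sub>R d) $ a = inverse d * (X (u + d) \<omega> j $ a - X u \<omega> j $ a)" for d \<omega>
    by simp
  have L2q: "L2_rv M (\<lambda>\<omega>. inverse d * (X (u + d) \<omega> j $ a - X u \<omega> j $ a))" for d
    by (intro L2_rv_cmult L2_rv_diff X_component_L2 jp)
  have "((\<lambda>d. LINT \<omega>|M. inverse d * (X (u + d) \<omega> j $ a - X u \<omega> j $ a) * W \<omega>) \<longlongrightarrow> (LINT \<omega>|M. X u \<omega> (j + 1) $ a * W \<omega>)) (at 0)"
    by (rule L2_tendsto_inner[OF lim[unfolded quot] L2q X_component_L2[OF jp(2)] W])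
  moreover have "(LINT \<omega>|M. inverse d * (X (u + d) \<omega> j $ a - X u \<omega> j $ a) * W \<omega>) = (corr j (u + d) $ a - corr j u $ a) / d" for d
  proof -
    have "(LINT \<omega>|M. inverse d * (X (u + d) \<omega> j $ a - X u \<omega> j $ a) * W \<omega>)
        = (LINT \<omega>|M. inverse d * (X (u + d) \<omega> j $ a * W \<omega> - X u \<omega> j $ a * W \<omega>))"
      by (simp add: algebra_simps)
    also have "\<dots> = inverse d * (corr j (u + d) $ a - corr j u $ a)"
      unfolding corr_def vec_lambda_beta
      by (simp add: L2_Cauchy_Schwarz(1)[OF X_component_L2[OF jp(1)] W])
    finally show ?thesis by (simp add: divide_inverse mult.commute)
  qed
  ultimately have "((\<lambda>d. (corr j (u + d) $ a - corr j u $ a) / d) \<longlongrightarrow> corr (j + 1) u $ a) (at 0)"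
    by (simp add: corr_def[of "Suc j"])
  then show "((\<lambda>x. corr j x $ a) has_vector_derivative corr (j + 1) u $ a) (at u)"
    unfolding has_real_derivative_iff_has_vector_derivative[symmetric] DERIV_def .
qed

lemma corr_bound: "\<exists>D\<ge>0. \<forall>j\<in>{1..p}. \<forall>u. norm (corr j u) \<le> D"
proof -
  let ?B = "X_const * msq M W"
  have B: "?B < \<infinity>" using X_const_finite W by (simp add: L2_rv_msq ennreal_mult_less_top)
  have "norm (corr j u) \<le> real CARD('k) * sqrt (enn2real ?B)" if j: "j \<in> {1..p}" for j u
  proof -
    have "\<bar>corr j u $ a\<bar> \<le> sqrt (enn2real ?B)" for a
    proof (rule ennreal_sq_bound[OF _ B])
      have "ennreal ((norm (LINT \<omega>|M. X u \<omega> j $ a * W \<omega>))\<^sup>2) \<le> msq M (\<lambda>\<omega>. X u \<omega> j $ a) * msq M W"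
        by (rule L2_Cauchy_Schwarz(2)[OF X_component_L2[OF j] W])
      also have "\<dots> \<le> X_const * msq M W"
      proof (rule mult_right_mono)
        have "msq M (\<lambda>\<omega>. X u \<omega> j $ a) \<le> ennreal (1\<^sup>2) * msq M (\<lambda>\<omega>. X u \<omega> j)"
          using X_L2[OF j, of u] by (intro msq_bound) (auto simp: component_le_norm_cart)
        also have "\<dots> \<le> X_const" using X_bound[OF j, of u] by simp
        finally show "msq M (\<lambda>\<omega>. X u \<omega> j $ a) \<le> X_const" .
      qed simp
      finally show "ennreal ((corr j u $ a)\<^sup>2) \<le> ?B" by (simp add: corr_def)
    qed
    then have "(\<Sum>a\<in>UNIV. \<bar>corr j u $ a\<bar>) \<le> (\<Sum>a\<in>(UNIV :: 'k set). sqrt (enn2real ?B))" by (intro sum_mono)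
    with norm_le_l1_cart[of "corr j u"] show ?thesis by simp
  qed
  then show ?thesis by (intro exI[of _ "real CARD('k) * sqrt (enn2real ?B)"]) auto
qed

definition corrY :: "real \<Rightarrow> real^'k" where
  "corrY u = (\<Sum>j=0..q. C j *v corr (j + 1) u)"

lemma corrY_component: "corrY u $ v = (LINT \<omega>|M. YD 0 u \<omega> $ v * W \<omega>)"
proof -
  have int: "integrable M (\<lambda>\<omega>. X u \<omega> (j + 1) $ a * W \<omega>)" if "j \<in> {0..q}" for j a
    by (rule L2_Cauchy_Schwarz(1)[OF X_component_L2 W]) (use that qp in auto)
  have "(LINT \<omega>|M. YD 0 u \<omega> $ v * W \<omega>) = (LINT \<omega>|M. (\<Sum>j=0..q. \<Sum>a\<in>UNIV. C j $ v $ a * (X u \<omega> (j + 1) $ a * W \<omega>)))"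
    by (intro Bochner_Integration.integral_cong refl)
      (simp add: YD_def sum_component matrix_vector_mult_def sum_distrib_right mult.assoc)
  also have "\<dots> = (\<Sum>j=0..q. \<Sum>a\<in>UNIV. C j $ v $ a * (LINT \<omega>|M. X u \<omega> (j + 1) $ a * W \<omega>))"
    by (subst Bochner_Integration.integral_sum, intro Bochner_Integration.integrable_sum integrable_mult_right int, assumption,
        intro sum.cong refl, subst Bochner_Integration.integral_sum, intro integrable_mult_right int, assumption,
        intro sum.cong refl integral_mult_right_zero)
  finally show ?thesis by (simp add: corrY_def corr_def sum_component matrix_vector_mult_def)
qed

text \<open>The quantity used in variation of constants:
  \<open>\<mu>\<^sup>T exp (\<Lambda> (t - u))\<close> applied to the first \<open>q\<close> blocks
  of \<open>corr\<close> at time \<open>u\<close>.\<close>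

definition Psi :: "(nat \<Rightarrow> real^'k) \<Rightarrow> real \<Rightarrow> real \<Rightarrow> real" where
  "Psi \<mu> t u = (\<Sum>i=1..q. \<mu> i \<bullet> (\<Sum>l=1..q. E (t - u) i l *v corr l u))"

text \<open>The product rule yields two sums that differ by an index shift.
  \<open>Lambda_step\<close> makes them cancel except for the forcing term from the output. Since
  \<open>q < p\<close>, all blocks involved are differentiable.\<close>

lemma Psi_deriv: "(Psi \<mu> t has_vector_derivative (\<Sum>v\<in>UNIV. kap \<mu> v (t - u) * corrY u $ v)) (at u)"
proof -
  have dE: "((\<lambda>u. E (t - u) i l) has_vector_derivative - bmult q (E (t - u)) (Lambda_mat q C) i l) (at u)"
    if "i \<in> {1..q}" "l \<in> {1..q}" for i l
  proof -
    have "((\<lambda>u. t - u) has_vector_derivative - 1) (at u)"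
      unfolding has_real_derivative_iff_has_vector_derivative[symmetric] by (auto intro!: derivative_eq_intros)
    from vector_diff_chain_at[OF this bexp_deriv_right[OF that]] show ?thesis by (simp add: comp_def)
  qed
  have dprod: "((\<lambda>u. E (t - u) i l *v corr l u) has_vector_derivative
      (E (t - u) i l *v corr (l + 1) u + (- bmult q (E (t - u)) (Lambda_mat q C) i l) *v corr l u)) (at u)"
    if "i \<in> {1..q}" "l \<in> {1..q}" for i l
    by (rule bounded_bilinear.has_vector_derivative[OF bounded_bilinear_matrix_vector dE[OF that] corr_deriv])
      (use that qp in auto)
  have "(Psi \<mu> t has_vector_derivative (\<Sum>i=1..q. \<mu> i \<bullet> (\<Sum>l=1..q. E (t - u) i l *v corr (l + 1) u
      + (- bmult q (E (t - u)) (Lambda_mat q C) i l) *v corr l u))) (at u)"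
    unfolding Psi_def[abs_def]
    by (intro has_vector_derivative_sum bounded_linear.has_vector_derivative[OF bounded_linear_inner_right] dprod)
  moreover have "(\<Sum>i=1..q. \<mu> i \<bullet> (\<Sum>l=1..q. E (t - u) i l *v corr (l + 1) u
      + (- bmult q (E (t - u)) (Lambda_mat q C) i l) *v corr l u)) = (\<Sum>v\<in>UNIV. kap \<mu> v (t - u) * corrY u $ v)"
  proof -
    have inner: "(\<Sum>l=1..q. E (t - u) i l *v corr (l + 1) u + (- bmult q (E (t - u)) (Lambda_mat q C) i l) *v corr l u)
        = (E (t - u) i q ** Ci) *v corrY u" for i
    proof -
      let ?e = "\<lambda>r. E (t - u) i r"
      have "(\<Sum>l=1..q. bmult q (E (t - u)) (Lambda_mat q C) i l *v corr l u)
          = (\<Sum>l=1..q. \<Sum>r=1..q. ?e r *v (Lambda_mat q C r l *v corr l u))"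
        unfolding bmult_def sum_matrix_vector_mult by (simp add: matrix_vector_mul_assoc)
      also have "\<dots> = (\<Sum>r=1..q. ?e r *v (\<Sum>l=1..q. Lambda_mat q C r l *v corr l u))"
        by (subst sum.swap) (simp add: linear_sum[OF matrix_vector_mul_linear])
      also have "\<dots> = (\<Sum>r=1..q. ?e r *v corr (r + 1) u - (if r = q then ?e r *v (Ci *v corrY u) else 0))"
      proof (rule sum.cong[OF refl])
        fix r assume r: "r \<in> {1..q}"
        show "?e r *v (\<Sum>l=1..q. Lambda_mat q C r l *v corr l u)
            = ?e r *v corr (r + 1) u - (if r = q then ?e r *v (Ci *v corrY u) else 0)"
          unfolding Lambda_step[OF r] corrY_def by (simp add: matrix_vector_mult_diff_distrib)
      qed
      also have "\<dots> = (\<Sum>r=1..q. ?e r *v corr (r + 1) u) - ?e q *v (Ci *v corrY u)"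
        using q_pos by (simp add: sum_subtractf)
      finally show ?thesis
        by (simp add: matrix_vector_mult_minus sum_subtractf matrix_vector_mul_assoc)
    qed
    show ?thesis unfolding inner kap_def
      by (simp add: inner_vec_def matrix_vector_mult_def sum_distrib_left sum_distrib_right)
        (subst sum.swap, simp add: sum.swap[of _ UNIV "{Suc 0..q}"] mult.assoc)
  qed
  ultimately show ?thesis by simp
qed

lemma Psi_end: "Psi \<mu> t t = (\<Sum>i=1..q. \<mu> i \<bullet> corr i t)"
proof -
  have *: "(\<Sum>l=1..q. E 0 i l *v corr l t) = corr i t" if "i \<in> {1..q}" for i
  proof -
    have "(\<Sum>l=1..q. E 0 i l *v corr l t) = (\<Sum>l=1..q. if l = i then corr l t else 0)"
      using that by (intro sum.cong refl) (simp add: bexp_0 bid_def)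
    then show ?thesis using that by simp
  qed
  show ?thesis unfolding Psi_def diff_self by (rule sum.cong[OF refl]) (simp only: *)
qed

text \<open>The exponential decays while \<open>corr\<close> stays bounded, so the initial condition
  is forgotten in the remote past.\<close>

lemma Psi_vanishes: "(Psi \<mu> t \<longlongrightarrow> 0) at_bot"
proof -
  obtain D where D: "D \<ge> 0" "\<And>j u. j \<in> {1..p} \<Longrightarrow> norm (corr j u) \<le> D" using corr_bound by blast
  obtain B where B: "B > 0" "\<And>(G :: real^'k^'k) (x :: real^'k). norm (G *v x) \<le> norm G * norm x * B"
    using bounded_bilinear.pos_bounded[OF bounded_bilinear_matrix_vector] by blast
  define N where "N = (\<Sum>i=1..q. norm (\<mu> i) * (\<Sum>l=1..q. Kq * D * B))"
  have le: "norm (Psi \<mu> t s) \<le> N * exp (- cq * (t - s))" if s: "s \<le> t" for s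
  proof -
    have "norm (Psi \<mu> t s) \<le> (\<Sum>i=1..q. norm (\<mu> i) * (\<Sum>l=1..q. Kq * D * B * exp (- cq * (t - s))))"
      unfolding Psi_def
    proof (intro order_trans[OF norm_sum] sum_mono)
      fix i assume i: "i \<in> {1..q}"
      have "norm (\<Sum>l=1..q. E (t - s) i l *v corr l s) \<le> (\<Sum>l=1..q. Kq * D * B * exp (- cq * (t - s)))"
      proof (intro order_trans[OF norm_sum] sum_mono)
        fix l assume l: "l \<in> {1..q}"
        have "norm (E (t - s) i l *v corr l s) \<le> norm (E (t - s) i l) * norm (corr l s) * B" by (rule B(2))
        also have "\<dots> \<le> (Kq * exp (- cq * (t - s))) * D * B"
          using i l s qp B(1) Kq_nonneg by (intro mult_right_mono mult_mono decay_q D) auto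
        finally show "norm (E (t - s) i l *v corr l s) \<le> Kq * D * B * exp (- cq * (t - s))" by (simp add: mult_ac)
      qed
      then have "norm (\<mu> i) * norm (\<Sum>l=1..q. E (t - s) i l *v corr l s) \<le> norm (\<mu> i) * (\<Sum>l=1..q. Kq * D * B * exp (- cq * (t - s)))"
        by (intro mult_left_mono) auto
      with Cauchy_Schwarz_ineq2[of "\<mu> i" "\<Sum>l=1..q. E (t - s) i l *v corr l s"]
      show "norm (\<mu> i \<bullet> (\<Sum>l=1..q. E (t - s) i l *v corr l s)) \<le> norm (\<mu> i) * (\<Sum>l=1..q. Kq * D * B * exp (- cq * (t - s)))"
        by simp
    qed
    also have "\<dots> = N * exp (- cq * (t - s))" unfolding N_def by (simp add: sum_distrib_right mult.assoc)
    finally show ?thesis .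
  qed
  have "((\<lambda>s. N * exp (- cq * (t - s))) \<longlongrightarrow> N * 0) at_bot"
  proof (intro tendsto_mult tendsto_const filterlim_compose[OF exp_at_bot])
    have "LIM s at_top. cq * (t + s) :> at_top"
      by (intro filterlim_tendsto_pos_mult_at_top[OF tendsto_const cq_pos]
          filterlim_tendsto_add_at_top[OF tendsto_const] filterlim_ident)
    then show "LIM s at_bot. - cq * (t - s) :> at_bot"
      unfolding filterlim_at_bot_mirror filterlim_uminus_at_bot by simp
  qed
  then have "((\<lambda>s. N * exp (- cq * (t - s))) \<longlongrightarrow> 0) at_bot" by simp
  from Lim_null_comparison[OF eventually_mono[OF eventually_le_at_bot[of t] le] this] show ?thesis .
qed

text \<open>The fundamental theorem of calculus for \<open>Psi\<close> on \<open>[s, t]\<close>,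
  with \<open>s\<close> tending to minus infinity. The integral of the derivative converges since
  the kernel is integrable.\<close>

lemma corr_identity:
  "(\<Sum>i=1..q. \<mu> i \<bullet> corr i t) = (\<Sum>v\<in>UNIV. LINT \<omega>|M. J \<mu> t v \<omega> * W \<omega>)"
proof -
  define \<phi> where "\<phi> u = (\<Sum>v\<in>UNIV. kk \<mu> v t u * corrY u $ v)" for u
  have int_v: "integrable lborel (\<lambda>u. kk \<mu> v t u * corrY u $ v)" for v
    unfolding corrY_component by (rule J_integrable[OF W])
  have int: "integrable lborel \<phi>" unfolding \<phi>_def by (intro Bochner_Integration.integrable_sum int_v)
  have cut: "(LINT u|lborel. indicator {s..} u *\<^sub>R \<phi> u) = Psi \<mu> t t - Psi \<mu> t s" if "s \<le> t" for s
  proof -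
    have "((\<lambda>u. \<Sum>v\<in>UNIV. kap \<mu> v (t - u) * corrY u $ v) has_integral Psi \<mu> t t - Psi \<mu> t s) {s..t}"
      by (rule fundamental_theorem_of_calculus[OF that])
        (rule has_vector_derivative_at_within[OF Psi_deriv])
    then have hi: "(\<phi> has_integral Psi \<mu> t t - Psi \<mu> t s) {s..t}"
      by (rule has_integral_eq[rotated]) (simp add: \<phi>_def kk_def)
    have si: "set_integrable lborel {s..t} \<phi>"
      unfolding set_integrable_def by (rule integrable_mult_indicator[OF _ int]) simp
    have "(LINT u|lborel. indicator {s..} u *\<^sub>R \<phi> u) = (LINT u:{s..t}|lborel. \<phi> u)"
      unfolding set_lebesgue_integral_def
      by (intro Bochner_Integration.integral_cong refl) (auto simp: indicator_def \<phi>_def kk_def)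
    also have "\<dots> = integral {s..t} \<phi>" by (rule set_borel_integral_eq_integral(2)[OF si])
    also have "\<dots> = Psi \<mu> t t - Psi \<mu> t s" by (rule integral_unique[OF hi])
    finally show ?thesis .
  qed
  have "((\<lambda>s. Psi \<mu> t t - Psi \<mu> t s) \<longlongrightarrow> (LINT u|lborel. \<phi> u)) at_bot"
    by (rule Lim_transform_eventually[OF integral_indicator_at_bot[OF int] eventually_mono[OF eventually_le_at_bot[of t] cut]])
  moreover have "((\<lambda>s. Psi \<mu> t t - Psi \<mu> t s) \<longlongrightarrow> Psi \<mu> t t - 0) at_bot"
    by (intro tendsto_diff tendsto_const Psi_vanishes)
  ultimately have "(LINT u|lborel. \<phi> u) = Psi \<mu> t t - 0"
    by (rule tendsto_unique[OF trivial_limit_at_bot_linorder])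
  moreover have "(LINT u|lborel. \<phi> u) = (\<Sum>v\<in>UNIV. LINT u|lborel. kk \<mu> v t u * corrY u $ v)"
    unfolding \<phi>_def by (rule Bochner_Integration.integral_sum) (rule int_v)
  ultimately show ?thesis by (simp add: Psi_end J_pairing[OF W] corrY_component)
qed

end

text \<open>Duality closes here: \<open>corr_identity\<close> holds for every test variable, in
  particular for the difference \<open>D\<close> of the two sides, which gives
  \<open>E D^2 = 0\<close>.\<close>

lemma state_representation:
  "AE \<omega> in M. (\<Sum>i=1..q. \<mu> i \<bullet> X t \<omega> i) = (\<Sum>v\<in>UNIV. J \<mu> t v \<omega>)"
proof -
  define D where "D \<omega> = (\<Sum>i=1..q. \<mu> i \<bullet> X t \<omega> i) - (\<Sum>v\<in>UNIV. J \<mu> t v \<omega>)" for \<omega>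
  have L2X: "L2_rv M (\<lambda>\<omega>. \<mu> i \<bullet> X t \<omega> i)" if "i \<in> {1..q}" for i
    by (rule L2_rv_linear[OF bounded_linear_inner_right X_L2]) (use that qp in auto)
  have D: "L2_rv M D" unfolding D_def[abs_def]
    by (intro L2_rv_diff L2_rv_sum J_L2 L2X)
  have 1: "(LINT \<omega>|M. (\<mu> i \<bullet> X t \<omega> i) * D \<omega>) = \<mu> i \<bullet> corr D i t" if i: "i \<in> {1..q}" for i
  proof -
    have ip: "i \<in> {1..p}" using i qp by auto
    have "(LINT \<omega>|M. (\<mu> i \<bullet> X t \<omega> i) * D \<omega>) = (LINT \<omega>|M. (\<Sum>a\<in>UNIV. \<mu> i $ a * (X t \<omega> i $ a * D \<omega>)))"
      by (simp add: inner_vec_def sum_distrib_right mult.assoc)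
    also have "\<dots> = (\<Sum>a\<in>UNIV. \<mu> i $ a * (LINT \<omega>|M. X t \<omega> i $ a * D \<omega>))"
      by (subst Bochner_Integration.integral_sum)
        (simp_all add: L2_Cauchy_Schwarz(1)[OF X_component_L2[OF D ip] D])
    finally show ?thesis by (simp add: inner_vec_def corr_def[OF D])
  qed
  have int1: "integrable M (\<lambda>\<omega>. (\<mu> i \<bullet> X t \<omega> i) * D \<omega>)" if "i \<in> {1..q}" for i
    by (rule L2_Cauchy_Schwarz(1)[OF L2X[OF that] D])
  have int2: "integrable M (\<lambda>\<omega>. J \<mu> t v \<omega> * D \<omega>)" for v
    by (rule L2_Cauchy_Schwarz(1)[OF J_L2 D])
  have "(LINT \<omega>|M. (D \<omega>)\<^sup>2) = (LINT \<omega>|M. (\<Sum>i=1..q. (\<mu> i \<bullet> X t \<omega> i) * D \<omega>) - (\<Sum>v\<in>UNIV. J \<mu> t v \<omega> * D \<omega>))"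
    by (intro Bochner_Integration.integral_cong refl)
      (simp only: power2_eq_square sum_distrib_right[symmetric] left_diff_distrib[symmetric] D_def)
  also have "\<dots> = (\<Sum>i=1..q. LINT \<omega>|M. (\<mu> i \<bullet> X t \<omega> i) * D \<omega>) - (\<Sum>v\<in>UNIV. LINT \<omega>|M. J \<mu> t v \<omega> * D \<omega>)"
    by (subst Bochner_Integration.integral_diff, (intro Bochner_Integration.integrable_sum int1 int2; assumption)+)
      (subst (1 2) Bochner_Integration.integral_sum, simp_all add: int1 int2)
  also have "(\<Sum>i=1..q. LINT \<omega>|M. (\<mu> i \<bullet> X t \<omega> i) * D \<omega>) = (\<Sum>i=1..q. \<mu> i \<bullet> corr D i t)"
    by (intro sum.cong refl 1)
  also have "\<dots> - (\<Sum>v\<in>UNIV. LINT \<omega>|M. J \<mu> t v \<omega> * D \<omega>) = 0"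
    by (simp only: corr_identity[OF D] diff_self)
  finally have "(LINT \<omega>|M. (D \<omega>)\<^sup>2) = 0" .
  then have "msq M D = 0"
    unfolding msq_def using L2_square_integrable[OF D] by (subst nn_integral_eq_integral) auto
  then have "AE \<omega> in M. D \<omega> = 0" using msq_eq_0_iff[of D M] D by auto
  then show ?thesis by eventually_elim (simp add: D_def)
qed

end

section \<open>The projection formula\<close>

lemma sum_matrix_mult_right: "(\<Sum>i\<in>S. f i) ** G = (\<Sum>i\<in>S. f i ** G)"
  for f :: "'i \<Rightarrow> real^'n^'m" and G :: "real^'k^'n"
  by (induction S rule: infinite_finite_induct) (auto simp: matrix_matrix_mult_def vec_eq_iff distrib_right sum.distrib)

lemma sum_matrix_mult_left: "G ** (\<Sum>i\<in>S. f i) = (\<Sum>i\<in>S. G ** f i)"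
  for f :: "'i \<Rightarrow> real^'n^'m" and G :: "real^'m^'k"
  by (induction S rule: infinite_finite_induct) (auto simp: matrix_add_ldistrib)

lemma sum_triangle_swap:
  fixes g :: "nat \<Rightarrow> nat \<Rightarrow> 'a::comm_monoid_add"
  assumes "0 < N"
  shows "(\<Sum>j=1..N. \<Sum>m<j. g j m) = (\<Sum>m=0..N - 1. \<Sum>j=m + 1..N. g j m)"
proof -
  have "(\<Sum>j=1..N. \<Sum>m<j. g j m) = (\<Sum>j=1..N. \<Sum>m=0..N - 1. if m < j then g j m else 0)"
    by (intro sum.cong refl sum.mono_neutral_cong_left) auto
  also have "\<dots> = (\<Sum>m=0..N - 1. \<Sum>j=1..N. if m < j then g j m else 0)" by (rule sum.swap)
  also have "\<dots> = (\<Sum>m=0..N - 1. \<Sum>j=m + 1..N. g j m)"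
    by (intro sum.cong refl sum.mono_neutral_cong_right) auto
  finally show ?thesis .
qed

lemma E_block_mult:
  assumes "q > 0"
  shows "bmult q (bmult 1 (E_col n) (E_row q)) G l i = (if l = n then G q i else 0)"
proof -
  have "bmult q (bmult 1 (E_col n) (E_row q)) G l i = (\<Sum>r=1..q. if r = q then (if l = n then G q i else 0) else 0)"
    unfolding bmult_def[of q] by (intro sum.cong refl) (auto simp: bmult_def E_col_def E_row_def)
  then show ?thesis using assms by simp
qed

context iccss
begin

abbreviation "Lam \<equiv> Lambda_mat q C"

text \<open>\<open>Lambda_step\<close> iterated \<open>j\<close> times. The identity is algebraic
  and holds for every outcome, because \<open>YD m\<close> is a linear combination of blocks and not
  a limit.\<close>

lemma state_expansion:
  "i \<in> {1..q} \<Longrightarrow> X t \<omega> (i + j) = (\<Sum>l=1..q. bpow q Lam j i l *v X t \<omega> l)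
    + (\<Sum>m<j. bpow q Lam (j - 1 - m) i q *v (Ci *v YD m t \<omega>))"
proof (induction j arbitrary: i)
  case 0
  have "(\<Sum>l=1..q. bpow q Lam 0 i l *v X t \<omega> l) = (\<Sum>l=1..q. if l = i then X t \<omega> l else 0)"
    by (intro sum.cong refl) (simp add: bid_def)
  then show ?case using 0 by simp
next
  case (Suc j)
  let ?Z = "\<lambda>m. Ci *v YD m t \<omega>"
  have "(\<Sum>l=1..q. Lam i l *v X t \<omega> (l + j)) = X t \<omega> (i + 1 + j) - (if i = q then ?Z j else 0)"
    using Lambda_step[OF Suc.prems, of "\<lambda>l. X t \<omega> (l + j)"] by (simp add: YD_def)
  then have "X t \<omega> (i + Suc j) = (\<Sum>l=1..q. Lam i l *v X t \<omega> (l + j)) + (if i = q then ?Z j else 0)"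
    by simp
  also have "(\<Sum>l=1..q. Lam i l *v X t \<omega> (l + j))
      = (\<Sum>l=1..q. Lam i l *v ((\<Sum>r=1..q. bpow q Lam j l r *v X t \<omega> r) + (\<Sum>m<j. bpow q Lam (j - 1 - m) l q *v ?Z m)))"
    by (intro sum.cong refl arg_cong2[where f="(*v)"] Suc.IH)
  also have "\<dots> = (\<Sum>l=1..q. \<Sum>r=1..q. (Lam i l ** bpow q Lam j l r) *v X t \<omega> r)
      + (\<Sum>l=1..q. \<Sum>m<j. (Lam i l ** bpow q Lam (j - 1 - m) l q) *v ?Z m)"
    by (simp add: matrix_vector_right_distrib linear_sum[OF matrix_vector_mul_linear] matrix_vector_mul_assoc sum.distrib matrix_mul_assoc)
  also have "(\<Sum>l=1..q. \<Sum>r=1..q. (Lam i l ** bpow q Lam j l r) *v X t \<omega> r) = (\<Sum>r=1..q. bpow q Lam (Suc j) i r *v X t \<omega> r)"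
    by (subst sum.swap) (simp add: bmult_def sum_matrix_vector_mult)
  also have "(\<Sum>l=1..q. \<Sum>m<j. (Lam i l ** bpow q Lam (j - 1 - m) l q) *v ?Z m) = (\<Sum>m<j. bpow q Lam (Suc (j - 1 - m)) i q *v ?Z m)"
    by (subst sum.swap) (simp add: bmult_def sum_matrix_vector_mult)
  \<comment> \<open>Subtraction is truncated, so the exponents agree only because
    \<open>m < j\<close>.\<close>
  also have "\<dots> = (\<Sum>m<j. bpow q Lam (Suc j - 1 - m) i q *v ?Z m)"
    by (intro sum.cong refl) (auto simp: Suc_diff_Suc simp del: bpow.simps)
  \<comment> \<open>The new term for \<open>m = j\<close> carries the exponent 0, and the block
    \<open>(i, q)\<close> of the identity is nonzero only for \<open>i = q\<close>.\<close>
  also have "(if i = q then ?Z j else 0) = bpow q Lam (Suc j - 1 - j) i q *v ?Z j"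
    by (simp add: bid_def)
  finally show ?case by (simp add: add.assoc del: bpow.simps)
qed

text \<open>Block \<open>q + j\<close> is reached from block \<open>q\<close> in \<open>j\<close>
  steps, so row \<open>q\<close> of the powers of \<open>\<Lambda>\<close> appears. Exchanging the
  order of summation collects the coefficient of each derivative of the output.\<close>

lemma row_expansion:
  "(\<Sum>l=1..p. H l *v X t \<omega> l)
    = (\<Sum>i=1..q. (H i + (\<Sum>j=1..p - q. H (q + j) ** bpow q Lam j q i)) *v X t \<omega> i)
    + (\<Sum>m=0..p - q - 1. (\<Sum>j=m + 1..p - q. H (q + j) ** bpow q Lam (j - 1 - m) q q) *v (Ci *v YD m t \<omega>))"
proof -
  let ?Z = "\<lambda>m. Ci *v YD m t \<omega>"
  have "(\<Sum>l=1..p. H l *v X t \<omega> l) = (\<Sum>l=1..q. H l *v X t \<omega> l) + (\<Sum>l=q + 1..p. H l *v X t \<omega> l)"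
    using sum.ub_add_nat[of 1 q "\<lambda>l. H l *v X t \<omega> l" "p - q"] qp by simp
  also have "(\<Sum>l=q + 1..p. H l *v X t \<omega> l) = (\<Sum>j=1..p - q. H (q + j) *v X t \<omega> (q + j))"
    by (rule sum.reindex_bij_witness[of _ "\<lambda>j. q + j" "\<lambda>l. l - q"]) auto
  also have "\<dots> = (\<Sum>j=1..p - q. H (q + j) *v ((\<Sum>i=1..q. bpow q Lam j q i *v X t \<omega> i) + (\<Sum>m<j. bpow q Lam (j - 1 - m) q q *v ?Z m)))"
    using q_pos by (intro sum.cong refl arg_cong2[where f="(*v)"] state_expansion) auto
  also have "\<dots> = (\<Sum>j=1..p - q. \<Sum>i=1..q. (H (q + j) ** bpow q Lam j q i) *v X t \<omega> i)
      + (\<Sum>j=1..p - q. \<Sum>m<j. (H (q + j) ** bpow q Lam (j - 1 - m) q q) *v ?Z m)"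
    by (simp add: matrix_vector_right_distrib linear_sum[OF matrix_vector_mul_linear] matrix_vector_mul_assoc sum.distrib matrix_mul_assoc)
  also have "(\<Sum>j=1..p - q. \<Sum>i=1..q. (H (q + j) ** bpow q Lam j q i) *v X t \<omega> i)
      = (\<Sum>i=1..q. (\<Sum>j=1..p - q. H (q + j) ** bpow q Lam j q i) *v X t \<omega> i)"
    by (subst sum.swap) (simp add: sum_matrix_vector_mult)
  also have "(\<Sum>j=1..p - q. \<Sum>m<j. (H (q + j) ** bpow q Lam (j - 1 - m) q q) *v ?Z m)
      = (\<Sum>m=0..p - q - 1. (\<Sum>j=m + 1..p - q. H (q + j) ** bpow q Lam (j - 1 - m) q q) *v ?Z m)"
    using qp by (subst sum_triangle_swap) (simp_all add: sum_matrix_vector_mult)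
  finally show ?thesis by (simp add: matrix_vector_mult_add_rdistrib sum.distrib add.assoc)
qed

lemma M_mat_row:
  assumes i: "i \<in> {1..q}"
  shows "M_mat p q A C R h 1 i = bmult p R (bexp p (A_mat p A) h) 1 i
    + (\<Sum>j=1..p - q. bmult p R (bexp p (A_mat p A) h) 1 (q + j) ** bpow q Lam j q i)"
proof -
  let ?H = "\<lambda>l. bmult p R (bexp p (A_mat p A) h) 1 l"
  have "M_mat p q A C R h 1 i = (\<Sum>l=1..p. ?H l ** (bid l i + (\<Sum>j=1..p - q. if l = q + j then bpow q Lam j q i else 0)))"
    unfolding M_mat_def bmult_def[of p "bmult p R (bexp p (A_mat p A) h)"] badd_def bsum_def E_mat_def
      E_block_mult[OF q_pos] ..
  also have "\<dots> = (\<Sum>l=1..p. if l = i then ?H l else 0) + (\<Sum>l=1..p. \<Sum>j=1..p - q. if l = q + j then ?H l ** bpow q Lam j q i else 0)"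
    unfolding matrix_add_ldistrib sum.distrib sum_matrix_mult_left
    by (intro arg_cong2[where f="(+)"] sum.cong refl) (auto simp: bid_def)
  also have "(\<Sum>l=1..p. if l = i then ?H l else 0) = ?H i" using i qp by simp
  also have "(\<Sum>l=1..p. \<Sum>j=1..p - q. if l = q + j then ?H l ** bpow q Lam j q i else 0)
      = (\<Sum>j=1..p - q. \<Sum>l=1..p. if l = q + j then ?H l ** bpow q Lam j q i else 0)"
    by (rule sum.swap)
  also have "\<dots> = (\<Sum>j=1..p - q. ?H (q + j) ** bpow q Lam j q i)"
    by (rule sum.cong[OF refl]) (use qp in auto)
  finally show ?thesis .
qed

lemma Mm_mat_row:
  "Mm_mat p q A C R m h 1 q = (\<Sum>j=m + 1..p - q. bmult p R (bexp p (A_mat p A) h) 1 (q + j) ** bpow q Lam (j - 1 - m) q q)"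
proof -
  let ?H = "\<lambda>l. bmult p R (bexp p (A_mat p A) h) 1 l"
  have "Mm_mat p q A C R m h 1 q = (\<Sum>l=1..p. ?H l ** (\<Sum>j=m + 1..p - q. if l = q + j then bpow q Lam (j - 1 - m) q q else 0))"
    unfolding Mm_mat_def bmult_def[of p "bmult p R (bexp p (A_mat p A) h)"] bsum_def E_block_mult[OF q_pos] ..
  also have "\<dots> = (\<Sum>l=1..p. \<Sum>j=m + 1..p - q. if l = q + j then ?H l ** bpow q Lam (j - 1 - m) q q else 0)"
    unfolding sum_matrix_mult_left by (intro sum.cong refl) auto
  also have "\<dots> = (\<Sum>j=m + 1..p - q. \<Sum>l=1..p. if l = q + j then ?H l ** bpow q Lam (j - 1 - m) q q else 0)"
    by (rule sum.swap)
  also have "\<dots> = (\<Sum>j=m + 1..p - q. ?H (q + j) ** bpow q Lam (j - 1 - m) q q)"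
    by (rule sum.cong[OF refl]) (use qp in auto)
  finally show ?thesis .
qed

lemma bmult_Theta: "bmult q F (Theta_mat q C) 1 1 = F 1 q ** Ci"
proof -
  have "bmult q F (Theta_mat q C) 1 1 = (\<Sum>l=1..q. if l = q then F 1 l ** Ci else 0)"
    unfolding bmult_def by (intro sum.cong refl) (simp add: Theta_mat_def)
  then show ?thesis using q_pos by simp
qed

lemma M_kernel_kap: "M_kernel p q A C R h a v x = kap (\<lambda>i. M_mat p q A C R h 1 i $ a) v x"
proof -
  have "M_kernel p q A C R h a v x = (\<Sum>i=1..q. M_mat p q A C R h 1 i ** (E x i q ** Ci)) $ a $ v"
    unfolding M_kernel_def bmult_Theta bmult_def[of q "M_mat p q A C R h"] sum_matrix_mult_right matrix_mul_assoc ..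
  then show ?thesis unfolding kap_def
    by (simp only: sum_component matrix_matrix_mult_def[of "M_mat p q A C R h 1 i" for i] vec_lambda_beta)
qed

lemma Mm_coeff_eq: "Mm_coeff p q A C R m h a v = (Mm_mat p q A C R m h 1 q ** Ci) $ a $ v"
  unfolding Mm_coeff_def bmult_Theta ..

lemma row_shift:
  "(\<Sum>l=1..p. R 1 l *v X (t + h) \<omega> l)
    = (\<Sum>l=1..p. bmult p R (bexp p (A_mat p A) h) 1 l *v X t \<omega> l) + (\<Sum>l=1..p. R 1 l *v innov t h l \<omega>)"
proof -
  have "(\<Sum>l=1..p. R 1 l *v X (t + h) \<omega> l)
      = (\<Sum>l=1..p. R 1 l *v ((\<Sum>j=1..p. bexp p (A_mat p A) h l j *v X t \<omega> j) + innov t h l \<omega>))"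
    by (simp add: innov_def)
  also have "\<dots> = (\<Sum>l=1..p. \<Sum>j=1..p. (R 1 l ** bexp p (A_mat p A) h l j) *v X t \<omega> j) + (\<Sum>l=1..p. R 1 l *v innov t h l \<omega>)"
    by (simp add: matrix_vector_right_distrib linear_sum[OF matrix_vector_mul_linear] matrix_vector_mul_assoc sum.distrib)
  also have "(\<Sum>l=1..p. \<Sum>j=1..p. (R 1 l ** bexp p (A_mat p A) h l j) *v X t \<omega> j)
      = (\<Sum>j=1..p. bmult p R (bexp p (A_mat p A) h) 1 j *v X t \<omega> j)"
    by (subst sum.swap) (simp add: bmult_def sum_matrix_vector_mult)
  finally show ?thesis .
qed

text \<open>The decomposition of the future value before projecting: the first \<open>q\<close>
  blocks at time \<open>t\<close>, the derivatives of the output at \<open>t\<close>, and the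
  prediction error. No null set is involved yet.\<close>

lemma row_decomposition:
  "(\<Sum>l=1..p. R 1 l *v X (t + h) \<omega> l) $ a
    = (\<Sum>i=1..q. M_mat p q A C R h 1 i $ a \<bullet> X t \<omega> i)
    + (\<Sum>v\<in>UNIV. \<Sum>m=0..p - q - 1. Mm_coeff p q A C R m h a v * YD m t \<omega> $ v)
    + (\<Sum>l=1..p. R 1 l *v innov t h l \<omega>) $ a"
proof -
  have 1: "(\<Sum>i=1..q. (bmult p R (bexp p (A_mat p A) h) 1 i
      + (\<Sum>j=1..p - q. bmult p R (bexp p (A_mat p A) h) 1 (q + j) ** bpow q Lam j q i)) *v X t \<omega> i)
    = (\<Sum>i=1..q. M_mat p q A C R h 1 i *v X t \<omega> i)"
    by (intro sum.cong refl) (simp only: M_mat_row)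
  have 2: "(\<Sum>m=0..p - q - 1. (Mm_mat p q A C R m h 1 q *v (Ci *v YD m t \<omega>)) $ a)
    = (\<Sum>v\<in>UNIV. \<Sum>m=0..p - q - 1. Mm_coeff p q A C R m h a v * YD m t \<omega> $ v)"
    unfolding Mm_coeff_eq matrix_vector_mul_assoc
    by (subst sum.swap) (simp add: matrix_vector_mult_def)
  show ?thesis
    unfolding row_shift row_expansion 1 Mm_mat_row[symmetric] vector_add_component sum_component 2
    by (simp add: matrix_vector_mul_component)
qed

text \<open>Orthogonality is checked for the generators, where it is \<open>innov_orthogonal\<close>
  expanded in coordinates; it extends to finite combinations by linearity and to the closure by
  continuity of the pairing.\<close>

lemma innov_orthogonal_L_space:
  assumes h: "0 \<le> h" and U: "U \<in> L_space M Y S t"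
  shows "(LINT \<omega>|M. complex_of_real ((\<Sum>l=1..p. R 1 l *v innov t h l \<omega>) $ a) * cnj (U \<omega>)) = 0"
proof -
  let ?N = "\<lambda>\<omega>. (\<Sum>l=1..p. R 1 l *v innov t h l \<omega>) $ a"
  have N: "L2_rv M ?N"
    by (intro L2_rv_linear[OF bounded_linear_vec_nth] L2_rv_sum L2_rv_linear[OF matrix_vector_mul_bounded_linear] innov_L2)
  have cN: "L2_rv M (\<lambda>\<omega>. complex_of_real (?N \<omega>))" by (rule L2_rv_linear[OF bounded_linear_of_real N])
  have icomp: "L2_rv M (\<lambda>\<omega>. innov t h l \<omega> $ b)" if "l \<in> {1..p}" for l b
    by (rule L2_rv_linear[OF bounded_linear_vec_nth innov_L2[OF that]])
  have Xcomp: "L2_rv M (\<lambda>\<omega>. X s \<omega> j $ b)" if "j \<in> {1..p}" for s j b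
    by (rule L2_rv_linear[OF bounded_linear_vec_nth X_L2[OF that]])
  have gen: "(LINT \<omega>|M. ?N \<omega> * YD 0 s \<omega> $ v) = 0" if s: "s \<le> t" for s v
  proof -
    have "(LINT \<omega>|M. ?N \<omega> * YD 0 s \<omega> $ v) = (LINT \<omega>|M. (\<Sum>l=1..p. \<Sum>j=0..q. \<Sum>b\<in>UNIV. \<Sum>d\<in>UNIV.
        R 1 l $ a $ b * C j $ v $ d * (innov t h l \<omega> $ b * X s \<omega> (j + 1) $ d)))"
    proof (intro Bochner_Integration.integral_cong refl)
      fix \<omega>
      have "?N \<omega> * YD 0 s \<omega> $ v = (\<Sum>l=1..p. \<Sum>b\<in>UNIV. R 1 l $ a $ b * innov t h l \<omega> $ b)
          * (\<Sum>j=0..q. \<Sum>d\<in>UNIV. C j $ v $ d * X s \<omega> (j + 1) $ d)"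
        by (simp add: YD_def sum_component matrix_vector_mult_def)
      also have "\<dots> = (\<Sum>l=1..p. \<Sum>j=0..q. (\<Sum>b\<in>UNIV. R 1 l $ a $ b * innov t h l \<omega> $ b) * (\<Sum>d\<in>UNIV. C j $ v $ d * X s \<omega> (j + 1) $ d))"
        by (rule sum_product)
      also have "\<dots> = (\<Sum>l=1..p. \<Sum>j=0..q. \<Sum>b\<in>UNIV. \<Sum>d\<in>UNIV.
        R 1 l $ a $ b * C j $ v $ d * (innov t h l \<omega> $ b * X s \<omega> (j + 1) $ d))"
        by (intro sum.cong refl) (simp only: sum_product, intro sum.cong refl, simp add: mult_ac)
      finally show "?N \<omega> * YD 0 s \<omega> $ v = (\<Sum>l=1..p. \<Sum>j=0..q. \<Sum>b\<in>UNIV. \<Sum>d\<in>UNIV.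
        R 1 l $ a $ b * C j $ v $ d * (innov t h l \<omega> $ b * X s \<omega> (j + 1) $ d))" .
    qed
    also have "\<dots> = (\<Sum>l=1..p. \<Sum>j=0..q. \<Sum>b\<in>UNIV. \<Sum>d\<in>UNIV.
        LINT \<omega>|M. R 1 l $ a $ b * C j $ v $ d * (innov t h l \<omega> $ b * X s \<omega> (j + 1) $ d))"
    proof -
      have int: "integrable M (\<lambda>\<omega>. R 1 l $ a $ b * C j $ v $ d * (innov t h l \<omega> $ b * X s \<omega> (j + 1) $ d))"
        if "l \<in> {1..p}" "j \<in> {0..q}" for l j b d
        by (intro integrable_mult_right L2_Cauchy_Schwarz(1) icomp Xcomp) (use that qp in auto)
      let ?f = "\<lambda>l j b d \<omega>. R 1 l $ a $ b * C j $ v $ d * (innov t h l \<omega> $ b * X s \<omega> (j + 1) $ d)"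
      have "(LINT \<omega>|M. (\<Sum>l=1..p. \<Sum>j=0..q. \<Sum>b\<in>UNIV. \<Sum>d\<in>UNIV. ?f l j b d \<omega>))
          = (\<Sum>l=1..p. LINT \<omega>|M. (\<Sum>j=0..q. \<Sum>b\<in>UNIV. \<Sum>d\<in>UNIV. ?f l j b d \<omega>))"
        by (intro Bochner_Integration.integral_sum Bochner_Integration.integrable_sum int)
      also have "\<dots> = (\<Sum>l=1..p. \<Sum>j=0..q. LINT \<omega>|M. (\<Sum>b\<in>UNIV. \<Sum>d\<in>UNIV. ?f l j b d \<omega>))"
        by (intro sum.cong refl Bochner_Integration.integral_sum Bochner_Integration.integrable_sum int)
      also have "\<dots> = (\<Sum>l=1..p. \<Sum>j=0..q. \<Sum>b\<in>UNIV. LINT \<omega>|M. (\<Sum>d\<in>UNIV. ?f l j b d \<omega>))"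
        by (intro sum.cong refl Bochner_Integration.integral_sum Bochner_Integration.integrable_sum int)
      also have "\<dots> = (\<Sum>l=1..p. \<Sum>j=0..q. \<Sum>b\<in>UNIV. \<Sum>d\<in>UNIV. LINT \<omega>|M. ?f l j b d \<omega>)"
        by (intro sum.cong refl Bochner_Integration.integral_sum int)
      finally show ?thesis .
    qed
    also have "\<dots> = 0"
      by (intro sum.neutral ballI) (use s qp h in \<open>simp add: innov_orthogonal\<close>)
    finally show ?thesis .
  qed
  have cgen: "(LINT \<omega>|M. complex_of_real (?N \<omega>) * cnj (coord Y v s \<omega>)) = 0" if "s \<le> t" for s v
  proof -
    have "(LINT \<omega>|M. complex_of_real (?N \<omega>) * cnj (coord Y v s \<omega>)) = (LINT \<omega>|M. complex_of_real (?N \<omega> * YD 0 s \<omega> $ v))"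
      by (simp add: coord_cY cY_def)
    then show ?thesis unfolding integral_complex_of_real gen[OF that] by simp
  qed
  have lin: "(LINT \<omega>|M. cnj (V \<omega>) * complex_of_real (?N \<omega>)) = 0" if V: "V \<in> lin_space Y S t" for V
  proof -
    obtain F d where F: "finite F" "F \<subseteq> S \<times> {..t}" "V = (\<lambda>\<omega>. \<Sum>(s, r)\<in>F. d (s, r) * coord Y s r \<omega>)"
      using V unfolding lin_space_def by blast
    have "(LINT \<omega>|M. cnj (V \<omega>) * complex_of_real (?N \<omega>))
        = (LINT \<omega>|M. (\<Sum>x\<in>F. cnj (d x) * (complex_of_real (?N \<omega>) * cnj (coord Y (fst x) (snd x) \<omega>))))"
      unfolding F(3) by (intro Bochner_Integration.integral_cong refl)
        (simp add: case_prod_unfold sum_distrib_right mult_ac)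
    also have "\<dots> = (\<Sum>x\<in>F. cnj (d x) * (LINT \<omega>|M. complex_of_real (?N \<omega>) * cnj (coord Y (fst x) (snd x) \<omega>)))"
      by (subst Bochner_Integration.integral_sum, intro integrable_mult_right integrable_mult_cnj cN coord_L2)
        (intro sum.cong refl integral_mult_right_zero)
    also have "\<dots> = 0"
    proof (intro sum.neutral ballI)
      fix x assume "x \<in> F"
      then have "snd x \<le> t" using F(2) by auto
      from cgen[OF this, of "fst x"]
      show "cnj (d x) * (LINT \<omega>|M. complex_of_real (?N \<omega>) * cnj (coord Y (fst x) (snd x) \<omega>)) = 0"
        by (simp only: mult_zero_right)
    qed
    finally show ?thesis .
  qed
  have UL: "L2_rv M U" using U by (simp add: L_space_def)
  obtain V where V: "\<And>n. V n \<in> lin_space Y S t" "L2_tendsto M sequentially V U"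
    using U unfolding L_space_def by blast
  have VL: "L2_rv M (V n)" for n by (rule lin_space_L2[OF coord_L2 V(1)])
  have "L2_tendsto M sequentially (\<lambda>n \<omega>. cnj (V n \<omega>)) (\<lambda>\<omega>. cnj (U \<omega>))"
    by (rule L2_tendsto_linear[OF bounded_linear_cnj V(2)]) (use VL UL in auto)
  from L2_tendsto_inner[OF this L2_rv_cnj[OF VL] L2_rv_cnj[OF UL] cN]
  have "(\<lambda>n. 0) \<longlonglongrightarrow> (LINT \<omega>|M. cnj (U \<omega>) * complex_of_real (?N \<omega>))"
    unfolding lin[OF V(1)] .
  then have "(LINT \<omega>|M. cnj (U \<omega>) * complex_of_real (?N \<omega>)) = 0"
    by (simp only: tendsto_const_iff[OF sequentially_bot])
  then show ?thesis by (simp only: mult.commute)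
qed

text \<open>The block row \<open>R\<close> is arbitrary, so that one argument serves both
  \<open>C_mat\<close> and \<open>C_shift\<close>. \<open>Z\<close> is given up to a null set,
  because the derivative in the second formula is a chosen representative.\<close>

lemma projection_formula:
  assumes h: "0 \<le> h" and Z: "Z \<in> borel_measurable M"
    and Z_eq: "AE \<omega> in M. Z \<omega> = complex_of_real ((\<Sum>l=1..p. R 1 l *v X (t + h) \<omega> l) $ a)"
  shows "AE \<omega> in M. L2_proj M (L_space M Y S t) Z \<omega> =
        (\<Sum>v\<in>S. integral_upto M t
           (\<lambda>u \<omega>. of_real (M_kernel p q A C R h a v (t - u)) * coord Y v u \<omega>) \<omega>)
      + (\<Sum>v\<in>S. \<Sum>m=0..p - q - 1. of_real (Mm_coeff p q A C R m h a v) * ms_deriv M m (coord Y v) t \<omega>)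
      + L2_proj M (L_space M Y S t)
          (\<lambda>\<omega>. \<Sum>v\<in>UNIV - S. integral_upto M t
             (\<lambda>u \<omega>. of_real (M_kernel p q A C R h a v (t - u)) * coord Y v u \<omega>) \<omega>) \<omega>
      + L2_proj M (L_space M Y S t)
          (\<lambda>\<omega>. \<Sum>v\<in>UNIV - S. \<Sum>m=0..p - q - 1.
             of_real (Mm_coeff p q A C R m h a v) * ms_deriv M m (coord Y v) t \<omega>) \<omega>"
proof -
  let ?\<mu> = "\<lambda>i. M_mat p q A C R h 1 i $ a"
  define IU where "IU v = integral_upto M t (\<lambda>u \<omega>. of_real (M_kernel p q A C R h a v (t - u)) * coord Y v u \<omega>)" for v
  define DD where "DD v = (\<lambda>\<omega>. \<Sum>m=0..p - q - 1. of_real (Mm_coeff p q A C R m h a v) * ms_deriv M m (coord Y v) t \<omega>)" for v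
  define N where "N = (\<lambda>\<omega>. complex_of_real ((\<Sum>l=1..p. R 1 l *v innov t h l \<omega>) $ a))"
  have mq: "m + q < p" if "m \<in> {0..p - q - 1}" for m using that qp by auto
  have IU_AE: "AE \<omega> in M. IU v \<omega> = of_real (J ?\<mu> t v \<omega>)" for v
    unfolding IU_def by (rule integral_upto_Y(2)) (simp only: M_kernel_kap)
  have IU_in: "IU v \<in> L_space M Y S t" if "v \<in> S" for v S
    unfolding IU_def by (rule integral_upto_Y(3)[OF _ that]) (simp only: M_kernel_kap)
  \<comment> \<open>Square-integrability is read off from membership in the span for all components,
    so it covers the indices outside \<open>S\<close> as well.\<close>
  have IU_L2: "L2_rv M (IU v)" for v
    by (rule L2_subspaceD(1)[OF L_subspace IU_in[of v UNIV]]) simp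
  have DD_in: "DD v \<in> L_space M Y S t" if "v \<in> S" for v S
    unfolding DD_def
    by (intro L2_subspace_sum[OF L_subspace] L2_subspaceD(4)[OF L_subspace] ms_deriv_in_L_space that mq)
  have DD_L2: "L2_rv M (DD v)" for v
    by (rule L2_subspaceD(1)[OF L_subspace DD_in[of v UNIV]]) simp
  have DD_AE: "AE \<omega> in M. DD v \<omega> = of_real (\<Sum>m=0..p - q - 1. Mm_coeff p q A C R m h a v * YD m t \<omega> $ v)" for v
  proof -
    have "AE \<omega> in M. \<forall>m\<in>{0..p - q - 1}. ms_deriv M m (coord Y v) t \<omega> = cY v m t \<omega>"
      by (rule AE_finite_allI) (use ms_deriv_Y mq in auto)
    then show ?thesis by eventually_elim (simp add: DD_def cY_def)
  qed
  have N_L2: "L2_rv M N" unfolding N_def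
    by (intro L2_rv_linear[OF bounded_linear_of_real] L2_rv_linear[OF bounded_linear_vec_nth] L2_rv_sum
        L2_rv_linear[OF matrix_vector_mul_bounded_linear] innov_L2)
  have all_IU: "AE \<omega> in M. \<forall>v\<in>UNIV. IU v \<omega> = of_real (J ?\<mu> t v \<omega>)"
    by (rule AE_finite_allI) (use IU_AE in auto)
  have all_DD: "AE \<omega> in M. \<forall>v\<in>UNIV. DD v \<omega> = of_real (\<Sum>m=0..p - q - 1. Mm_coeff p q A C R m h a v * YD m t \<omega> $ v)"
    by (rule AE_finite_allI) (use DD_AE in auto)
  have split: "(\<Sum>v\<in>UNIV. f v) = (\<Sum>v\<in>S. f v) + (\<Sum>v\<in>UNIV - S. f v)" for f :: "'k \<Rightarrow> complex"
    using sum.subset_diff[of S UNIV f] by (simp add: add.commute)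
  have eq: "AE \<omega> in M. Z \<omega> = ((\<Sum>v\<in>S. IU v \<omega>) + (\<Sum>v\<in>S. DD v \<omega>)) + (\<Sum>v\<in>UNIV - S. IU v \<omega>) + (\<Sum>v\<in>UNIV - S. DD v \<omega>) + N \<omega>"
    using Z_eq state_representation[of ?\<mu> t] all_IU all_DD
  proof eventually_elim
    case (elim \<omega>)
    have "Z \<omega> = of_real (\<Sum>v\<in>UNIV. J ?\<mu> t v \<omega>)
        + of_real (\<Sum>v\<in>UNIV. \<Sum>m=0..p - q - 1. Mm_coeff p q A C R m h a v * YD m t \<omega> $ v) + N \<omega>"
      unfolding elim(1) row_decomposition elim(2) N_def by simp
    also have "complex_of_real (\<Sum>v\<in>UNIV. J ?\<mu> t v \<omega>) = (\<Sum>v\<in>UNIV. IU v \<omega>)"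
      using elim(3) by simp
    also have "complex_of_real (\<Sum>v\<in>UNIV. \<Sum>m=0..p - q - 1. Mm_coeff p q A C R m h a v * YD m t \<omega> $ v) = (\<Sum>v\<in>UNIV. DD v \<omega>)"
      unfolding of_real_sum[of _ UNIV] by (intro sum.cong refl) (use elim(4) in simp)
    finally show ?case unfolding split by (simp add: algebra_simps)
  qed
  have "L2_rv M (\<lambda>\<omega>. ((\<Sum>v\<in>S. IU v \<omega>) + (\<Sum>v\<in>S. DD v \<omega>)) + (\<Sum>v\<in>UNIV - S. IU v \<omega>) + (\<Sum>v\<in>UNIV - S. DD v \<omega>) + N \<omega>)"
    by (intro L2_rv_add L2_rv_sum IU_L2 DD_L2 N_L2)
  with Z msq_cong_AE[OF eq] have Z_L2: "L2_rv M Z" by (simp add: L2_rv_msq)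
  have "AE \<omega> in M. L2_proj M (L_space M Y S t) Z \<omega> = ((\<Sum>v\<in>S. IU v \<omega>) + (\<Sum>v\<in>S. DD v \<omega>))
      + L2_proj M (L_space M Y S t) (\<lambda>\<omega>. \<Sum>v\<in>UNIV - S. IU v \<omega>) \<omega>
      + L2_proj M (L_space M Y S t) (\<lambda>\<omega>. \<Sum>v\<in>UNIV - S. DD v \<omega>) \<omega>"
  proof (rule L2_proj_decomposition[OF prob_space_axioms L_subspace Z_L2 _ _ _ N_L2 _ eq])
    show "(\<lambda>\<omega>. (\<Sum>v\<in>S. IU v \<omega>) + (\<Sum>v\<in>S. DD v \<omega>)) \<in> L_space M Y S t"
      by (intro L2_subspaceD(3)[OF L_subspace] L2_subspace_sum[OF L_subspace] IU_in DD_in)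
    show "L2_rv M (\<lambda>\<omega>. \<Sum>v\<in>UNIV - S. IU v \<omega>)" by (intro L2_rv_sum IU_L2)
    show "L2_rv M (\<lambda>\<omega>. \<Sum>v\<in>UNIV - S. DD v \<omega>)" by (intro L2_rv_sum DD_L2)
    show "(LINT \<omega>|M. N \<omega> * cnj (U \<omega>)) = 0" if "U \<in> L_space M Y S t" for U
      unfolding N_def by (rule innov_orthogonal_L_space[OF h that])
  qed
  then show ?thesis unfolding IU_def DD_def .
qed

end

theorem theorem3p8:
  fixes M :: "'w measure"
    and L Y :: "real \<Rightarrow> 'w \<Rightarrow> real^'k"
    and X :: "real \<Rightarrow> 'w \<Rightarrow> nat \<Rightarrow> real^'k"
    and A C :: "nat \<Rightarrow> real^'k^'k"
    and p q :: nat
    and S :: "'k set" and a :: 'k and h t :: real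
  assumes "prob_space M"
    and "q > 0" and "p > q"
    and "ICCSS M p q A C L X Y"
    and "h \<ge> 0"
  shows "(AE \<omega> in M.
      L2_proj M (L_space M Y S t) (coord Y a (t + h)) \<omega> =
        (\<Sum>v\<in>S. integral_upto M t
           (\<lambda>u \<omega>. of_real (M_kernel p q A C (C_mat q C) h a v (t - u)) * coord Y v u \<omega>) \<omega>)
      + (\<Sum>v\<in>S. \<Sum>m=0..p - q - 1.
           of_real (Mm_coeff p q A C (C_mat q C) m h a v) * ms_deriv M m (coord Y v) t \<omega>)
      + L2_proj M (L_space M Y S t)
          (\<lambda>\<omega>. \<Sum>v\<in>UNIV - S. integral_upto M t
             (\<lambda>u \<omega>. of_real (M_kernel p q A C (C_mat q C) h a v (t - u)) * coord Y v u \<omega>) \<omega>) \<omega>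
      + L2_proj M (L_space M Y S t)
          (\<lambda>\<omega>. \<Sum>v\<in>UNIV - S. \<Sum>m=0..p - q - 1.
             of_real (Mm_coeff p q A C (C_mat q C) m h a v) * ms_deriv M m (coord Y v) t \<omega>) \<omega>)
    \<and> (AE \<omega> in M.
      L2_proj M (L_space M Y S t) (ms_deriv M (p - q - 1) (coord Y a) (t + h)) \<omega> =
        (\<Sum>v\<in>S. integral_upto M t
           (\<lambda>u \<omega>. of_real (M_kernel p q A C (C_shift p q C) h a v (t - u)) * coord Y v u \<omega>) \<omega>)
      + (\<Sum>v\<in>S. \<Sum>m=0..p - q - 1.
           of_real (Mm_coeff p q A C (C_shift p q C) m h a v) * ms_deriv M m (coord Y v) t \<omega>)
      + L2_proj M (L_space M Y S t)
          (\<lambda>\<omega>. \<Sum>v\<in>UNIV - S. integral_upto M t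
             (\<lambda>u \<omega>. of_real (M_kernel p q A C (C_shift p q C) h a v (t - u)) * coord Y v u \<omega>) \<omega>) \<omega>
      + L2_proj M (L_space M Y S t)
          (\<lambda>\<omega>. \<Sum>v\<in>UNIV - S. \<Sum>m=0..p - q - 1.
             of_real (Mm_coeff p q A C (C_shift p q C) m h a v) * ms_deriv M m (coord Y v) t \<omega>) \<omega>)"
proof -
  from assms(4) have levy: "levy_process M L" "integrable M (\<lambda>\<omega>. (norm (L 1 \<omega>))\<^sup>2)" "(LINT \<omega>|M. L 1 \<omega>) = 0"
    and rank: "rank (C q) = CARD('k)"
    and stable: "\<And>z. det (P_poly p A z) = 0 \<Longrightarrow> Re z < 0" "\<And>z. det (Q_poly q C z) = 0 \<Longrightarrow> Re z < 0"
    and input: "input_process M L p A X" and Y: "Y = output_process p q C X"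
    unfolding ICCSS_def by simp_all
  have p0: "p > 0" using assms by simp
  obtain c K where cK: "0 < c" "0 \<le> K"
    "\<And>x i j. x \<ge> 0 \<Longrightarrow> i \<in> {1..p} \<Longrightarrow> j \<in> {1..p} \<Longrightarrow> norm (bexp p (A_mat p A) x i j) \<le> K * exp (- c * x)"
    by (rule bexp_A_mat_decay[of p A], rule p0, erule stable(1), rule that)
  obtain cq Kq where cKq: "0 < cq" "0 \<le> Kq"
    "\<And>x i j. x \<ge> 0 \<Longrightarrow> i \<in> {1..q} \<Longrightarrow> j \<in> {1..q} \<Longrightarrow> norm (bexp q (Lambda_mat q C) x i j) \<le> Kq * exp (- cq * x)"
    by (rule bexp_Lambda_mat_decay[of q C], rule assms(2), rule matrix_inv_full_rank(1)[OF rank], erule stable(2), rule that)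
  interpret square_integrable_levy M L
    using assms(1) levy by (intro square_integrable_levy.intro square_integrable_levy_axioms.intro)
  interpret iccss M L p A X K c q C Kq cq
    using cK cKq input assms(2,3) matrix_inv_full_rank(2)[OF rank] by unfold_locales
  have Ypq: "Y = output_process p q C X" by (rule Y)
  have 1: "AE \<omega> in M. coord Y a (t + h) \<omega> = complex_of_real ((\<Sum>l=1..p. C_mat q C 1 l *v X (t + h) \<omega> l) $ a)"
    unfolding coord_def Y output_process_def by simp
  have pq: "p - q - 1 + q < p" using assms by simp
  \<comment> \<open>Moving the coefficients \<open>p - q - 1\<close> places to the right, relative
    to \<open>C_mat\<close>, selects the blocks of the highest available derivative; its last block
    is \<open>X_p\<close>.\<close>
  have shift: "(\<Sum>l=1..p. C_shift p q C 1 l *v X (t + h) \<omega> l) = YD (p - q - 1) (t + h) \<omega>" for \<omega>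
  proof -
    have "(\<Sum>l=1..p. C_shift p q C 1 l *v X (t + h) \<omega> l) = (\<Sum>l=p - q..p. C (l - (p - q)) *v X (t + h) \<omega> l)"
      using assms by (intro sum.mono_neutral_cong_right) (auto simp: C_shift_def)
    also have "\<dots> = YD (p - q - 1) (t + h) \<omega>" unfolding YD_def
      by (rule sum.reindex_bij_witness[of _ "\<lambda>j. j + (p - q)" "\<lambda>l. l - (p - q)"]) (use assms in auto)
    finally show ?thesis .
  qed
  have 2: "AE \<omega> in M. ms_deriv M (p - q - 1) (coord Y a) (t + h) \<omega>
      = complex_of_real ((\<Sum>l=1..p. C_shift p q C 1 l *v X (t + h) \<omega> l) $ a)"
    using ms_deriv_Y[OF pq, of a "t + h"] unfolding shift Ypq by (simp add: cY_def)
  have m1: "coord Y a (t + h) \<in> borel_measurable M"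
    using coord_L2[of a "t + h"] unfolding Ypq by auto
  have m2: "ms_deriv M (p - q - 1) (coord Y a) (t + h) \<in> borel_measurable M"
    using ms_deriv_Y[OF pq, of a "t + h"] unfolding Ypq by simp
  show ?thesis
    using projection_formula[where R="C_mat q C" and a=a and h=h and t=t and S=S
        and Z="coord Y a (t + h)", OF assms(5) m1 1]
      projection_formula[where R="C_shift p q C" and a=a and h=h and t=t and S=S
        and Z="ms_deriv M (p - q - 1) (coord Y a) (t + h)", OF assms(5) m2 2]
    unfolding Ypq by (rule conjI)
qed

end
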